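(* Let $\Theta$ be a knot vector with simple interior knots $\theta_4,\dots,\theta_n$ and triple knots at the endpoints. (a) We have $I_n-\Gamma S=Z\,D_5D_4D_3$ with a matrix $Z\in\mathbb{R}^{n\times(n-3)}$ whose entries $z_{i,j}$ are zero if $j>i+1$. (b) Let $4\le\ell\le n$ and $p_\ell(x)=(\theta_\ell-x)_+^2$, so that $p_\ell=\Phi_3\mathbf{c}_\ell$ with $\mathbf{c}_\ell=(\mathbf{c}_{\ell,j};1\le j\le n)$, $\mathbf{c}_{\ell,j}=(\theta_\ell-\theta_{j+1})(\theta_\ell-\theta_{j+2})$ for $1\le j\le\ell-3$ and $\mathbf{c}_{\ell,j}=0$ otherwise. Let $(a,b,c,d,e,f)=(\theta_{j+1}-\theta_j;\ \ell-3\le j\le\ell+2)$. Then $$w_\ell:=\mathbf{c}_\ell^TZ=\mu_\ell e_{\ell-4}^T+\kappa_\ell e_{\ell-3}^T+\nu_\ell e_{\ell-2}^T,$$ with the scalar factors $$\mu_\ell=\frac{\bigl(b^2(a+b+c)^2+a(a+b)(b+c)c\bigr)d^4}{600(a+b+c+d)(b+c+d)(c+d)},\qquad \nu_\ell=\frac{\bigl(e^2(d+e+f)^2+f(e+f)(d+e)d\bigr)c^4}{600(c+d+e+f)(c+d+e)(c+d)},$$ $$\kappa_\ell=\frac{P(b,c,d,e)}{600(b+c+d)(b+c+d+e)(c+d)(c+d+e)},$$ where $$\begin{aligned}P(b,c,d,e)={}&c^2(b+c)(c+d)(d+e)^3(b+c+d)^2+c^2d^3(b+c)(c+d+e)(b+c+d+e)^2\\&+c^2d(b+c)(d+e)^2(b+c+d)^2(c+d+e)+c^2d^2(b+c)(c+d)(d+e)(b+c+d+e)^2\\&+bc^2d^2(d+e)^2(b+c+d)(b+c+d+e)+bd^2(b+c)^2(c+d)(d+e)^2(c+d+e)\\&+b^2cd^2(d+e)^3(b+c+d)+b^2cd^3(d+e)^2(b+c+d+e).\end{aligned}$$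 The factor $\kappa_\ell=\kappa_\ell(b,c,d,e)$ is symmetric in the sense $\kappa_\ell(b,c,d,e)=\kappa_\ell(e,c,d,b)=\kappa_\ell(b,d,c,e)=\kappa_\ell(e,d,c,b)$, and its numerator $P$ is a homogeneous polynomial of degree $9$. Furthermore, $$\mathbf{c}_\ell^T\,\Gamma\,D_3^TD_4^TD_5^T=2\,\bigl(N_{6,j}(\theta_\ell);\ 1\le j\le n-3\bigr).$$ (c) Fix indices $4\le\ell_1<\dots<\ell_r\le n$ of interior knots of $\Theta$. Every solution $U_3\in\mathbb{R}^{(n-3)\times(n-3)}$ of the equation $AU_3=B$, where $$A=2\,\bigl[N_{6,k}(\theta_{\ell_j})\bigr]_{j=1,\dots,r;\ k=1,\dots,n-3}\in\mathbb{R}^{r\times(n-3)},\qquad B=\bigl[w_{\ell_j}\bigr]_{j=1,\dots,r}\in\mathbb{R}^{r\times(n-3)}$$ with the row vectors $w_{\ell_j}$ from (b), defines a kernel $L(x,y)=\Phi_3(y)\,S_L\,\Phi_3(x)^T$, $S_L=S+D_3^TD_4^TD_5^T\,U_3\,D_5D_4D_3$, which reproduces all polynomials of degree (at most) $2$ and all truncated powers $(\theta_{\ell_j}-x)_+^2$ with $1\le j\le r$; that is, $\int_\alpha^\beta p(y)L(x,y)\,dy=p(x)$ on $[\alpha,\beta]$ for each of these functions $p$.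
   Context: $\Theta=\{\theta_1\le\dots\le\theta_{n+3}\}$ is a knot vector in an interval $[\alpha,\beta]$ with $\theta_1=\theta_2=\theta_3=\alpha$, $\theta_{n+1}=\theta_{n+2}=\theta_{n+3}=\beta$ and simple interior knots $\alpha<\theta_4<\dots<\theta_n<\beta$. (The letters $a,\dots,f$ are reserved for knot differences.) B-splines of order $s\in\{3,4,5,6\}$: $N_{s,k}(x)=(\theta_{k+s}-\theta_k)\,[\theta_k,\dots,\theta_{k+s}\mid(\cdot-x)_+^{s-1}]$, $1\le k\le n+3-s$ (divided difference; values at $x=\beta$ are left limits). $\Phi_3=(N_{3,1},\dots,N_{3,n})$ (row vector), and $\Gamma=\bigl(\int_\alpha^\beta N_{3,j}N_{3,k}\,dx\bigr)_{1\le j,k\le n}$ is its Gram matrix. With $h_{j,k}=(\theta_{k+j}-\theta_k)/j$, for $s\in\{3,4,5\}$ the matrix $D_s$ has size $(n+2-s)\times(n+3-s)$ with entries $(D_s)_{i,i}=h_{s,i}^{-1}$, $(D_s)_{i,i+1}=-h_{s,i+1}^{-1}$ and all other entries $0$. $S\in\mathbb{R}^{n\times n}$ is the matrix $S=U_0+D_3^TU_1D_3+D_3^TD_4^TU_2D_4D_3$ with diagonal matrices $U_\nu=\mathrm{diag}(u_k^{(\nu)};1\le k\le n-\nu)$, $$u_k^{(0)}=\frac{3}{\theta_{k+3}-\theta_k},\qquad u_k^{(1)}=\frac{F_1(\theta_{k+1},\theta_{k+2},\theta_{k+3})}{6(\theta_{k+4}-\theta_k)},\qquad u_k^{(2)}=\frac{F_2(\theta_{k+1},\dots,\theta_{k+4})}{96(\theta_{k+5}-\theta_k)},$$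 where $F_1(x_1,x_2,x_3)=(x_1-x_2)^2+(x_1-x_3)^2+(x_2-x_3)^2$ and $F_2(x_1,\dots,x_4)=(x_1-x_2)^2(x_3-x_4)^2+(x_1-x_3)^2(x_2-x_4)^2+(x_1-x_4)^2(x_2-x_3)^2$. Recalled from Chui et al. (2004): $S$ is the unique symmetric matrix of bandwidth $2$ (entries $s_{i,j}=0$ for $|i-j|>2$) for which $\int_\alpha^\beta p(y)\Phi_3(y)S\Phi_3(x)^T\,dy=p(x)$ for all polynomials $p$ of degree at most $2$. $e_k$ is the $k$-th canonical unit (column) vector in $\mathbb{R}^{n-3}$ for $1\le k\le n-3$; for $\ell=4$ the term with $e_0$ and for $\ell=n$ the term with $e_{n-2}$ are read as zero (their scalar factors $\mu_4$ and $\nu_n$ are $0$).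
   Formalization: The symmetry chain for κ is false as printed, e.g. κ(1,1,2,2)≠κ(2,1,2,1) and κ(1,1,2,2)≠κ(1,2,1,2); only κ(b,c,d,e)=κ(e,d,c,b) and κ(e,c,d,b)=κ(b,d,c,e) are stated and proved. *)

theory Defs
  imports
    "HOL-Analysis.Analysis"
    "HOL-Computational_Algebra.Polynomial"
    "Jordan_Normal_Form.Matrix"
begin

unbundle no vec_syntax and no inner_syntax

hide_const (open) Finite_Cartesian_Product.vec Finite_Cartesian_Product.mat
  Finite_Cartesian_Product.row
hide_type (open) Finite_Cartesian_Product.vec

text \<open>
  Knots, B-splines, coefficients and unit vectors are numbered from 1 as usual in spline
  theory, whereas vectors and matrices are indexed from 0; hence the shifts by one in
  the entries below. A knot vector is a function whose values at \<open>1, \<dots>, n + 3\<close> are the knots.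
\<close>

definition simple_knot_vector :: "nat \<Rightarrow> real \<Rightarrow> real \<Rightarrow> (nat \<Rightarrow> real) \<Rightarrow> bool" where
  "simple_knot_vector n \<alpha> \<beta> \<theta> \<longleftrightarrow>
     3 \<le> n \<and> \<theta> 1 = \<alpha> \<and> \<theta> 2 = \<alpha> \<and> \<theta> 3 = \<alpha> \<and>
     \<theta> (n + 1) = \<beta> \<and> \<theta> (n + 2) = \<beta> \<and> \<theta> (n + 3) = \<beta> \<and>
     strict_mono_on {3..n + 1} \<theta>"

text \<open>
  Divided differences \<open>[\<theta>\<^sub>k, \<dots>, \<theta>\<^sub>k\<^sub>+\<^sub>m | f]\<close> at nondecreasing, possibly coalescent nodes.
  At coalescent nodes the derivatives of \<open>f\<close> are taken from the left. This is the usual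
  derivative where \<open>f\<close> is smooth. It matters only for truncated powers whose break point
  is a multiple knot, where the choice makes the B-splines continuous from the right (so they
  have the usual values at the left endpoint).
\<close>

definition left_deriv :: "(real \<Rightarrow> real) \<Rightarrow> real \<Rightarrow> real" where
  "left_deriv f t = vector_derivative f (at_left t)"

fun divdiff :: "(nat \<Rightarrow> real) \<Rightarrow> nat \<Rightarrow> nat \<Rightarrow> (real \<Rightarrow> real) \<Rightarrow> real" where
  "divdiff \<theta> k 0 f = f (\<theta> k)"
| "divdiff \<theta> k (Suc m) f =
     (if \<theta> (k + Suc m) = \<theta> k then (left_deriv ^^ Suc m) f (\<theta> k) / fact (Suc m)
      else (divdiff \<theta> (Suc k) m f - divdiff \<theta> k m f) / (\<theta> (k + Suc m) - \<theta> k))"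

definition trunc_pow :: "nat \<Rightarrow> real \<Rightarrow> real \<Rightarrow> real" where
  "trunc_pow m t x = (max 0 (t - x)) ^ m"

definition bspline_interior :: "(nat \<Rightarrow> real) \<Rightarrow> nat \<Rightarrow> nat \<Rightarrow> real \<Rightarrow> real" where
  "bspline_interior \<theta> s k x =
     (\<theta> (k + s) - \<theta> k) * divdiff \<theta> k s (\<lambda>t. trunc_pow (s - 1) t x)"

definition bspline :: "nat \<Rightarrow> (nat \<Rightarrow> real) \<Rightarrow> nat \<Rightarrow> nat \<Rightarrow> real \<Rightarrow> real" where
  "bspline n \<theta> s k x =
     (if x = \<theta> (n + 3) then Lim (at_left x) (bspline_interior \<theta> s k)
      else bspline_interior \<theta> s k x)"

definition Phi3 :: "nat \<Rightarrow> (nat \<Rightarrow> real) \<Rightarrow> real \<Rightarrow> real vec" where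
  "Phi3 n \<theta> x = vec n (\<lambda>i. bspline n \<theta> 3 (i + 1) x)"

definition Gram :: "nat \<Rightarrow> (nat \<Rightarrow> real) \<Rightarrow> real mat" where
  "Gram n \<theta> = mat n n (\<lambda>(i, j).
     integral {\<theta> 1..\<theta> (n + 3)} (\<lambda>x. bspline n \<theta> 3 (i + 1) x * bspline n \<theta> 3 (j + 1) x))"

definition knot_h :: "(nat \<Rightarrow> real) \<Rightarrow> nat \<Rightarrow> nat \<Rightarrow> real" where
  "knot_h \<theta> j k = (\<theta> (k + j) - \<theta> k) / real j"

definition Dmat :: "nat \<Rightarrow> (nat \<Rightarrow> real) \<Rightarrow> nat \<Rightarrow> real mat" where
  "Dmat n \<theta> s = mat (n + 2 - s) (n + 3 - s) (\<lambda>(i, j).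
     if j = i then inverse (knot_h \<theta> s (i + 1))
     else if j = i + 1 then - inverse (knot_h \<theta> s (i + 2))
     else 0)"

definition F1 :: "real \<Rightarrow> real \<Rightarrow> real \<Rightarrow> real" where
  "F1 x1 x2 x3 = (x1 - x2)\<^sup>2 + (x1 - x3)\<^sup>2 + (x2 - x3)\<^sup>2"

definition F2 :: "real \<Rightarrow> real \<Rightarrow> real \<Rightarrow> real \<Rightarrow> real" where
  "F2 x1 x2 x3 x4 =
     (x1 - x2)\<^sup>2 * (x3 - x4)\<^sup>2 + (x1 - x3)\<^sup>2 * (x2 - x4)\<^sup>2 + (x1 - x4)\<^sup>2 * (x2 - x3)\<^sup>2"

definition u0 :: "(nat \<Rightarrow> real) \<Rightarrow> nat \<Rightarrow> real" where
  "u0 \<theta> k = 3 / (\<theta> (k + 3) - \<theta> k)"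

definition u1 :: "(nat \<Rightarrow> real) \<Rightarrow> nat \<Rightarrow> real" where
  "u1 \<theta> k = F1 (\<theta> (k + 1)) (\<theta> (k + 2)) (\<theta> (k + 3)) / (6 * (\<theta> (k + 4) - \<theta> k))"

definition u2 :: "(nat \<Rightarrow> real) \<Rightarrow> nat \<Rightarrow> real" where
  "u2 \<theta> k =
     F2 (\<theta> (k + 1)) (\<theta> (k + 2)) (\<theta> (k + 3)) (\<theta> (k + 4)) / (96 * (\<theta> (k + 5) - \<theta> k))"

definition Smat :: "nat \<Rightarrow> (nat \<Rightarrow> real) \<Rightarrow> real mat" where
  "Smat n \<theta> =
     (let D3 = Dmat n \<theta> 3; D4 = Dmat n \<theta> 4;
          U0 = mat_diag n (\<lambda>i. u0 \<theta> (i + 1));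
          U1 = mat_diag (n - 1) (\<lambda>i. u1 \<theta> (i + 1));
          U2 = mat_diag (n - 2) (\<lambda>i. u2 \<theta> (i + 1))
      in U0 + D3\<^sup>T * U1 * D3 + D3\<^sup>T * D4\<^sup>T * U2 * D4 * D3)"

text \<open>Row vector times matrix; row and column vectors share the type of vectors.\<close>

abbreviation row_mult_mat :: "real vec \<Rightarrow> real mat \<Rightarrow> real vec" (infixl \<open>\<^sub>v*\<close> 70) where
  "v \<^sub>v* M \<equiv> M\<^sup>T *\<^sub>v v"

text \<open>\<open>canon_vec m k\<close> is the zero vector for \<open>k = 0\<close> and for \<open>k > m\<close>.\<close>

definition canon_vec :: "nat \<Rightarrow> nat \<Rightarrow> real vec" where
  "canon_vec m k = vec m (\<lambda>i. if i + 1 = k then 1 else 0)"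

definition cvec :: "nat \<Rightarrow> (nat \<Rightarrow> real) \<Rightarrow> nat \<Rightarrow> real vec" where
  "cvec n \<theta> l = vec n (\<lambda>i. let j = i + 1 in
     if j + 3 \<le> l then (\<theta> l - \<theta> (j + 1)) * (\<theta> l - \<theta> (j + 2)) else 0)"

definition mu :: "real \<Rightarrow> real \<Rightarrow> real \<Rightarrow> real \<Rightarrow> real" where
  "mu a b c d =
     (b\<^sup>2 * (a + b + c)\<^sup>2 + a * (a + b) * (b + c) * c) * d ^ 4 /
     (600 * (a + b + c + d) * (b + c + d) * (c + d))"

definition nu :: "real \<Rightarrow> real \<Rightarrow> real \<Rightarrow> real \<Rightarrow> real" where
  "nu c d e f =
     (e\<^sup>2 * (d + e + f)\<^sup>2 + f * (e + f) * (d + e) * d) * c ^ 4 /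
     (600 * (c + d + e + f) * (c + d + e) * (c + d))"

definition kappa_num :: "real \<Rightarrow> real \<Rightarrow> real \<Rightarrow> real \<Rightarrow> real" where
  "kappa_num b c d e =
       c\<^sup>2 * (b + c) * (c + d) * (d + e) ^ 3 * (b + c + d)\<^sup>2
     + c\<^sup>2 * d ^ 3 * (b + c) * (c + d + e) * (b + c + d + e)\<^sup>2
     + c\<^sup>2 * d * (b + c) * (d + e)\<^sup>2 * (b + c + d)\<^sup>2 * (c + d + e)
     + c\<^sup>2 * d\<^sup>2 * (b + c) * (c + d) * (d + e) * (b + c + d + e)\<^sup>2
     + b * c\<^sup>2 * d\<^sup>2 * (d + e)\<^sup>2 * (b + c + d) * (b + c + d + e)
     + b * d\<^sup>2 * (b + c)\<^sup>2 * (c + d) * (d + e)\<^sup>2 * (c + d + e)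
     + b\<^sup>2 * c * d\<^sup>2 * (d + e) ^ 3 * (b + c + d)
     + b\<^sup>2 * c * d ^ 3 * (d + e)\<^sup>2 * (b + c + d + e)"

definition kappa :: "real \<Rightarrow> real \<Rightarrow> real \<Rightarrow> real \<Rightarrow> real" where
  "kappa b c d e =
     kappa_num b c d e / (600 * (b + c + d) * (b + c + d + e) * (c + d) * (c + d + e))"

text \<open>
  \<open>kappa\<close> is invariant under reversal of its arguments, but not under exchanging only
  the outer or only the inner two.
\<close>

lemma kappa_not_swap_outer: "kappa 1 1 2 2 \<noteq> kappa 2 1 2 1"
  by (simp add: kappa_def kappa_num_def)

lemma kappa_not_swap_inner: "kappa 1 1 2 2 \<noteq> kappa 1 2 1 2"
  by (simp add: kappa_def kappa_num_def)

definition homogeneous_poly4 :: "nat \<Rightarrow> (real \<Rightarrow> real \<Rightarrow> real \<Rightarrow> real \<Rightarrow> real) \<Rightarrow> bool" where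
  "homogeneous_poly4 m f \<longleftrightarrow>
     (\<exists>q :: nat \<times> nat \<times> nat \<times> nat \<Rightarrow> real.
        (\<exists>i j k l. i + j + k + l = m \<and> q (i, j, k, l) \<noteq> 0) \<and>
        (\<forall>b c d e. f b c d e =
           (\<Sum>(i, j, k, l) \<in> {(i, j, k, l). i + j + k + l = m}.
              q (i, j, k, l) * b ^ i * c ^ j * d ^ k * e ^ l)))"

definition spline_kernel :: "nat \<Rightarrow> (nat \<Rightarrow> real) \<Rightarrow> real mat \<Rightarrow> real \<Rightarrow> real \<Rightarrow> real" where
  "spline_kernel n \<theta> M x y = (Phi3 n \<theta> y \<^sub>v* M) \<bullet> Phi3 n \<theta> x"

definition reproduces :: "real \<Rightarrow> real \<Rightarrow> (real \<Rightarrow> real \<Rightarrow> real) \<Rightarrow> (real \<Rightarrow> real) \<Rightarrow> bool" where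
  "reproduces \<alpha> \<beta> L p \<longleftrightarrow>
     (\<forall>x\<in>{\<alpha>..\<beta>}. ((\<lambda>y. p y * L x y) has_integral p x) {\<alpha>..\<beta>})"

end

theory Submission
  imports Defs
begin

text \<open>
  The matrix \<open>S\<close> maps the vector of moments of a quadratic polynomial to its B-spline coefficients; with the
  explicit moments this is a polynomial identity in the knots. So every row of \<open>I - \<Gamma> S\<close> is orthogonal to
  the moments of all quadratics. These span the kernel of \<open>D\<^sub>5 D\<^sub>4 D\<^sub>3\<close>, and the row factors through
  this product because partial sums invert the bidiagonal matrices.

  By the Peano kernel theorem the moments of \<open>p\<^sub>l(x) = (\<theta>\<^sub>l - x)\<^sub>+\<^sup>2\<close> are third divided differences of
  \<open>(\<theta>\<^sub>l - x)\<^sub>+\<^sup>5\<close>, and the three difference matrices turn them into sixth divided differences, that is, into values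
  of B-splines of order 6. The moments of \<open>p\<^sub>l\<close> vanish on the B-splines to the right of \<open>\<theta>\<^sub>l\<close> and agree with those of
  \<open>(\<theta>\<^sub>l - x)\<^sup>2\<close> to the left of it. Hence \<open>w\<^sub>l\<close> has only three nonzero entries: solving the triangular systems from the left
  gives \<open>\<mu>\<^sub>l\<close> and \<open>\<kappa>\<^sub>l\<close>, solving them from the right gives \<open>\<nu>\<^sub>l\<close>.
\<close>

section \<open>Divided differences of jets\<close>

text \<open>The matrix Z is never given by a formula. With D = D_5 D_4 D_3 it enters parts (b) and
  (c) only through the transposed identity D^T Z^T v = v - S Gamma v, and the three factors of D^T
  can be solved one after the other from either end. The obstacle to finding w_l is that the moments
  of the truncated square do not vanish to the left of its break point. Subtracting the moments of
  the full square, which S turns into known coefficients, makes the data vanish on that side, so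
  only entries near the break point survive. In part (c), a kernel with matrix M reproduces the
  spline with coefficients v as soon as M^T Gamma v = v. The correction term contributes D^T U_3^T D
  Gamma v. This is 0 for quadratics, and for the chosen truncated powers the equation for U_3 makes
  it D^T w = v - S Gamma v, exactly what S Gamma v lacks. Transposes are kept throughout because U_3
  may be non-symmetric. The technical difficulty is the triple end knots, where derivatives up to
  order two replace difference quotients.\<close>

text \<open>
  A jet \<open>F\<close> lists the values \<open>F i = f\<^sup>(\<^sup>i\<^sup>) / i!\<close>. Working with jets instead of functions makes
  divided differences linear also at coalescent nodes, without any smoothness assumption.
\<close>

fun jet_dd :: "(nat \<Rightarrow> real) \<Rightarrow> nat \<Rightarrow> nat \<Rightarrow> (nat \<Rightarrow> real \<Rightarrow> real) \<Rightarrow> real" where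
  "jet_dd \<theta> k 0 F = F 0 (\<theta> k)"
| "jet_dd \<theta> k (Suc m) F =
     (if \<theta> (k + Suc m) = \<theta> k then F (Suc m) (\<theta> k)
      else (jet_dd \<theta> (Suc k) m F - jet_dd \<theta> k m F) / (\<theta> (k + Suc m) - \<theta> k))"

text \<open>The recursion consults the i-th component only at a knot that recurs i places later.
  Derivatives therefore have to be known at repeated knots only; the same restriction appears in the
  other jet lemmas.\<close>

lemma divdiff_eq_jet_dd:
  assumes "\<And>j i. k \<le> j \<Longrightarrow> j + i \<le> k + m \<Longrightarrow> \<theta> (j + i) = \<theta> j \<Longrightarrow>
    (left_deriv ^^ i) f (\<theta> j) = fact i * F i (\<theta> j)"
  shows "divdiff \<theta> k m f = jet_dd \<theta> k m F"
  using assms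
proof (induction m arbitrary: k)
  case 0
  from 0[of k 0] show ?case by simp
next
  case (Suc m)
  have "divdiff \<theta> (Suc k) m f = jet_dd \<theta> (Suc k) m F" "divdiff \<theta> k m f = jet_dd \<theta> k m F"
    by (rule Suc.IH, rule Suc.prems; simp)+
  moreover have "\<theta> (k + Suc m) = \<theta> k \<Longrightarrow> (left_deriv ^^ Suc m) f (\<theta> k) = fact (Suc m) * F (Suc m) (\<theta> k)"
    using Suc.prems[of k "Suc m"] by blast
  ultimately show ?case
    by (simp del: funpow.simps fact_Suc)
qed

lemma jet_dd_cong:
  assumes "\<And>j i. k \<le> j \<Longrightarrow> j + i \<le> k + m \<Longrightarrow> \<theta> (j + i) = \<theta> j \<Longrightarrow> F i (\<theta> j) = G i (\<theta> j)"
  shows "jet_dd \<theta> k m F = jet_dd \<theta> k m G"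
  using assms
proof (induction m arbitrary: k)
  case 0
  from 0[of k 0] show ?case by simp
next
  case (Suc m)
  have "jet_dd \<theta> (Suc k) m F = jet_dd \<theta> (Suc k) m G" "jet_dd \<theta> k m F = jet_dd \<theta> k m G"
    by (rule Suc.IH, rule Suc.prems; simp)+
  then show ?case
    using Suc.prems[of k "Suc m"] by simp
qed

lemma jet_dd_zero [simp]: "jet_dd \<theta> k m (\<lambda>i t. 0) = 0"
  by (induction m arbitrary: k) auto

lemma jet_dd_add: "jet_dd \<theta> k m (\<lambda>i t. F i t + G i t) = jet_dd \<theta> k m F + jet_dd \<theta> k m G"
proof (induction m arbitrary: k)
  case (Suc m)
  show ?case
    by (simp add: Suc.IH add_diff_add flip: add_divide_distrib)
qed simp

lemma jet_dd_cmult: "jet_dd \<theta> k m (\<lambda>i t. a * F i t) = a * jet_dd \<theta> k m F"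
proof (induction m arbitrary: k)
  case (Suc m)
  show ?case
    by (simp add: Suc.IH flip: right_diff_distrib)
qed simp

text \<open>A divided difference combines finitely many jet components linearly, so an integral over
  the parameter x can be computed component by component.\<close>

lemma jet_dd_has_integral:
  assumes "\<And>j i. k \<le> j \<Longrightarrow> j + i \<le> k + m \<Longrightarrow> \<theta> (j + i) = \<theta> j \<Longrightarrow>
    ((\<lambda>x. F x i (\<theta> j)) has_integral G i (\<theta> j)) S"
  shows "((\<lambda>x. jet_dd \<theta> k m (F x)) has_integral jet_dd \<theta> k m G) S"
  using assms
proof (induction m arbitrary: k)
  case 0
  from 0[of k 0] show ?case by simp
next
  case (Suc m)
  have "((\<lambda>x. jet_dd \<theta> (Suc k) m (F x)) has_integral jet_dd \<theta> (Suc k) m G) S"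
    "((\<lambda>x. jet_dd \<theta> k m (F x)) has_integral jet_dd \<theta> k m G) S"
    by (rule Suc.IH, rule Suc.prems; simp)+
  from has_integral_divide[OF has_integral_diff[OF this], of "\<theta> (k + Suc m) - \<theta> k"]
  show ?case
    using Suc.prems[of k "Suc m"] by simp
qed

lemma continuous_on_jet_dd:
  assumes "\<And>j i. k \<le> j \<Longrightarrow> j + i \<le> k + m \<Longrightarrow> \<theta> (j + i) = \<theta> j \<Longrightarrow>
    continuous_on S (\<lambda>x. F x i (\<theta> j))"
  shows "continuous_on S (\<lambda>x. jet_dd \<theta> k m (F x))"
  using assms
proof (induction m arbitrary: k)
  case 0
  from 0[of k 0] show ?case by simp
next
  case (Suc m)
  have "continuous_on S (\<lambda>x. jet_dd \<theta> (Suc k) m (F x))"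
    "continuous_on S (\<lambda>x. jet_dd \<theta> k m (F x))"
    by (rule Suc.IH, rule Suc.prems; simp)+
  moreover from this have "continuous_on S
      (\<lambda>x. (jet_dd \<theta> (Suc k) m (F x) - jet_dd \<theta> k m (F x)) / (\<theta> (k + Suc m) - \<theta> k))"
    if "\<theta> (k + Suc m) \<noteq> \<theta> k"
    using that by (intro continuous_on_divide continuous_on_diff continuous_on_const) auto
  ultimately show ?case
    using Suc.prems[of k "Suc m"] by (cases "\<theta> (k + Suc m) = \<theta> k") simp_all
qed

lemma jet_dd_coalescent:
  assumes "\<And>j. k \<le> j \<Longrightarrow> j \<le> k + m \<Longrightarrow> \<theta> j = \<theta> k"
  shows "jet_dd \<theta> k m F = F m (\<theta> k)"
  using assms[of "k + m"] by (cases m) simp_all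

text \<open>Clearing the denominator gives a recursion without case distinction: if the outer knots
  coincide, monotonicity makes all knots between them equal, and both lower differences are the same
  jet component.\<close>

lemma jet_dd_Suc:
  assumes "\<And>i j. k \<le> i \<Longrightarrow> i \<le> j \<Longrightarrow> j \<le> k + Suc m \<Longrightarrow> \<theta> i \<le> \<theta> j"
  shows "jet_dd \<theta> k (Suc m) F * (\<theta> (k + Suc m) - \<theta> k) = jet_dd \<theta> (Suc k) m F - jet_dd \<theta> k m F"
proof (cases "\<theta> (k + Suc m) = \<theta> k")
  case True
  have eq: "\<theta> j = \<theta> k" if "k \<le> j" "j \<le> k + Suc m" for j
    using assms[of k j] assms[of j "k + Suc m"] that True by auto
  have "jet_dd \<theta> i m F = F m (\<theta> i)" if "i = k \<or> i = Suc k" for i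
  proof (rule jet_dd_coalescent)
    show "\<theta> j = \<theta> i" if "i \<le> j" "j \<le> i + m" for j
      using eq[of i] eq[of j] that \<open>i = k \<or> i = Suc k\<close> by auto
  qed
  then show ?thesis
    using True eq[of "Suc k"] by simp
qed auto

section \<open>Divided differences of powers\<close>

definition pow_jet :: "nat \<Rightarrow> real \<Rightarrow> nat \<Rightarrow> real \<Rightarrow> real" where
  "pow_jet r s i t = real (r choose i) * (t - s) ^ (r - i)"

lemma jet_dd_numeral:
  "jet_dd \<theta> k 1 F = (if \<theta> (k + 1) = \<theta> k then F 1 (\<theta> k)
     else (F 0 (\<theta> (k + 1)) - F 0 (\<theta> k)) / (\<theta> (k + 1) - \<theta> k))"
  "jet_dd \<theta> k 2 F = (if \<theta> (k + 2) = \<theta> k then F 2 (\<theta> k)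
     else (jet_dd \<theta> (k + 1) 1 F - jet_dd \<theta> k 1 F) / (\<theta> (k + 2) - \<theta> k))"
  "jet_dd \<theta> k 3 F = (if \<theta> (k + 3) = \<theta> k then F 3 (\<theta> k)
     else (jet_dd \<theta> (k + 1) 2 F - jet_dd \<theta> k 2 F) / (\<theta> (k + 3) - \<theta> k))"
  using jet_dd.simps(2)[of \<theta> k 0 F] jet_dd.simps(2)[of \<theta> k 1 F] jet_dd.simps(2)[of \<theta> k 2 F]
  by (simp_all only: jet_dd.simps(1) Suc_eq_plus1 numeral_plus_one add_num_simps
      one_add_one add_0)

lemma jet_dd_pow2_3: "jet_dd \<theta> k 3 (pow_jet 2 s) = 0"
proof -
  have 1: "jet_dd \<theta> i 1 (pow_jet 2 s) = (\<theta> i - s) + (\<theta> (i + 1) - s)" for i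
  proof (cases "\<theta> (i + 1) = \<theta> i")
    case False
    have "y\<^sup>2 - x\<^sup>2 = (x + y) * (y - x)" for x y :: real
      by (simp add: algebra_simps eval_nat_numeral)
    from this[of "\<theta> (i + 1) - s" "\<theta> i - s"] show ?thesis using False unfolding jet_dd_numeral by (simp add: pow_jet_def)
  qed (unfold jet_dd_numeral, simp add: pow_jet_def)
  have 2: "jet_dd \<theta> i 2 (pow_jet 2 s) = 1" for i
    unfolding jet_dd_numeral(2) 1 by (simp add: pow_jet_def)
  show ?thesis
    unfolding jet_dd_numeral(3) 2 by (simp add: pow_jet_def)
qed

text \<open>The complete homogeneous symmetric polynomial of degree 2. In general the m-th divided
  difference of an r-th power is the complete homogeneous polynomial of degree r - m in the m + 1
  nodes.\<close>

definition hom2 :: "real \<Rightarrow> real \<Rightarrow> real \<Rightarrow> real \<Rightarrow> real" where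
  "hom2 w x y z = w\<^sup>2 + x\<^sup>2 + y\<^sup>2 + z\<^sup>2 + w * x + w * y + w * z + x * y + x * z + y * z"

text \<open>Fifth powers matter because their third derivative is a multiple of a square. Each
  further difference rests on the identity h_d(y,...,z) - h_d(x,y,...) = (z - x) h_{d-1}(x,y,...,z)
  for complete homogeneous polynomials, of degree 4, 3 and 2 in turn.\<close>

lemma jet_dd_pow5_1:
  "jet_dd \<theta> k 1 (pow_jet 5 s) =
    (\<theta> k - s) ^ 4 + (\<theta> k - s) ^ 3 * (\<theta> (k + 1) - s) + (\<theta> k - s)\<^sup>2 * (\<theta> (k + 1) - s)\<^sup>2
    + (\<theta> k - s) * (\<theta> (k + 1) - s) ^ 3 + (\<theta> (k + 1) - s) ^ 4"
    (is "_ = ?r")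
proof (cases "\<theta> (k + 1) = \<theta> k")
  case True
  have "x ^ 4 + x ^ 3 * x + x\<^sup>2 * x\<^sup>2 + x * x ^ 3 + x ^ 4 = 5 * x ^ 4" for x :: real
    by (simp add: algebra_simps eval_nat_numeral)
  then have "?r = 5 * (\<theta> k - s) ^ 4"
    using True by metis
  moreover have "jet_dd \<theta> k 1 (pow_jet 5 s) = 5 * (\<theta> k - s) ^ 4"
    unfolding jet_dd_numeral(1) using True by (simp add: pow_jet_def)
  ultimately show ?thesis
    by metis
next
  case False
  have "y ^ 5 - x ^ 5 = (x ^ 4 + x ^ 3 * y + x\<^sup>2 * y\<^sup>2 + x * y ^ 3 + y ^ 4) * (y - x)" for x y :: real
    by (simp add: algebra_simps eval_nat_numeral)
  from this[of "\<theta> (k + 1) - s" "\<theta> k - s"] show ?thesis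
    unfolding jet_dd_numeral(1) using False by (simp add: pow_jet_def)
qed

lemma jet_dd_pow5_2:
  assumes "\<theta> k \<le> \<theta> (k + 1)" "\<theta> (k + 1) \<le> \<theta> (k + 2)"
  shows "jet_dd \<theta> k 2 (pow_jet 5 s) =
    (\<theta> k - s) ^ 3 + (\<theta> (k + 1) - s) ^ 3 + (\<theta> (k + 2) - s) ^ 3
    + (\<theta> k - s)\<^sup>2 * (\<theta> (k + 1) - s) + (\<theta> k - s)\<^sup>2 * (\<theta> (k + 2) - s)
    + (\<theta> (k + 1) - s)\<^sup>2 * (\<theta> k - s) + (\<theta> (k + 1) - s)\<^sup>2 * (\<theta> (k + 2) - s)
    + (\<theta> (k + 2) - s)\<^sup>2 * (\<theta> k - s) + (\<theta> (k + 2) - s)\<^sup>2 * (\<theta> (k + 1) - s)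
    + (\<theta> k - s) * (\<theta> (k + 1) - s) * (\<theta> (k + 2) - s)"
    (is "_ = ?r")
proof (cases "\<theta> (k + 2) = \<theta> k")
  case True
  then have "\<theta> (k + 1) = \<theta> k"
    using assms by simp
  then have "?r = 10 * (\<theta> k - s) ^ 3"
    using True by (simp add: eval_nat_numeral)
  moreover have "(5 choose 2) = (10::nat)"
    by (simp add: numeral_eq_Suc)
  ultimately show ?thesis
    unfolding jet_dd_numeral(2) using True by (simp add: pow_jet_def)
next
  case False
  have *: "k + 1 + 1 = k + 2" by simp
  have "(y ^ 4 + y ^ 3 * z + y\<^sup>2 * z\<^sup>2 + y * z ^ 3 + z ^ 4)
      - (x ^ 4 + x ^ 3 * y + x\<^sup>2 * y\<^sup>2 + x * y ^ 3 + y ^ 4)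
    = (x ^ 3 + y ^ 3 + z ^ 3 + x\<^sup>2 * y + x\<^sup>2 * z + y\<^sup>2 * x + y\<^sup>2 * z + z\<^sup>2 * x + z\<^sup>2 * y
      + x * y * z) * (z - x)" for x y z :: real
    by (simp add: algebra_simps eval_nat_numeral)
  from this[of "\<theta> (k + 1) - s" "\<theta> (k + 2) - s" "\<theta> k - s"]
  have "jet_dd \<theta> (k + 1) 1 (pow_jet 5 s) - jet_dd \<theta> k 1 (pow_jet 5 s) = ?r * (\<theta> (k + 2) - \<theta> k)"
    unfolding jet_dd_pow5_1 * by simp
  then show ?thesis
    unfolding jet_dd_numeral(2) using False by simp
qed

lemma jet_dd_pow5_3:
  assumes "\<theta> k \<le> \<theta> (k + 1)" "\<theta> (k + 1) \<le> \<theta> (k + 2)" "\<theta> (k + 2) \<le> \<theta> (k + 3)" "\<theta> k \<noteq> \<theta> (k + 3)"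
  shows "jet_dd \<theta> k 3 (pow_jet 5 s) =
    hom2 (\<theta> k - s) (\<theta> (k + 1) - s) (\<theta> (k + 2) - s) (\<theta> (k + 3) - s)"
    (is "_ = ?r")
proof -
  have *: "k + 1 + 1 = k + 2" "k + 1 + 2 = k + 3" by simp_all
  have "(x ^ 3 + y ^ 3 + z ^ 3 + x\<^sup>2 * y + x\<^sup>2 * z + y\<^sup>2 * x + y\<^sup>2 * z + z\<^sup>2 * x + z\<^sup>2 * y + x * y * z)
    - (w ^ 3 + x ^ 3 + y ^ 3 + w\<^sup>2 * x + w\<^sup>2 * y + x\<^sup>2 * w + x\<^sup>2 * y + y\<^sup>2 * w + y\<^sup>2 * x + w * x * y)
    = hom2 w x y z * (z - w)" for w x y z :: real
    by (simp add: hom2_def) (simp add: algebra_simps eval_nat_numeral)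
  from this[of "\<theta> (k + 1) - s" "\<theta> (k + 2) - s" "\<theta> (k + 3) - s" "\<theta> k - s"]
  have "jet_dd \<theta> (k + 1) 2 (pow_jet 5 s) - jet_dd \<theta> k 2 (pow_jet 5 s) = ?r * (\<theta> (k + 3) - \<theta> k)"
    using assms jet_dd_pow5_2[of \<theta> k s] jet_dd_pow5_2[of \<theta> "k + 1" s]
    unfolding * by simp
  then show ?thesis
    unfolding jet_dd_numeral(3) using assms by simp
qed

section \<open>The difference matrices acting on sequences\<close>

text \<open>
  Here sequences are numbered from 1, as in the paper. \<open>bdiff \<theta> s\<close> is the action of \<open>D\<^sub>s\<close>, \<open>adiff \<theta> s\<close> that of
  its transpose, and \<open>sop n \<theta>\<close> that of \<open>S\<close>. Extending a vector by zero (\<open>cutoff\<close>) makes the formula for the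
  transpose valid also in its first and last entry.
\<close>

definition bdiff :: "(nat \<Rightarrow> real) \<Rightarrow> nat \<Rightarrow> (nat \<Rightarrow> real) \<Rightarrow> nat \<Rightarrow> real" where
  "bdiff \<theta> s v k = v k / knot_h \<theta> s k - v (k + 1) / knot_h \<theta> s (k + 1)"

definition adiff :: "(nat \<Rightarrow> real) \<Rightarrow> nat \<Rightarrow> (nat \<Rightarrow> real) \<Rightarrow> nat \<Rightarrow> real" where
  "adiff \<theta> s v k = (v k - v (k - 1)) / knot_h \<theta> s k"

definition cutoff :: "nat \<Rightarrow> (nat \<Rightarrow> real) \<Rightarrow> nat \<Rightarrow> real" where
  "cutoff m v k = (if 1 \<le> k \<and> k \<le> m then v k else 0)"

lemma cutoff_0 [simp]: "cutoff m v 0 = 0"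
  by (simp add: cutoff_def)

lemma cutoff_eq [simp]: "1 \<le> k \<Longrightarrow> k \<le> m \<Longrightarrow> cutoff m v k = v k"
  by (simp add: cutoff_def)

lemma cutoff_gt [simp]: "m < k \<Longrightarrow> cutoff m v k = 0"
  by (simp add: cutoff_def)

lemma cutoff_cong: "(\<And>k. 1 \<le> k \<Longrightarrow> k \<le> m \<Longrightarrow> v k = w k) \<Longrightarrow> cutoff m v = cutoff m w"
  by (auto simp: cutoff_def fun_eq_iff)

lemma bdiff_diff: "bdiff \<theta> s (\<lambda>k. v k - w k) k = bdiff \<theta> s v k - bdiff \<theta> s w k"
  by (simp add: bdiff_def diff_divide_distrib)

lemma adiff_diff: "adiff \<theta> s (\<lambda>k. v k - w k) k = adiff \<theta> s v k - adiff \<theta> s w k"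
  by (simp add: adiff_def diff_divide_distrib)

lemma adiff_add: "adiff \<theta> s (\<lambda>k. v k + w k) k = adiff \<theta> s v k + adiff \<theta> s w k"
  by (simp add: adiff_def add_divide_distrib diff_divide_distrib)

lemma cutoff_diff: "cutoff m (\<lambda>k. v k - w k) = (\<lambda>k. cutoff m v k - cutoff m w k)"
  by (simp add: cutoff_def fun_eq_iff)

lemma cutoff_add: "cutoff m (\<lambda>k. v k + w k) = (\<lambda>k. cutoff m v k + cutoff m w k)"
  by (simp add: cutoff_def fun_eq_iff)

text \<open>Summation by parts. The boundary term at the right end remains and disappears once the
  sequence is cut off there.\<close>

lemma sum_adiff_mult:
  assumes "x 0 = 0"
  shows "(\<Sum>k = 1..Suc N. adiff \<theta> s x k * y k) =
    (\<Sum>k = 1..N. x k * bdiff \<theta> s y k) + x (Suc N) * y (Suc N) / knot_h \<theta> s (Suc N)"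
proof (induction N)
  case (Suc N)
  have "x (Suc N) * y (Suc N) / knot_h \<theta> s (Suc N) + adiff \<theta> s x (Suc (Suc N)) * y (Suc (Suc N))
      = x (Suc N) * bdiff \<theta> s y (Suc N)
        + x (Suc (Suc N)) * y (Suc (Suc N)) / knot_h \<theta> s (Suc (Suc N))"
    by (simp add: adiff_def bdiff_def diff_divide_distrib left_diff_distrib right_diff_distrib)
  moreover have "(\<Sum>k = 1..Suc (Suc N). adiff \<theta> s x k * y k) =
      (\<Sum>k = 1..Suc N. adiff \<theta> s x k * y k) + adiff \<theta> s x (Suc (Suc N)) * y (Suc (Suc N))"
    by simp
  ultimately show ?case
    unfolding Suc.IH by simp
qed (simp add: adiff_def assms)

lemma adiff_partial_sum:
  assumes "1 \<le> k" "knot_h \<theta> s k \<noteq> 0"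
  shows "adiff \<theta> s (\<lambda>k. \<Sum>j = 1..k. v j * knot_h \<theta> s j) k = v k"
proof -
  obtain k' where "k = Suc k'"
    using assms(1) by (cases k) auto
  then show ?thesis
    using assms(2) by (simp add: adiff_def)
qed

text \<open>The transposed difference matrices are triangular seen from either end: a zero at the
  boundary propagates as long as the right-hand side vanishes. The next lemma is the mirror image,
  starting at the right end.\<close>

lemma adiff_zero_left:
  assumes "x 0 = 0" "\<And>k. 1 \<le> k \<Longrightarrow> k \<le> p \<Longrightarrow> adiff \<theta> s x k = 0"
    "\<And>k. 1 \<le> k \<Longrightarrow> k \<le> p \<Longrightarrow> knot_h \<theta> s k \<noteq> 0" "k \<le> p"
  shows "x k = 0"
  using assms(4)
proof (induction k)
  case (Suc k)
  then have "x k = 0" by simp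
  moreover have "adiff \<theta> s x (Suc k) = 0" "knot_h \<theta> s (Suc k) \<noteq> 0"
    using assms(2,3)[of "Suc k"] Suc.prems by simp_all
  ultimately show ?case
    by (simp add: adiff_def)
qed (simp add: assms)

lemma adiff_zero_right:
  assumes "x N = 0" "\<And>k. p < k \<Longrightarrow> k \<le> N \<Longrightarrow> adiff \<theta> s x k = 0"
    "\<And>k. p < k \<Longrightarrow> k \<le> N \<Longrightarrow> knot_h \<theta> s k \<noteq> 0" "p \<le> k" "k \<le> N"
  shows "x k = 0"
  using assms(5,4)
proof (induction rule: inc_induct)
  case (step k)
  then have "x (Suc k) = 0" by simp
  moreover have "adiff \<theta> s x (Suc k) = 0" "knot_h \<theta> s (Suc k) \<noteq> 0"
    using assms(2,3)[of "Suc k"] step by simp_all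
  ultimately show ?case
    by (simp add: adiff_def)
qed (simp add: assms)

definition sop :: "nat \<Rightarrow> (nat \<Rightarrow> real) \<Rightarrow> (nat \<Rightarrow> real) \<Rightarrow> nat \<Rightarrow> real" where
  "sop n \<theta> v k = u0 \<theta> k * v k + adiff \<theta> 3 (cutoff (n - 1) (\<lambda>k. u1 \<theta> k * bdiff \<theta> 3 v k
     + adiff \<theta> 4 (cutoff (n - 2) (\<lambda>k. u2 \<theta> k * bdiff \<theta> 4 (bdiff \<theta> 3 v) k)) k)) k"

lemma sop_diff: "sop n \<theta> (\<lambda>k. v k - w k) k = sop n \<theta> v k - sop n \<theta> w k"
proof -
  have *: "bdiff \<theta> s (\<lambda>k. v k - w k) = (\<lambda>k. bdiff \<theta> s v k - bdiff \<theta> s w k)" for s v w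
    by (simp add: bdiff_diff fun_eq_iff)
  have "(\<lambda>k. u1 \<theta> k * (bdiff \<theta> 3 v k - bdiff \<theta> 3 w k) + (adiff \<theta> 4 x k - adiff \<theta> 4 y k)) =
      (\<lambda>k. (u1 \<theta> k * bdiff \<theta> 3 v k + adiff \<theta> 4 x k) - (u1 \<theta> k * bdiff \<theta> 3 w k + adiff \<theta> 4 y k))" for x y
    by (simp add: algebra_simps fun_eq_iff)
  then show ?thesis
    by (simp add: sop_def * right_diff_distrib cutoff_diff adiff_diff)
qed

section \<open>Knot vectors and the moments of quadratic polynomials\<close>

locale spline_knots =
  fixes n :: nat and \<alpha> \<beta> :: real and \<theta> :: "nat \<Rightarrow> real"
  assumes knots: "simple_knot_vector n \<alpha> \<beta> \<theta>"
begin

lemma n_ge_3: "3 \<le> n"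
  using knots by (simp add: simple_knot_vector_def)

lemma knot_left: "1 \<le> i \<Longrightarrow> i \<le> 3 \<Longrightarrow> \<theta> i = \<alpha>"
proof -
  assume "1 \<le> i" "i \<le> 3"
  then have "i = 1 \<or> i = 2 \<or> i = 3" by auto
  then show ?thesis
    using knots by (auto simp: simple_knot_vector_def)
qed

lemma knot_right: "n + 1 \<le> i \<Longrightarrow> i \<le> n + 3 \<Longrightarrow> \<theta> i = \<beta>"
proof -
  assume "n + 1 \<le> i" "i \<le> n + 3"
  then have "i = n + 1 \<or> i = n + 2 \<or> i = n + 3" by auto
  then show ?thesis
    using knots by (auto simp: simple_knot_vector_def)
qed

lemma knot_less:
  assumes "1 \<le> i" "i < j" "4 \<le> j" "i \<le> n" "j \<le> n + 3"
  shows "\<theta> i < \<theta> j"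
proof -
  have "\<theta> i = \<theta> (max i 3)"
    using knot_left[of i] knot_left[of 3] assms by (cases "i \<le> 3") (auto simp: max_def)
  moreover have "\<theta> j = \<theta> (min j (n + 1))"
    using knot_right[of j] knot_right[of "n + 1"] assms by (cases "j \<le> n + 1") (auto simp: min_def)
  moreover have "strict_mono_on {3..n + 1} \<theta>"
    using knots by (simp add: simple_knot_vector_def)
  then have "\<theta> (max i 3) < \<theta> (min j (n + 1))"
    by (rule strict_mono_onD) (use assms n_ge_3 in auto)
  ultimately show ?thesis by simp
qed

lemma knot_mono:
  assumes "1 \<le> i" "i \<le> j" "j \<le> n + 3"
  shows "\<theta> i \<le> \<theta> j"
proof (cases "i < j \<and> 4 \<le> j \<and> i \<le> n")
  case True
  then show ?thesis
    using knot_less[of i j] assms by auto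
next
  case False
  then have "i = j \<or> j \<le> 3 \<or> n + 1 \<le> i"
    using assms by auto
  then show ?thesis
    using knot_left[of i] knot_left[of j] knot_right[of i] knot_right[of j] assms by auto
qed

lemma knot_coincide:
  assumes "1 \<le> j" "j + i \<le> n + 3" "\<theta> (j + i) = \<theta> j" "0 < i"
  shows "j + i \<le> 3 \<or> n + 1 \<le> j"
proof (rule ccontr)
  assume "\<not> ?thesis"
  then show False
    using knot_less[of j "j + i"] assms by auto
qed

lemma knot_in: "1 \<le> i \<Longrightarrow> i \<le> n + 3 \<Longrightarrow> \<theta> i \<in> {\<alpha>..\<beta>}"
  using knot_mono[of 1 i] knot_mono[of i "n + 3"] knot_left[of 1] knot_right[of "n + 3"] by auto

lemma knot_h_pos: "1 \<le> k \<Longrightarrow> 3 \<le> s \<Longrightarrow> k + s \<le> n + 3 \<Longrightarrow> 0 < knot_h \<theta> s k"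
  using knot_less[of k "k + s"] by (simp add: knot_h_def)

text \<open>The integral of \<open>(s - x)\<^sup>2\<close> against the k-th quadratic B-spline, in
  closed form; \<open>moment_has_integral\<close> confirms this.\<close>

definition moment :: "real \<Rightarrow> nat \<Rightarrow> real" where
  "moment s k = knot_h \<theta> 3 k * hom2 (\<theta> k - s) (\<theta> (k + 1) - s) (\<theta> (k + 2) - s) (\<theta> (k + 3) - s) / 10"

text \<open>The coefficients of \<open>(s - x)\<^sup>2\<close> in Marsden's identity.\<close>

definition coef :: "real \<Rightarrow> nat \<Rightarrow> real" where
  "coef s k = (s - \<theta> (k + 1)) * (s - \<theta> (k + 2))"

text \<open>Division by \<open>knot_h\<close> turns a moment into a third divided difference of a
  fifth power. Each difference operator raises the order by one, so the complete homogeneous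
  polynomial drops to degree 1, then to degree 0, and finally to zero in the two lemmas that
  follow.\<close>

lemma bdiff3_moment:
  assumes "1 \<le> k" "k + 1 \<le> n"
  shows "bdiff \<theta> 3 (moment s) k =
    - (\<theta> (k + 4) - \<theta> k) * (\<theta> k + \<theta> (k + 1) + \<theta> (k + 2) + \<theta> (k + 3) + \<theta> (k + 4) - 5 * s) / 10"
proof -
  have idx: "k + 1 + 1 = k + 2" "k + 1 + 2 = k + 3" "k + 1 + 3 = k + 4" by simp_all
  have "knot_h \<theta> 3 k \<noteq> 0" "knot_h \<theta> 3 (k + 1) \<noteq> 0"
    using knot_h_pos[of k 3] knot_h_pos[of "k + 1" 3] assms by auto
  then have "bdiff \<theta> 3 (moment s) k =
      (hom2 (\<theta> k - s) (\<theta> (k + 1) - s) (\<theta> (k + 2) - s) (\<theta> (k + 3) - s)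
      - hom2 (\<theta> (k + 1) - s) (\<theta> (k + 2) - s) (\<theta> (k + 3) - s) (\<theta> (k + 4) - s)) / 10"
    unfolding bdiff_def moment_def idx by (simp add: diff_divide_distrib)
  moreover have "hom2 (a - s) (b - s) (c - s) (d - s) - hom2 (b - s) (c - s) (d - s) (e - s) =
      - (e - a) * (a + b + c + d + e - 5 * s)" for a b c d e :: real
    by (simp add: hom2_def algebra_simps power2_eq_square)
  ultimately show ?thesis
    by metis
qed

lemma bdiff4_moment:
  assumes "1 \<le> k" "k + 2 \<le> n"
  shows "bdiff \<theta> 4 (bdiff \<theta> 3 (moment s)) k = 2 * (\<theta> (k + 5) - \<theta> k) / 5"
proof -
  have idx: "k + 1 + 1 = k + 2" "k + 1 + 2 = k + 3" "k + 1 + 3 = k + 4" "k + 1 + 4 = k + 5" by simp_all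
  have cancel: "- d * E / 10 / (d / 4) = - 2 * E / 5" if "d \<noteq> 0" for d E :: real
    using that by (simp add: field_simps)
  have "\<theta> (k + 4) - \<theta> k \<noteq> 0" "\<theta> (k + 5) - \<theta> (k + 1) \<noteq> 0"
    using knot_less[of k "k + 4"] knot_less[of "k + 1" "k + 5"] assms by auto
  note cancel[OF this(1)] cancel[OF this(2)]
  moreover have "k + 1 \<le> n" "1 \<le> k + 1" "k + 1 + 1 \<le> n"
    using assms by simp_all
  ultimately show ?thesis
    using assms(1) unfolding bdiff_def[of _ 4] knot_h_def
    by (simp only: bdiff3_moment idx of_nat_numeral) (simp add: field_simps)
qed

lemma bdiff5_moment:
  assumes "1 \<le> k" "k + 3 \<le> n"
  shows "bdiff \<theta> 5 (bdiff \<theta> 4 (bdiff \<theta> 3 (moment s))) k = 0"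
proof -
  have cancel: "2 * d / 5 / (d / 5) = 2" if "d \<noteq> 0" for d :: real
    using that by simp
  have "\<theta> (k + 5) - \<theta> k \<noteq> 0" "\<theta> (k + 1 + 5) - \<theta> (k + 1) \<noteq> 0"
    using knot_less[of k "k + 5"] knot_less[of "k + 1" "k + 1 + 5"] assms by auto
  note cancel[OF this(1)] cancel[OF this(2)]
  moreover have "k + 2 \<le> n" "1 \<le> k + 1" "k + 1 + 2 \<le> n"
    using assms by simp_all
  ultimately show ?thesis
    using assms(1) unfolding bdiff_def[of _ 5] knot_h_def
    by (simp only: bdiff4_moment of_nat_numeral)
qed

end

text \<open>
  Applying \<open>U\<^sub>1 D\<^sub>3 + D\<^sub>4\<^sup>T U\<^sub>2 D\<^sub>4 D\<^sub>3\<close> to the moments of \<open>(s - x)\<^sup>2\<close>, the outer knots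
  cancel and \<open>middle_poly\<close> of the three inner knots remains.
\<close>

definition middle_poly :: "real \<Rightarrow> real \<Rightarrow> real \<Rightarrow> real \<Rightarrow> real" where
  "middle_poly s x y z = - (F1 x y z * (x + y + z - 5 * s)
     + 2 * (z * (x - y)\<^sup>2 + y * (x - z)\<^sup>2 + x * (y - z)\<^sup>2)) / 60"

text \<open>The outer length e - a factors out and cancels against \<open>knot_h\<close> of order 4.
  The outer knots then occur only in e + a, which the \<open>u1\<close> term removes. The next
  identity does the same one level higher with the length d - a.\<close>

lemma F2_diff:
  "F2 b c d e - F2 a b c d =
    (e - a) * ((e + a) * F1 b c d - 2 * (d * (b - c)\<^sup>2 + c * (b - d)\<^sup>2 + b * (c - d)\<^sup>2))"
  by (simp add: F2_def F1_def algebra_simps power2_eq_square)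

lemma middle_poly_diff:
  "(middle_poly s b c d - middle_poly s a b c) * 3 =
    (d - a) * ((s - b) * (s - c) - hom2 (a - s) (b - s) (c - s) (d - s) / 10)"
  by (simp add: middle_poly_def F1_def hom2_def field_simps power2_eq_square)

lemma F1_same [simp]: "F1 x x x = 0"
  by (simp add: F1_def)

text \<open>At the triple end knots the closed formulas vanish by themselves, so they agree with the
  zero extension by \<open>cutoff\<close> one index beyond either end.\<close>

lemma F2_same [simp]: "F2 x x x y = 0" "F2 y x x x = 0"
  by (simp_all add: F2_def)

lemma middle_poly_same [simp]: "middle_poly s x x x = 0"
  by (simp add: middle_poly_def)

context spline_knots
begin

lemma sop_moment:
  assumes k: "1 \<le> k" "k \<le> n"
  shows "sop n \<theta> (moment s) k = coef s k"
proof -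
  \<comment> \<open>The length in the denominator of \<open>u2\<close> cancels against the one in
    \<open>bdiff4_moment\<close>, and 240 = 96 * 5 / 2.\<close>
  let ?F = "\<lambda>k. F2 (\<theta> (k + 1)) (\<theta> (k + 2)) (\<theta> (k + 3)) (\<theta> (k + 4)) / 240"
  let ?A = "\<lambda>k. middle_poly s (\<theta> (k + 1)) (\<theta> (k + 2)) (\<theta> (k + 3))"
  let ?in = "cutoff (n - 2) (\<lambda>k. u2 \<theta> k * bdiff \<theta> 4 (bdiff \<theta> 3 (moment s)) k)"
  have in_eq: "?in k = ?F k" if "k \<le> n - 1" for k
  proof -
    have "k = 0 \<or> k = n - 1 \<or> (1 \<le> k \<and> k + 2 \<le> n)"
      using that by arith
    then consider "k = 0" | "k = n - 1" | "1 \<le> k" "k + 2 \<le> n"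
      by blast
    then show ?thesis
    proof cases
      case 1
      then show ?thesis by (simp add: knot_left)
    next
      case 2
      then show ?thesis using n_ge_3 by (simp add: knot_right)
    next
      case 3
      moreover from 3 have "\<theta> k < \<theta> (k + 5)"
        using knot_less[of k "k + 5"] n_ge_3 by auto
      ultimately show ?thesis
        by (simp add: bdiff4_moment u2_def field_simps)
    qed
  qed
  have mid: "u1 \<theta> k * bdiff \<theta> 3 (moment s) k + adiff \<theta> 4 ?in k = ?A k"
    if k: "1 \<le> k" "k + 1 \<le> n" for k
  proof -
    have ne: "\<theta> (k + 4) - \<theta> k \<noteq> 0"
      using knot_less[of k "k + 4"] k n_ge_3 by auto
    have idx: "k - 1 + 1 = k" "k - 1 + 2 = k + 1" "k - 1 + 3 = k + 2" "k - 1 + 4 = k + 3"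
      and le: "k \<le> n - 1" "k - 1 \<le> n - 1"
      using k by auto
    have df: "?in k - ?in (k - 1) = (\<theta> (k + 4) - \<theta> k) * ((\<theta> (k + 4) + \<theta> k)
        * F1 (\<theta> (k + 1)) (\<theta> (k + 2)) (\<theta> (k + 3)) - 2 * (\<theta> (k + 3) * (\<theta> (k + 1) - \<theta> (k + 2))\<^sup>2
          + \<theta> (k + 2) * (\<theta> (k + 1) - \<theta> (k + 3))\<^sup>2 + \<theta> (k + 1) * (\<theta> (k + 2) - \<theta> (k + 3))\<^sup>2)) / 240"
      unfolding in_eq[OF le(1)] in_eq[OF le(2)] idx F2_diff[symmetric] by (rule diff_divide_distrib[symmetric])
    have cancel: "d * Q / 240 / (d / 4) = Q / 60" if "d \<noteq> 0" for d Q :: real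
      using that by (simp add: field_simps)
    have ad: "adiff \<theta> 4 ?in k = ((\<theta> (k + 4) + \<theta> k)
        * F1 (\<theta> (k + 1)) (\<theta> (k + 2)) (\<theta> (k + 3)) - 2 * (\<theta> (k + 3) * (\<theta> (k + 1) - \<theta> (k + 2))\<^sup>2
          + \<theta> (k + 2) * (\<theta> (k + 1) - \<theta> (k + 3))\<^sup>2 + \<theta> (k + 1) * (\<theta> (k + 2) - \<theta> (k + 3))\<^sup>2)) / 60"
      unfolding adiff_def knot_h_def of_nat_numeral df by (rule cancel[OF ne])
    have "F / (6 * d) * (- d * E / 10) = - F * E / 60" if "d \<noteq> 0" for d E F :: real
      using that by (simp add: field_simps)
    from this[OF ne] have ub: "u1 \<theta> k * bdiff \<theta> 3 (moment s) k =
        - F1 (\<theta> (k + 1)) (\<theta> (k + 2)) (\<theta> (k + 3))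
        * (\<theta> k + \<theta> (k + 1) + \<theta> (k + 2) + \<theta> (k + 3) + \<theta> (k + 4) - 5 * s) / 60"
      unfolding bdiff3_moment[OF k] u1_def by blast
    show ?thesis
      unfolding ad ub middle_poly_def by (simp add: field_simps)
  qed
  have out: "cutoff (n - 1) (\<lambda>k. u1 \<theta> k * bdiff \<theta> 3 (moment s) k + adiff \<theta> 4 ?in k) k = ?A k"
    if "k \<le> n" for k
  proof -
    have "k = 0 \<or> k = n \<or> (1 \<le> k \<and> k + 1 \<le> n)"
      using that by arith
    then consider "k = 0" | "k = n" | "1 \<le> k" "k + 1 \<le> n"
      by blast
    then show ?thesis
    proof cases
      case 1
      then show ?thesis by (simp add: knot_left)
    next
      case 2
      then show ?thesis using n_ge_3 by (simp add: knot_right)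
    next
      case 3
      then show ?thesis by (simp add: mid)
    qed
  qed
  have ne: "\<theta> (k + 3) - \<theta> k \<noteq> 0"
    using knot_less[of k "k + 3"] k n_ge_3 by auto
  have "k - 1 + 1 = k" "k - 1 + 2 = k + 1" "k - 1 + 3 = k + 2"
    using k by auto
  then have "sop n \<theta> (moment s) k = u0 \<theta> k * moment s k +
      (?A k - middle_poly s (\<theta> k) (\<theta> (k + 1)) (\<theta> (k + 2))) / knot_h \<theta> 3 k"
    unfolding sop_def adiff_def[of \<theta> 3] using out[of k] out[of "k - 1"] k by simp
  also have "(?A k - middle_poly s (\<theta> k) (\<theta> (k + 1)) (\<theta> (k + 2))) / knot_h \<theta> 3 k =
      (?A k - middle_poly s (\<theta> k) (\<theta> (k + 1)) (\<theta> (k + 2))) * 3 / (\<theta> (k + 3) - \<theta> k)"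
    by (simp add: knot_h_def)
  also have "\<dots> = (s - \<theta> (k + 1)) * (s - \<theta> (k + 2))
      - hom2 (\<theta> k - s) (\<theta> (k + 1) - s) (\<theta> (k + 2) - s) (\<theta> (k + 3) - s) / 10"
    unfolding middle_poly_diff using ne by simp
  \<comment> \<open>The term from \<open>u0\<close> equals the moment divided by
    \<open>knot_h\<close>, that is \<open>hom2\<close> / 10, and cancels the last summand.\<close>
  finally show ?thesis
    using ne by (simp add: u0_def moment_def[of s k] knot_h_def coef_def)
qed

end

section \<open>Truncated powers\<close>

text \<open>Only u = 0 is delicate. There the difference quotient is
  \<open>max 0 h ^ (m - 1)\<close>, which tends to 0 because m is at least 2.\<close>

lemma max_power_has_real_derivative:
  fixes u :: real
  assumes "2 \<le> m"
  shows "((\<lambda>u. max 0 u ^ m) has_real_derivative real m * max 0 u ^ (m - 1)) (at u)"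
proof -
  consider "u < 0" | "0 < u" | "u = 0" by linarith
  then show ?thesis
  proof cases
    case 1
    have "((\<lambda>u. 0 :: real) has_real_derivative real m * max 0 u ^ (m - 1)) (at u)"
      using 1 assms by (auto intro!: derivative_eq_intros simp: max_def)
    then show ?thesis
      by (rule DERIV_cong_ev[THEN iffD1, rotated 3])
        (use 1 assms in \<open>auto simp: max_def intro!: eventually_mono[OF eventually_nhds_in_open[of "{..<0}"]]\<close>)
  next
    case 2
    have "((\<lambda>u. u ^ m) has_real_derivative real m * max 0 u ^ (m - 1)) (at u)"
      using 2 by (auto intro!: derivative_eq_intros simp: max_def)
    then show ?thesis
      by (rule DERIV_cong_ev[THEN iffD1, rotated 3])
        (use 2 in \<open>auto simp: max_def intro!: eventually_mono[OF eventually_nhds_in_open[of "{0<..}"]]\<close>)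
  next
    case 3
    obtain p where m: "m = Suc (Suc p)"
      using assms by (metis add_2_eq_Suc le_iff_add)
    have "((\<lambda>h::real. max 0 h ^ (m - 1)) \<longlongrightarrow> max 0 0 ^ (m - 1)) (at 0)"
      by (intro tendsto_intros)
    then have "((\<lambda>h::real. max 0 h ^ (m - 1)) \<longlongrightarrow> 0) (at 0)"
      using m by simp
    then have "((\<lambda>h::real. max 0 h ^ m / h) \<longlongrightarrow> 0) (at 0)"
    proof (rule Lim_transform_eventually)
      show "\<forall>\<^sub>F h in at 0. max 0 h ^ (m - 1) = max 0 h ^ m / (h::real)"
        by (auto simp: m eventually_at_filter max_def nonzero_eq_divide_eq intro!: always_eventually)
    qed
    then show ?thesis
      using m 3 by (simp add: DERIV_def power_0_left)
  qed
qed

lemma trunc_pow_has_real_derivative_knot: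
  assumes "2 \<le> m"
  shows "((\<lambda>t. trunc_pow m t x) has_real_derivative real m * trunc_pow (m - 1) t x) (at t within S)"
proof -
  have "((\<lambda>t. max 0 (t - x) ^ m) has_real_derivative real m * max 0 (t - x) ^ (m - 1) * 1) (at t)"
    by (rule DERIV_chain2[OF max_power_has_real_derivative[OF assms]]) (auto intro!: derivative_eq_intros)
  then show ?thesis
    unfolding trunc_pow_def by (simp add: has_field_derivative_at_within)
qed

lemma trunc_pow_has_real_derivative:
  assumes "2 \<le> m"
  shows "((\<lambda>x. trunc_pow m t x) has_real_derivative - real m * trunc_pow (m - 1) t x) (at x within S)"
proof -
  have "((\<lambda>x. max 0 (t - x) ^ m) has_real_derivative real m * max 0 (t - x) ^ (m - 1) * (- 1)) (at x)"
    by (rule DERIV_chain2[OF max_power_has_real_derivative[OF assms]]) (auto intro!: derivative_eq_intros)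
  then show ?thesis
    unfolding trunc_pow_def by (simp add: has_field_derivative_at_within)
qed

lemma left_deriv_eq:
  assumes "(f has_real_derivative d) (at_left t)"
  shows "left_deriv f t = d"
  unfolding left_deriv_def
  by (rule vector_derivative_within)
    (use assms in \<open>auto simp: has_real_derivative_iff_has_vector_derivative trivial_limit_at_left_real\<close>)

lemma left_deriv_trunc_pow:
  assumes "2 \<le> m"
  shows "left_deriv (\<lambda>t. c * trunc_pow m t x) = (\<lambda>t. c * real m * trunc_pow (m - 1) t x)"
proof
  fix t
  have "((\<lambda>t. c * trunc_pow m t x) has_real_derivative c * (real m * trunc_pow (m - 1) t x)) (at_left t)"
    by (rule DERIV_cmult[OF trunc_pow_has_real_derivative_knot[OF assms]])
  then show "left_deriv (\<lambda>t. c * trunc_pow m t x) t = c * real m * trunc_pow (m - 1) t x"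
    by (simp add: left_deriv_eq mult.assoc)
qed

text \<open>The choice of side shows only at t = x: the function is zero to the left, hence the
  strict inequality.\<close>

lemma left_deriv_trunc_pow_1:
  "left_deriv (\<lambda>t. c * trunc_pow 1 t x) t = (if x < t then c else 0)"
proof (rule left_deriv_eq)
  show "((\<lambda>t. c * trunc_pow 1 t x) has_real_derivative (if x < t then c else 0)) (at_left t)"
  proof (cases "x < t")
    case True
    have "((\<lambda>t. c * (t - x)) has_real_derivative c) (at t)"
      by (auto intro!: derivative_eq_intros)
    then have "((\<lambda>t. c * trunc_pow 1 t x) has_real_derivative c) (at t)"
      by (rule DERIV_cong_ev[THEN iffD1, rotated 3])
        (use True in \<open>auto simp: trunc_pow_def max_def
          intro!: eventually_mono[OF eventually_nhds_in_open[of "{x<..}"]]\<close>)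
    then show ?thesis
      using True by (simp add: has_field_derivative_at_within)
  next
    case False
    have "((\<lambda>t. 0) has_real_derivative 0) (at t within {..t})"
      by simp
    then have "((\<lambda>t. c * trunc_pow 1 t x) has_real_derivative 0) (at t within {..t})"
      by (rule has_field_derivative_transform_within[of _ _ _ _ 1])
        (use False in \<open>auto simp: trunc_pow_def\<close>)
    then show ?thesis
      using False by (auto intro: DERIV_subset)
  qed
qed

lemma continuous_on_trunc_pow: "continuous_on S (trunc_pow m t)"
  unfolding trunc_pow_def[abs_def] by (intro continuous_intros)

lemma left_deriv_iter_trunc_pow_2:
  "(left_deriv ^^ 1) (\<lambda>t. trunc_pow 2 t x) t = 2 * trunc_pow 1 t x"
  "(left_deriv ^^ 2) (\<lambda>t. trunc_pow 2 t x) t = (if x < t then 2 else 0)"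
proof -
  have 1: "left_deriv (\<lambda>t. trunc_pow 2 t x) = (\<lambda>t. 2 * trunc_pow 1 t x)"
    using left_deriv_trunc_pow[of 2 1 x] by simp
  then show "(left_deriv ^^ 1) (\<lambda>t. trunc_pow 2 t x) t = 2 * trunc_pow 1 t x"
    by simp
  show "(left_deriv ^^ 2) (\<lambda>t. trunc_pow 2 t x) t = (if x < t then 2 else 0)"
    using left_deriv_trunc_pow_1[of 2 x t] 1 by (simp add: numeral_2_eq_2)
qed

lemma left_deriv_iter_trunc_pow_5:
  "(left_deriv ^^ 1) (\<lambda>t. trunc_pow 5 t x) t = 5 * trunc_pow 4 t x"
  "(left_deriv ^^ 2) (\<lambda>t. trunc_pow 5 t x) t = 20 * trunc_pow 3 t x"
proof -
  have 1: "left_deriv (\<lambda>t. trunc_pow 5 t x) = (\<lambda>t. 5 * trunc_pow 4 t x)"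
    using left_deriv_trunc_pow[of 5 1 x] by simp
  then show "(left_deriv ^^ 1) (\<lambda>t. trunc_pow 5 t x) t = 5 * trunc_pow 4 t x"
    by simp
  show "(left_deriv ^^ 2) (\<lambda>t. trunc_pow 5 t x) t = 20 * trunc_pow 3 t x"
    using left_deriv_trunc_pow[of 4 5 x] 1 by (simp add: numeral_2_eq_2)
qed

lemma jet_dd_pow_low_3:
  assumes "r \<le> 2"
  shows "jet_dd \<theta> k 3 (pow_jet r s) = 0"
proof -
  have "jet_dd \<theta> i 1 (pow_jet 1 s) = 1" "jet_dd \<theta> i 1 (pow_jet 0 s) = 0" for i
    unfolding jet_dd_numeral by (simp_all add: pow_jet_def)
  then have "jet_dd \<theta> i 2 (pow_jet 1 s) = 0" "jet_dd \<theta> i 2 (pow_jet 0 s) = 0" for i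
    unfolding jet_dd_numeral(2) by (simp_all add: pow_jet_def binomial_eq_0)
  then have "jet_dd \<theta> k 3 (pow_jet 1 s) = 0" "jet_dd \<theta> k 3 (pow_jet 0 s) = 0"
    unfolding jet_dd_numeral(3) by (simp_all add: pow_jet_def binomial_eq_0)
  moreover have "r = 0 \<or> r = 1 \<or> r = 2"
    using assms by auto
  ultimately show ?thesis
    using jet_dd_pow2_3 by auto
qed

section \<open>Quadratic B-splines\<close>

context spline_knots
begin

text \<open>
  The component with index 2 is half the second left derivative of \<open>\<lambda>t. trunc_pow 2 t x\<close> only at the two triple
  knots, where it is needed. It is constant in \<open>x\<close>, so that \<open>quad\<close> is continuous up to \<open>x = \<beta>\<close>.
\<close>

definition kernel_jet :: "real \<Rightarrow> nat \<Rightarrow> real \<Rightarrow> real" where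
  "kernel_jet x i t = (if i = 0 then trunc_pow 2 t x else if i = 1 then 2 * trunc_pow 1 t x
     else if t = \<beta> then 1 else 0)"

definition quad :: "nat \<Rightarrow> real \<Rightarrow> real" where
  "quad k x = (\<theta> (k + 3) - \<theta> k) * jet_dd \<theta> k 3 (kernel_jet x)"

lemma alpha_less_beta: "\<alpha> < \<beta>"
  using knot_less[of 3 "n + 1"] knot_left[of 3] knot_right[of "n + 1"] n_ge_3 by simp

text \<open>No knot has multiplicity above three, and only the end knots reach it. So a jet
  comparison involves derivatives up to order two, the second one only at the end points.\<close>

lemma coalescent_cases:
  assumes "1 \<le> j" "j + i \<le> n + 3" "\<theta> (j + i) = \<theta> j"
  obtains "i = 0" | "i = 1" | "i = 2" "\<theta> j = \<alpha>" | "i = 2" "\<theta> j = \<beta>"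
proof (cases "i \<le> 1")
  case True
  then have "i = 0 \<or> i = 1" by auto
  with that(1,2) show thesis by blast
next
  case False
  then have "j + i \<le> 3 \<or> n + 1 \<le> j"
    using knot_coincide[of j i] assms by simp
  then show thesis
  proof
    assume "j + i \<le> 3"
    then have "i = 2" "\<theta> j = \<alpha>"
      using False assms(1) knot_left[of j] by auto
    with that(3) show thesis by blast
  next
    assume "n + 1 \<le> j"
    then have "i = 2" "\<theta> j = \<beta>"
      using False assms(2) knot_right[of j] by auto
    with that(4) show thesis by blast
  qed
qed

lemma continuous_on_quad:
  assumes "1 \<le> k" "k \<le> n"
  shows "continuous_on S (quad k)"
proof -
  have "continuous_on S (\<lambda>x. kernel_jet x i t)" for i t
    unfolding kernel_jet_def
    by (cases "i = 0"; cases "i = 1") (auto intro!: continuous_intros continuous_on_trunc_pow)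
  then have "continuous_on S (\<lambda>x. jet_dd \<theta> k 3 (kernel_jet x))"
    by (intro continuous_on_jet_dd)
  then show ?thesis
    unfolding quad_def[abs_def] by (intro continuous_intros)
qed

lemma bspline_interior_eq_quad:
  assumes "1 \<le> k" "k \<le> n" "\<alpha> \<le> x" "x < \<beta>"
  shows "bspline_interior \<theta> 3 k x = quad k x"
proof -
  have "divdiff \<theta> k 3 (\<lambda>t. trunc_pow 2 t x) = jet_dd \<theta> k 3 (kernel_jet x)"
  proof (rule divdiff_eq_jet_dd)
    fix j i
    assume ji: "k \<le> j" "j + i \<le> k + 3" "\<theta> (j + i) = \<theta> j"
    show "(left_deriv ^^ i) (\<lambda>t. trunc_pow 2 t x) (\<theta> j) = fact i * kernel_jet x i (\<theta> j)"
      by (rule coalescent_cases[of j i])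
        (use ji assms alpha_less_beta left_deriv_iter_trunc_pow_2[of x] in
          \<open>auto simp: kernel_jet_def simp del: funpow.simps\<close>)
  qed
  then show ?thesis
    by (simp add: bspline_interior_def quad_def)
qed

lemma bspline_eq_quad:
  assumes k: "1 \<le> k" "k \<le> n" and x: "x \<in> {\<alpha>..\<beta>}"
  shows "bspline n \<theta> 3 k x = quad k x"
proof (cases "x = \<beta>")
  case False
  then show ?thesis
    using assms bspline_interior_eq_quad[of k x] knot_right[of "n + 3"] by (simp add: bspline_def)
next
  case True
  \<comment> \<open>Continuity of \<open>quad\<close> supplies the left limit by which the B-spline
    is defined at \<open>\<beta>\<close>.\<close>
  have "(quad k \<longlongrightarrow> quad k \<beta>) (at_left \<beta>)"
    using continuous_on_quad[OF k, of UNIV]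
    by (simp add: continuous_on_eq_continuous_at continuous_within_subset[of \<beta> UNIV] isCont_def
        filterlim_at_split)
  then have "(bspline_interior \<theta> 3 k \<longlongrightarrow> quad k \<beta>) (at_left \<beta>)"
  proof (rule Lim_transform_eventually)
    have "eventually (\<lambda>x. x \<in> {\<alpha><..<\<beta>}) (at_left \<beta>)"
      by (rule eventually_at_leftI[OF _ alpha_less_beta])
    then show "\<forall>\<^sub>F x in at_left \<beta>. quad k x = bspline_interior \<theta> 3 k x"
      by eventually_elim (use k in \<open>simp add: bspline_interior_eq_quad\<close>)
  qed
  then have "Lim (at_left \<beta>) (bspline_interior \<theta> 3 k) = quad k \<beta>"
    by (intro tendsto_Lim) (auto simp: trivial_limit_at_left_real)
  then show ?thesis
    using True knot_right[of "n + 3"] by (simp add: bspline_def)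
qed

text \<open>
  In Marsden's identity consecutive Newton interpolants of \<open>\<lambda>t. trunc_pow 2 t x\<close> at three knots differ by
  one term of the sum, which therefore telescopes.
\<close>

definition newton :: "real \<Rightarrow> real \<Rightarrow> nat \<Rightarrow> real" where
  "newton x t j = jet_dd \<theta> j 0 (kernel_jet x) + (t - \<theta> j) * jet_dd \<theta> j 1 (kernel_jet x)
     + (t - \<theta> j) * (t - \<theta> (j + 1)) * jet_dd \<theta> j 2 (kernel_jet x)"

lemma dd_step:
  assumes "1 \<le> k" "k + Suc m \<le> n + 3"
  shows "jet_dd \<theta> k (Suc m) F * (\<theta> (k + Suc m) - \<theta> k) = jet_dd \<theta> (k + 1) m F - jet_dd \<theta> k m F"
  using jet_dd_Suc[of k m \<theta> F] knot_mono assms by simp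

text \<open>Both quadratics interpolate at the two shared knots, so their difference is a multiple
  of \<open>coef t j\<close>. The factor is the difference of the leading coefficients, which is the
  B-spline.\<close>

lemma newton_diff:
  assumes "1 \<le> j" "j \<le> n"
  shows "newton x t (j + 1) - newton x t j = coef t j * quad j x"
proof -
  define f H G E where "f = (\<lambda>j. jet_dd \<theta> j 0 (kernel_jet x))" and "H = (\<lambda>j. jet_dd \<theta> j 1 (kernel_jet x))"
    and "G = (\<lambda>j. jet_dd \<theta> j 2 (kernel_jet x))" and "E = jet_dd \<theta> j 3 (kernel_jet x)"
  have f: "f (j + 1) = f j + H j * (\<theta> (j + 1) - \<theta> j)"
    and H: "H (j + 1) = H j + G j * (\<theta> (j + 2) - \<theta> j)"
    and G: "G (j + 1) = G j + E * (\<theta> (j + 3) - \<theta> j)"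
    using dd_step[of j 0 "kernel_jet x"] dd_step[of j 1 "kernel_jet x"] dd_step[of j 2 "kernel_jet x"] assms
    by (simp_all only: f_def H_def G_def E_def Suc_eq_plus1 one_add_one add_0 numeral_plus_one add_num_simps)
  have "newton x t (j + 1) = f (j + 1) + (t - \<theta> (j + 1)) * H (j + 1)
      + (t - \<theta> (j + 1)) * (t - \<theta> (j + 2)) * G (j + 1)"
    "newton x t j = f j + (t - \<theta> j) * H j + (t - \<theta> j) * (t - \<theta> (j + 1)) * G j"
    by (simp_all add: newton_def f_def H_def G_def)
  then show ?thesis
    unfolding f H G quad_def coef_def E_def[symmetric] by (simp add: algebra_simps)
qed

lemma newton_sum:
  assumes "m \<le> n"
  shows "(\<Sum>j = 1..m. coef t j * quad j x) = newton x t (m + 1) - newton x t 1"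
  using assms by (induction m) (simp_all add: newton_diff[symmetric])

text \<open>At three equal nodes the Newton interpolant is a Taylor polynomial. At \<alpha> it is
  that of the zero function; at \<beta>, in the next lemma, it is that of
  \<open>(t - x)\<^sup>2\<close>.\<close>

lemma newton_first:
  assumes "\<alpha> \<le> x"
  shows "newton x t 1 = 0"
proof -
  have "jet_dd \<theta> 1 0 F = F 0 \<alpha>" "jet_dd \<theta> 1 1 F = F 1 \<alpha>" "jet_dd \<theta> 1 2 F = F 2 \<alpha>" for F
    using knot_left[of 1] knot_left[of 2] knot_left[of 3]
    unfolding jet_dd_numeral by (simp_all add: numeral_2_eq_2 numeral_3_eq_3)
  then show ?thesis
    using assms alpha_less_beta knot_left[of 1] unfolding newton_def by (simp add: kernel_jet_def trunc_pow_def)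
qed

lemma newton_last:
  assumes "x \<le> \<beta>"
  shows "newton x t (n + 1) = (t - x)\<^sup>2"
proof -
  have *: "jet_dd \<theta> (n + 1) 0 F = F 0 \<beta>" "jet_dd \<theta> (n + 1) 1 F = F 1 \<beta>"
      "jet_dd \<theta> (n + 1) 2 F = F 2 \<beta>" for F
    using knot_right[of "n + 1"] knot_right[of "n + 2"] knot_right[of "n + 3"]
    unfolding jet_dd_numeral by (simp_all add: numeral_2_eq_2 numeral_3_eq_3)
  have "newton x t (n + 1) = (\<beta> - x)\<^sup>2 + (t - \<beta>) * (2 * (\<beta> - x)) + (t - \<beta>) * (t - \<beta>)"
    using assms knot_right[of "n + 1"] knot_right[of "n + 2"]
    unfolding newton_def * by (simp add: kernel_jet_def trunc_pow_def)
  then show ?thesis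
    by (simp add: power2_eq_square algebra_simps)
qed

lemma newton_at_knot:
  assumes "1 \<le> j" "j + 2 \<le> n + 3"
  shows "newton x (\<theta> (j + 2)) j = trunc_pow 2 (\<theta> (j + 2)) x"
proof -
  define f H G where "f = (\<lambda>j. jet_dd \<theta> j 0 (kernel_jet x))" and "H = (\<lambda>j. jet_dd \<theta> j 1 (kernel_jet x))"
    and "G = jet_dd \<theta> j 2 (kernel_jet x)"
  have f: "f (j + 1) = f j + H j * (\<theta> (j + 1) - \<theta> j)"
      "f (j + 2) = f (j + 1) + H (j + 1) * (\<theta> (j + 2) - \<theta> (j + 1))"
    and H: "H (j + 1) = H j + G * (\<theta> (j + 2) - \<theta> j)"
    using dd_step[of j 0 "kernel_jet x"] dd_step[of "j + 1" 0 "kernel_jet x"] dd_step[of j 1 "kernel_jet x"] assms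
    by (simp_all add: f_def H_def G_def numeral_2_eq_2)
  have "newton x (\<theta> (j + 2)) j = f j + (\<theta> (j + 2) - \<theta> j) * H j
      + (\<theta> (j + 2) - \<theta> j) * (\<theta> (j + 2) - \<theta> (j + 1)) * G"
    by (simp add: newton_def f_def H_def G_def)
  also have "\<dots> = f (j + 2)"
    unfolding f H by (simp add: algebra_simps)
  finally show ?thesis
    by (simp add: f_def kernel_jet_def)
qed

lemma marsden:
  assumes "x \<in> {\<alpha>..\<beta>}"
  shows "(\<Sum>j = 1..n. coef t j * quad j x) = (t - x)\<^sup>2"
  using newton_sum[of n] newton_first[of x] newton_last[of x] assms by simp

definition trunc_coef :: "nat \<Rightarrow> nat \<Rightarrow> real" where
  "trunc_coef l j = (if j + 3 \<le> l then coef (\<theta> l) j else 0)"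

text \<open>Stopping Marsden's sum at l - 3 leaves the interpolant with nodes of index l - 2, l - 1,
  l. Evaluated at its last node it returns the interpolated truncated power.\<close>

lemma trunc_marsden:
  assumes "x \<in> {\<alpha>..\<beta>}" "3 \<le> l" "l \<le> n + 3"
  shows "(\<Sum>j = 1..n. trunc_coef l j * quad j x) = trunc_pow 2 (\<theta> l) x"
proof -
  obtain i where l: "l = i + 3"
    using assms(2) by (metis add.commute le_iff_add)
  have "(\<Sum>j = 1..n. trunc_coef l j * quad j x) = (\<Sum>j = 1..i. coef (\<theta> l) j * quad j x)"
    using assms by (intro sum.mono_neutral_cong_right) (auto simp: trunc_coef_def l)
  also have "\<dots> = newton x (\<theta> l) (i + 1)"
    using assms newton_first[of x] by (subst newton_sum) (auto simp: l)
  also have "\<dots> = trunc_pow 2 (\<theta> l) x"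
    using newton_at_knot[of "i + 1" x] assms by (simp add: l numeral_3_eq_3)
  finally show ?thesis .
qed


section \<open>Integrals against quadratic B-splines\<close>

text \<open>Taylor's formula with integral remainder. The truncation moves the upper limit t into
  the integrand, so all nodes share one domain of integration and divided differences in t can be
  taken.\<close>

lemma trunc_taylor_has_integral:
  fixes g :: "nat \<Rightarrow> real \<Rightarrow> real"
  assumes g: "\<And>m t. m < p \<Longrightarrow> t \<in> {\<alpha>..\<beta>} \<Longrightarrow>
      (g m has_real_derivative g (Suc m) t) (at t within {\<alpha>..\<beta>})"
    and p: "2 \<le> p" and t: "t \<in> {\<alpha>..\<beta>}"
  shows "((\<lambda>x. g p x * trunc_pow (p - 1) t x) has_integral
    fact (p - 1) * (g 0 t - (\<Sum>i<p. (t - \<alpha>) ^ i / fact i * g i \<alpha>))) {\<alpha>..\<beta>}"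
proof -
  have "((\<lambda>x. ((t - x) ^ (p - 1) / fact (p - 1)) *\<^sub>R g p x) has_integral
      g 0 t - (\<Sum>i<p. ((t - \<alpha>) ^ i / fact i) *\<^sub>R g i \<alpha>)) {\<alpha>..t}"
  proof (rule Taylor_has_integral)
    show "(g m has_vector_derivative g (Suc m) x) (at x within {\<alpha>..t})"
      if "m < p" "\<alpha> \<le> x" "x \<le> t" for m x
      using DERIV_subset[OF g[OF that(1)], of x "{\<alpha>..t}"] that t
      by (simp add: has_real_derivative_iff_has_vector_derivative)
  qed (use p t in auto)
  from has_integral_mult_right[OF this, of "fact (p - 1)"]
  have "((\<lambda>x. g p x * (t - x) ^ (p - 1)) has_integral
      fact (p - 1) * (g 0 t - (\<Sum>i<p. (t - \<alpha>) ^ i / fact i * g i \<alpha>))) {\<alpha>..t}"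
    by (simp add: mult.commute)
  then have "((\<lambda>x. g p x * trunc_pow (p - 1) t x) has_integral
      fact (p - 1) * (g 0 t - (\<Sum>i<p. (t - \<alpha>) ^ i / fact i * g i \<alpha>))) {\<alpha>..t}"
    by (rule has_integral_eq[rotated]) (auto simp: trunc_pow_def)
  moreover have "((\<lambda>x. g p x * trunc_pow (p - 1) t x) has_integral 0) {t..\<beta>}"
    by (rule has_integral_is_0) (use p in \<open>auto simp: trunc_pow_def\<close>)
  ultimately have "((\<lambda>x. g p x * trunc_pow (p - 1) t x) has_integral
      fact (p - 1) * (g 0 t - (\<Sum>i<p. (t - \<alpha>) ^ i / fact i * g i \<alpha>)) + 0) {\<alpha>..\<beta>}"
    using t by (intro has_integral_combine[of \<alpha> t \<beta>]) auto
  then show ?thesis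
    by simp
qed

text \<open>
  Third divided differences annihilate the quadratic Taylor polynomial at \<open>\<alpha>\<close>, so only \<open>g\<close> itself
  remains on the right-hand side.
\<close>

lemma peano_kernel:
  fixes g :: "nat \<Rightarrow> real \<Rightarrow> real"
  assumes g: "\<And>m t. m < 3 \<Longrightarrow> t \<in> {\<alpha>..\<beta>} \<Longrightarrow>
      (g m has_real_derivative g (Suc m) t) (at t within {\<alpha>..\<beta>})"
    and k: "1 \<le> k" "k \<le> n"
  shows "((\<lambda>x. g 3 x * quad k x) has_integral
    6 * knot_h \<theta> 3 k * jet_dd \<theta> k 3 (\<lambda>i t. g i t / fact i)) {\<alpha>..\<beta>}"
proof -
  \<comment> \<open>\<open>T\<close> is twice the jet of the quadratic Taylor polynomial at
    \<alpha>. The factor 2 is the factorial in the remainder formula for a quadratic kernel.\<close>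
  define T where "T = (\<lambda>i t. 2 * (g 0 \<alpha>) * pow_jet 0 \<alpha> i t
    + (2 * g 1 \<alpha> * pow_jet 1 \<alpha> i t + g 2 \<alpha> * pow_jet 2 \<alpha> i t))"
  define G where "G = (\<lambda>i t. 2 * (g i t / fact i) + (- 1) * T i t)"
  have int: "((\<lambda>x. g 3 x * kernel_jet x i (\<theta> j)) has_integral G i (\<theta> j)) {\<alpha>..\<beta>}"
    if ji: "k \<le> j" "j + i \<le> k + 3" "\<theta> (j + i) = \<theta> j" for j i
  proof -
    have t: "\<theta> j \<in> {\<alpha>..\<beta>}"
      using knot_in[of j] ji k by auto
    have j: "1 \<le> j" "j + i \<le> n + 3"
      using ji k by auto
    show ?thesis
    proof (rule coalescent_cases[OF j ji(3)])
      assume i: "i = 0"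
      have "((\<lambda>x. g 3 x * trunc_pow (3 - 1) (\<theta> j) x) has_integral fact (3 - 1) *
          (g 0 (\<theta> j) - (\<Sum>i<3. (\<theta> j - \<alpha>) ^ i / fact i * g i \<alpha>))) {\<alpha>..\<beta>}"
        by (rule trunc_taylor_has_integral) (use g t in auto)
      moreover have "fact (3 - 1) * (g 0 (\<theta> j) - (\<Sum>i<3. (\<theta> j - \<alpha>) ^ i / fact i * g i \<alpha>)) = G 0 (\<theta> j)"
        by (simp add: G_def T_def pow_jet_def eval_nat_numeral field_simps)
      ultimately show ?thesis
        using i by (simp add: kernel_jet_def)
    next
      assume i: "i = 1"
      have "((\<lambda>x. g (Suc 2) x * trunc_pow (2 - 1) (\<theta> j) x) has_integral fact (2 - 1) *
          (g (Suc 0) (\<theta> j) - (\<Sum>i<2. (\<theta> j - \<alpha>) ^ i / fact i * g (Suc i) \<alpha>))) {\<alpha>..\<beta>}"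
        by (rule trunc_taylor_has_integral) (use g t in auto)
      from has_integral_mult_right[OF this, of 2]
      have "((\<lambda>x. g 3 x * (2 * trunc_pow 1 (\<theta> j) x)) has_integral
          2 * (g 1 (\<theta> j) - (\<Sum>i<2. (\<theta> j - \<alpha>) ^ i / fact i * g (Suc i) \<alpha>))) {\<alpha>..\<beta>}"
        by (simp add: mult.left_commute)
      moreover have "2 * (g 1 (\<theta> j) - (\<Sum>i<2. (\<theta> j - \<alpha>) ^ i / fact i * g (Suc i) \<alpha>)) = G 1 (\<theta> j)"
        by (simp add: G_def T_def pow_jet_def eval_nat_numeral algebra_simps)
      ultimately show ?thesis
        using i by (simp add: kernel_jet_def)
    next
      \<comment> \<open>At \<alpha> both sides vanish. At \<beta> the second component of the kernel
        is 1, and the claim is the fundamental theorem of calculus.\<close>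
      assume i: "i = 2" and "\<theta> j = \<alpha>"
      then show ?thesis
        using alpha_less_beta by (simp add: G_def T_def kernel_jet_def pow_jet_def binomial_eq_0)
    next
      assume i: "i = 2" and tb: "\<theta> j = \<beta>"
      have "(g 3 has_integral g 2 \<beta> - g 2 \<alpha>) {\<alpha>..\<beta>}"
        using alpha_less_beta g[of 2]
        by (intro fundamental_theorem_of_calculus)
          (auto simp: numeral_3_eq_3 numeral_2_eq_2 simp flip: has_real_derivative_iff_has_vector_derivative)
      then show ?thesis
        using i tb by (simp add: G_def T_def kernel_jet_def pow_jet_def binomial_eq_0)
    qed
  qed
  have "((\<lambda>x. jet_dd \<theta> k 3 (\<lambda>i t. g 3 x * kernel_jet x i t)) has_integral jet_dd \<theta> k 3 G) {\<alpha>..\<beta>}"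
    by (rule jet_dd_has_integral) (rule int)
  moreover have "jet_dd \<theta> k 3 G = 2 * jet_dd \<theta> k 3 (\<lambda>i t. g i t / fact i)"
    unfolding G_def T_def jet_dd_add jet_dd_cmult
    by (simp add: jet_dd_pow_low_3)
  ultimately have "((\<lambda>x. g 3 x * jet_dd \<theta> k 3 (kernel_jet x)) has_integral
      2 * jet_dd \<theta> k 3 (\<lambda>i t. g i t / fact i)) {\<alpha>..\<beta>}"
    by (simp add: jet_dd_cmult)
  from has_integral_mult_right[OF this, of "\<theta> (k + 3) - \<theta> k"]
  have "((\<lambda>x. (\<theta> (k + 3) - \<theta> k) * (g 3 x * jet_dd \<theta> k 3 (kernel_jet x))) has_integral
      (\<theta> (k + 3) - \<theta> k) * (2 * jet_dd \<theta> k 3 (\<lambda>i t. g i t / fact i))) {\<alpha>..\<beta>}" .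
  moreover have "(\<lambda>x. (\<theta> (k + 3) - \<theta> k) * (g 3 x * jet_dd \<theta> k 3 (kernel_jet x))) = (\<lambda>x. g 3 x * quad k x)"
    by (simp add: quad_def fun_eq_iff)
  moreover have "(\<theta> (k + 3) - \<theta> k) * (2 * J) = 6 * knot_h \<theta> 3 k * J" for J
    by (simp add: knot_h_def)
  ultimately show ?thesis
    by metis
qed

section \<open>Moments of squares and of truncated squares\<close>

lemma moment_eq_jet_dd:
  assumes "1 \<le> k" "k \<le> n"
  shows "moment s k = knot_h \<theta> 3 k * jet_dd \<theta> k 3 (pow_jet 5 s) / 10"
proof -
  have "jet_dd \<theta> k 3 (pow_jet 5 s) =
      hom2 (\<theta> k - s) (\<theta> (k + 1) - s) (\<theta> (k + 2) - s) (\<theta> (k + 3) - s)"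
    using assms knot_mono[of k "k + 1"] knot_mono[of "k + 1" "k + 2"] knot_mono[of "k + 2" "k + 3"]
      knot_less[of k "k + 3"] by (intro jet_dd_pow5_3) auto
  then show ?thesis
    by (simp add: moment_def)
qed

lemma moment_has_integral:
  assumes k: "1 \<le> k" "k \<le> n"
  shows "((\<lambda>x. (s - x)\<^sup>2 * quad k x) has_integral moment s k) {\<alpha>..\<beta>}"
proof -
  \<comment> \<open>Successive antiderivatives of the square \<open>g 3\<close>; the denominator 60
    is 5 * 4 * 3.\<close>
  define g where "g = (\<lambda>(m :: nat) t. if m = 0 then (t - s) ^ 5 / 60 else if m = 1 then (t - s) ^ 4 / 12
    else if m = 2 then (t - s) ^ 3 / 3 else (s - t)\<^sup>2 :: real)"
  have "((\<lambda>x. g 3 x * quad k x) has_integral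
      6 * knot_h \<theta> 3 k * jet_dd \<theta> k 3 (\<lambda>i t. g i t / fact i)) {\<alpha>..\<beta>}"
  proof (rule peano_kernel[OF _ k])
    fix m :: nat and t :: real
    assume "m < 3"
    then have "m = 0 \<or> m = 1 \<or> m = 2" by auto
    then show "(g m has_real_derivative g (Suc m) t) (at t within {\<alpha>..\<beta>})"
      by (auto simp: g_def power2_commute[of s] intro!: derivative_eq_intros)
  qed
  moreover have "(\<lambda>x. g 3 x * quad k x) = (\<lambda>x. (s - x)\<^sup>2 * quad k x)"
    by (simp add: g_def)
  moreover have "jet_dd \<theta> k 3 (\<lambda>i t. g i t / fact i) = jet_dd \<theta> k 3 (\<lambda>i t. 1 / 60 * pow_jet 5 s i t)"
  proof (rule jet_dd_cong)
    fix j i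
    assume ji: "k \<le> j" "j + i \<le> k + 3" "\<theta> (j + i) = \<theta> j"
    have "(5 choose 2) = (10 :: nat)" by (simp add: numeral_eq_Suc)
    with ji k show "g i (\<theta> j) / fact i = 1 / 60 * pow_jet 5 s i (\<theta> j)"
      by (auto elim!: coalescent_cases[of j i, rotated 2] simp: g_def pow_jet_def)
  qed
  moreover have "6 * knot_h \<theta> 3 k * jet_dd \<theta> k 3 (\<lambda>i t. 1 / 60 * pow_jet 5 s i t) = moment s k"
    unfolding jet_dd_cmult moment_eq_jet_dd[OF k] by simp
  ultimately show ?thesis
    by metis
qed

text \<open>The jet in t of the fifth truncated power of c - t, which lives to the left of c. Its
  companion \<open>right_jet\<close> lives to the right; as 5 is odd, right minus left is the full
  power of t - c.\<close>

definition left_jet :: "real \<Rightarrow> nat \<Rightarrow> real \<Rightarrow> real" where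
  "left_jet c i t = (- 1) ^ i * real (5 choose i) * trunc_pow (5 - i) c t"

definition right_jet :: "real \<Rightarrow> nat \<Rightarrow> real \<Rightarrow> real" where
  "right_jet c i t = real (5 choose i) * trunc_pow (5 - i) t c"

lemma pow_jet_eq_right_minus_left:
  assumes "i < 5"
  shows "pow_jet 5 c i t = right_jet c i t + (- 1) * left_jet c i t"
proof -
  have "i = 0 \<or> i = 1 \<or> i = 2 \<or> i = 3 \<or> i = 4"
    using assms by auto
  then show ?thesis
    by (cases "c \<le> t")
      (auto simp: pow_jet_def right_jet_def left_jet_def trunc_pow_def max_def eval_nat_numeral algebra_simps)
qed

lemma jet_dd_left_right:
  assumes "1 \<le> k" "k + m \<le> n + 3"
  shows "jet_dd \<theta> k m (pow_jet 5 c) = jet_dd \<theta> k m (right_jet c) - jet_dd \<theta> k m (left_jet c)"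
proof -
  have "jet_dd \<theta> k m (pow_jet 5 c) = jet_dd \<theta> k m (\<lambda>i t. right_jet c i t + (- 1) * left_jet c i t)"
  proof (rule jet_dd_cong)
    fix j i
    assume ji: "k \<le> j" "j + i \<le> k + m" "\<theta> (j + i) = \<theta> j"
    show "pow_jet 5 c i (\<theta> j) = right_jet c i (\<theta> j) + (- 1) * left_jet c i (\<theta> j)"
      by (rule coalescent_cases[of j i]) (use ji assms in \<open>auto simp: pow_jet_eq_right_minus_left\<close>)
  qed
  then show ?thesis
    unfolding jet_dd_add jet_dd_cmult by simp
qed

text \<open>The integral of the truncated square of c - x against the k-th B-spline. The sign arises
  because the third derivative in t of the fifth truncated power of c - t is negative.\<close>

definition trunc_moment :: "real \<Rightarrow> nat \<Rightarrow> real" where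
  "trunc_moment c k = - knot_h \<theta> 3 k * jet_dd \<theta> k 3 (left_jet c) / 10"

lemma trunc_moment_has_integral:
  assumes k: "1 \<le> k" "k \<le> n"
  shows "((\<lambda>x. trunc_pow 2 c x * quad k x) has_integral trunc_moment c k) {\<alpha>..\<beta>}"
proof -
  define g where "g = (\<lambda>(m :: nat) t. if m = 0 then - 1 / 60 * trunc_pow 5 c t
    else if m = 1 then 1 / 12 * trunc_pow 4 c t
    else if m = 2 then - 1 / 3 * trunc_pow 3 c t else trunc_pow 2 c t)"
  have "((\<lambda>x. g 3 x * quad k x) has_integral
      6 * knot_h \<theta> 3 k * jet_dd \<theta> k 3 (\<lambda>i t. g i t / fact i)) {\<alpha>..\<beta>}"
  proof (rule peano_kernel[OF _ k])
    fix m :: nat and t :: real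
    assume "m < 3"
    then have "m = 0 \<or> m = 1 \<or> m = 2" by auto
    moreover have "((\<lambda>t. a * trunc_pow m c t) has_real_derivative a * (- real m * trunc_pow (m - 1) c t))
        (at t within {\<alpha>..\<beta>})" if "2 \<le> m" for a m
      by (intro DERIV_cmult trunc_pow_has_real_derivative that)
    from this[of 5 "- 1 / 60"] this[of 4 "1 / 12"] this[of 3 "- 1 / 3"]
    have "(g 0 has_real_derivative g 1 t) (at t within {\<alpha>..\<beta>})"
      "(g 1 has_real_derivative g 2 t) (at t within {\<alpha>..\<beta>})"
      "(g 2 has_real_derivative g 3 t) (at t within {\<alpha>..\<beta>})"
      by (simp_all add: g_def)
    ultimately show "(g m has_real_derivative g (Suc m) t) (at t within {\<alpha>..\<beta>})"
      by (auto simp: numeral_2_eq_2 numeral_3_eq_3)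
  qed
  moreover have "(\<lambda>x. g 3 x * quad k x) = (\<lambda>x. trunc_pow 2 c x * quad k x)"
    by (simp add: g_def)
  moreover have "jet_dd \<theta> k 3 (\<lambda>i t. g i t / fact i) = jet_dd \<theta> k 3 (\<lambda>i t. - 1 / 60 * left_jet c i t)"
  proof (rule jet_dd_cong)
    fix j i
    assume ji: "k \<le> j" "j + i \<le> k + 3" "\<theta> (j + i) = \<theta> j"
    have "(5 choose 2) = (10 :: nat)" by (simp add: numeral_eq_Suc)
    with ji k show "g i (\<theta> j) / fact i = - 1 / 60 * left_jet c i (\<theta> j)"
      by (auto elim!: coalescent_cases[of j i, rotated 2] simp: g_def left_jet_def)
  qed
  moreover have "6 * knot_h \<theta> 3 k * jet_dd \<theta> k 3 (\<lambda>i t. - 1 / 60 * left_jet c i t) = trunc_moment c k"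
    unfolding jet_dd_cmult trunc_moment_def by simp
  ultimately show ?thesis
    by metis
qed

text \<open>Exchanges the sides: the truncated square of c - x minus the full square is minus the
  truncated square of x - c. Hence the difference vanishes on B-splines to the left of c, where the
  triangular solve for w_l begins.\<close>

lemma trunc_moment_minus_moment:
  assumes "1 \<le> k" "k \<le> n"
  shows "trunc_moment c k - moment c k = - knot_h \<theta> 3 k * jet_dd \<theta> k 3 (right_jet c) / 10"
proof -
  have "jet_dd \<theta> k 3 (right_jet c) = jet_dd \<theta> k 3 (left_jet c) + jet_dd \<theta> k 3 (pow_jet 5 c)"
    using jet_dd_left_right[of k 3 c] assms by simp
  then show ?thesis
    unfolding trunc_moment_def moment_eq_jet_dd[OF assms] by (simp add: field_simps)
qed

text \<open>Each operator cancels \<open>knot_h\<close>, takes a difference, and reproduces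
  \<open>knot_h\<close> of the next order, so the result has the shape that the following operator
  needs. The factors 4 and 5 come from the averaging in \<open>knot_h\<close>; the last length is
  kept whole, as in the normalization of the B-splines of order 6.\<close>

lemma bdiff_jet_dd:
  assumes v: "\<And>j. 1 \<le> j \<Longrightarrow> j \<le> n \<Longrightarrow> v j = knot_h \<theta> 3 j * jet_dd \<theta> j 3 F"
  shows "1 \<le> k \<Longrightarrow> k + 1 \<le> n \<Longrightarrow> bdiff \<theta> 3 v k = - 4 * knot_h \<theta> 4 k * jet_dd \<theta> k 4 F"
    and "1 \<le> k \<Longrightarrow> k + 2 \<le> n \<Longrightarrow> bdiff \<theta> 4 (bdiff \<theta> 3 v) k = 20 * knot_h \<theta> 5 k * jet_dd \<theta> k 5 F"
    and "1 \<le> k \<Longrightarrow> k + 3 \<le> n \<Longrightarrow> bdiff \<theta> 5 (bdiff \<theta> 4 (bdiff \<theta> 3 v)) k =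
      - 20 * ((\<theta> (k + 6) - \<theta> k) * jet_dd \<theta> k 6 F)"
proof -
  have cancel: "bdiff \<theta> s w k = a * b k - a * b (k + 1)"
    if "w k = a * knot_h \<theta> s k * b k" "w (k + 1) = a * knot_h \<theta> s (k + 1) * b (k + 1)"
      "1 \<le> k" "3 \<le> s" "k + 1 + s \<le> n + 3" for s w a b k
    using that knot_h_pos[of k s] knot_h_pos[of "k + 1" s] by (simp add: bdiff_def)
  have step: "jet_dd \<theta> k m F - jet_dd \<theta> (k + 1) m F = - real (Suc m) * (knot_h \<theta> (Suc m) k * jet_dd \<theta> k (Suc m) F)"
    if "1 \<le> k" "k + Suc m \<le> n + 3" for k m
    using dd_step[OF that, of F] by (simp add: knot_h_def mult.commute del: of_nat_Suc)
  have 3: "bdiff \<theta> 3 v k = - 4 * knot_h \<theta> 4 k * jet_dd \<theta> k 4 F" if "1 \<le> k" "k + 1 \<le> n" for k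
    using cancel[of v k 1 3 "\<lambda>k. jet_dd \<theta> k 3 F"] v[of k] v[of "k + 1"] step[of k 3] that by simp
  then show "1 \<le> k \<Longrightarrow> k + 1 \<le> n \<Longrightarrow> bdiff \<theta> 3 v k = - 4 * knot_h \<theta> 4 k * jet_dd \<theta> k 4 F" .
  have 4: "bdiff \<theta> 4 (bdiff \<theta> 3 v) k = 20 * knot_h \<theta> 5 k * jet_dd \<theta> k 5 F" if "1 \<le> k" "k + 2 \<le> n" for k
    using cancel[of "bdiff \<theta> 3 v" k "- 4" 4 "\<lambda>k. jet_dd \<theta> k 4 F"] 3[of k] 3[of "k + 1"] step[of k 4] that
    by simp
  then show "1 \<le> k \<Longrightarrow> k + 2 \<le> n \<Longrightarrow> bdiff \<theta> 4 (bdiff \<theta> 3 v) k = 20 * knot_h \<theta> 5 k * jet_dd \<theta> k 5 F" .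
  show "bdiff \<theta> 5 (bdiff \<theta> 4 (bdiff \<theta> 3 v)) k = - 20 * ((\<theta> (k + 6) - \<theta> k) * jet_dd \<theta> k 6 F)"
    if "1 \<le> k" "k + 3 \<le> n" for k
    using cancel[of "bdiff \<theta> 4 (bdiff \<theta> 3 v)" k 20 5 "\<lambda>k. jet_dd \<theta> k 5 F"] 4[of k] 4[of "k + 1"]
      step[of k 5] that by (simp add: knot_h_def)
qed

lemma bspline6_eq:
  assumes k: "1 \<le> k" "k + 3 \<le> n" and c: "c < \<beta>"
  shows "bspline n \<theta> 6 k c = (\<theta> (k + 6) - \<theta> k) * jet_dd \<theta> k 6 (right_jet c)"
proof -
  have "divdiff \<theta> k 6 (\<lambda>t. trunc_pow 5 t c) = jet_dd \<theta> k 6 (right_jet c)"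
  proof (rule divdiff_eq_jet_dd)
    fix j i
    assume ji: "k \<le> j" "j + i \<le> k + 6" "\<theta> (j + i) = \<theta> j"
    have "(5 choose 2) = (10 :: nat)" by (simp add: numeral_eq_Suc)
    note choose = this
    show "(left_deriv ^^ i) (\<lambda>t. trunc_pow 5 t c) (\<theta> j) = fact i * right_jet c i (\<theta> j)"
      by (rule coalescent_cases[of j i])
        (use choose ji k left_deriv_iter_trunc_pow_5[of c] in
          \<open>auto simp: right_jet_def simp del: funpow.simps\<close>)
  qed
  then show ?thesis
    using c knot_right[of "n + 3"] by (simp add: bspline_def bspline_interior_def)
qed

text \<open>The moments involve powers truncated to the left of c, the B-splines powers truncated to
  the right. The two differ by a polynomial of degree 5, which the sixth difference annihilates;
  here this comes from \<open>bdiff5_moment\<close>. The factor 2 is 20 / 10.\<close>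

lemma bdiff_trunc_moment:
  assumes "1 \<le> k" "k + 3 \<le> n" "c < \<beta>"
  shows "bdiff \<theta> 5 (bdiff \<theta> 4 (bdiff \<theta> 3 (trunc_moment c))) k = 2 * bspline n \<theta> 6 k c"
proof -
  have "bdiff \<theta> 5 (bdiff \<theta> 4 (bdiff \<theta> 3 (trunc_moment c))) k =
      - 20 * ((\<theta> (k + 6) - \<theta> k) * jet_dd \<theta> k 6 (\<lambda>i t. - 1 / 10 * left_jet c i t))"
    using assms by (intro bdiff_jet_dd(3)) (simp_all only: jet_dd_cmult, simp_all add: trunc_moment_def)
  moreover have "bdiff \<theta> 5 (bdiff \<theta> 4 (bdiff \<theta> 3 (moment c))) k =
      - 20 * ((\<theta> (k + 6) - \<theta> k) * jet_dd \<theta> k 6 (\<lambda>i t. 1 / 10 * pow_jet 5 c i t))"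
    using assms by (intro bdiff_jet_dd(3)) (simp_all only: jet_dd_cmult, simp_all add: moment_eq_jet_dd)
  ultimately show ?thesis
    using assms bdiff5_moment[of k c] jet_dd_left_right[of k 6 c] bspline6_eq[of k c]
    unfolding jet_dd_cmult by auto
qed

section \<open>The Gram matrix\<close>

definition gram :: "nat \<Rightarrow> nat \<Rightarrow> real" where
  "gram i j = integral {\<alpha>..\<beta>} (\<lambda>x. quad i x * quad j x)"

lemma gram_has_integral:
  assumes "1 \<le> i" "i \<le> n" "1 \<le> j" "j \<le> n"
  shows "((\<lambda>x. quad i x * quad j x) has_integral gram i j) {\<alpha>..\<beta>}"
  unfolding gram_def
  by (rule integrable_integral, rule integrable_continuous_real)
    (intro continuous_on_mult continuous_on_quad assms)

lemma gram_sym: "gram i j = gram j i"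
  by (simp add: gram_def mult.commute)

lemma gram_apply_has_integral:
  assumes i: "1 \<le> i" "i \<le> n"
    and p: "\<And>x. x \<in> {\<alpha>..\<beta>} \<Longrightarrow> (\<Sum>j = 1..n. v j * quad j x) = p x"
  shows "((\<lambda>x. p x * quad i x) has_integral (\<Sum>j = 1..n. gram i j * v j)) {\<alpha>..\<beta>}"
proof -
  have "((\<lambda>x. \<Sum>j = 1..n. quad i x * quad j x * v j) has_integral (\<Sum>j = 1..n. gram i j * v j)) {\<alpha>..\<beta>}"
    by (intro has_integral_sum has_integral_mult_left gram_has_integral) (use i in auto)
  then show ?thesis
  proof (rule has_integral_eq[rotated])
    fix x
    assume "x \<in> {\<alpha>..\<beta>}"
    have "(\<Sum>j = 1..n. quad i x * quad j x * v j) = (\<Sum>j = 1..n. v j * quad j x) * quad i x"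
      unfolding sum_distrib_right by (rule sum.cong) (simp_all add: mult.commute)
    then show "(\<Sum>j = 1..n. quad i x * quad j x * v j) = p x * quad i x"
      using p[OF \<open>x \<in> {\<alpha>..\<beta>}\<close>] by simp
  qed
qed

lemma gram_apply:
  assumes "1 \<le> i" "i \<le> n"
    and "\<And>x. x \<in> {\<alpha>..\<beta>} \<Longrightarrow> (\<Sum>j = 1..n. v j * quad j x) = p x"
    and "((\<lambda>x. p x * quad i x) has_integral I) {\<alpha>..\<beta>}"
  shows "(\<Sum>j = 1..n. gram i j * v j) = I"
  using gram_apply_has_integral[OF assms(1-3)] assms(4) by (rule has_integral_unique)

lemma gram_coef: "1 \<le> i \<Longrightarrow> i \<le> n \<Longrightarrow> (\<Sum>j = 1..n. gram i j * coef s j) = moment s i"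
  using gram_apply[of i "coef s" "\<lambda>x. (s - x)\<^sup>2" "moment s i"] marsden moment_has_integral by simp

lemma gram_trunc_coef:
  "1 \<le> i \<Longrightarrow> i \<le> n \<Longrightarrow> 3 \<le> l \<Longrightarrow> l \<le> n + 3 \<Longrightarrow>
    (\<Sum>j = 1..n. gram i j * trunc_coef l j) = trunc_moment (\<theta> l) i"
  using gram_apply[of i "trunc_coef l" "trunc_pow 2 (\<theta> l)" "trunc_moment (\<theta> l) i"]
    trunc_marsden trunc_moment_has_integral by simp

section \<open>Local support of the B-splines and bandwidth of the Gram matrix\<close>

lemma quad_zero_right:
  assumes "1 \<le> k" "k + 3 \<le> n" "\<theta> (k + 3) \<le> x"
  shows "quad k x = 0"
proof -
  have "jet_dd \<theta> k 3 (kernel_jet x) = jet_dd \<theta> k 3 (\<lambda>i t. 0)"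
  proof (rule jet_dd_cong)
    fix j i
    assume ji: "k \<le> j" "j + i \<le> k + 3" "\<theta> (j + i) = \<theta> j"
    then have "\<theta> j \<le> \<theta> (k + 3)" "\<theta> j < \<beta>"
      using knot_mono[of j "k + 3"] knot_less[of j "n + 1"] knot_right[of "n + 1"] assms by auto
    then show "kernel_jet x i (\<theta> j) = 0"
      using assms by (simp add: kernel_jet_def trunc_pow_def)
  qed
  then show ?thesis
    by (simp add: quad_def)
qed

text \<open>To the left of the support the truncation has no effect at any node, so the kernel is a
  quadratic polynomial in t, and the third divided difference annihilates it.\<close>

lemma quad_zero_left:
  assumes "4 \<le> k" "k \<le> n" "x \<le> \<theta> k"
  shows "quad k x = 0"
proof -
  have "jet_dd \<theta> k 3 (kernel_jet x) = jet_dd \<theta> k 3 (pow_jet 2 x)"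
  proof (rule jet_dd_cong)
    fix j i
    assume ji: "k \<le> j" "j + i \<le> k + 3" "\<theta> (j + i) = \<theta> j"
    then have "\<theta> k \<le> \<theta> j" "\<alpha> < \<theta> j"
      using knot_mono[of k j] knot_less[of 3 j] knot_left[of 3] assms by auto
    note pos = this
    show "kernel_jet x i (\<theta> j) = pow_jet 2 x i (\<theta> j)"
      by (rule coalescent_cases[of j i])
        (use pos assms ji in \<open>auto simp: kernel_jet_def trunc_pow_def pow_jet_def\<close>)
  qed
  then show ?thesis
    by (simp add: quad_def jet_dd_pow2_3)
qed

lemma gram_band:
  assumes "1 \<le> i" "i + 3 \<le> j" "j \<le> n"
  shows "gram i j = 0"
proof -
  have "quad i x * quad j x = 0" for x
    using quad_zero_left[of j x] quad_zero_right[of i x] knot_mono[of "i + 3" j] assms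
    by (cases "x \<le> \<theta> j") simp_all
  then have "(\<lambda>x. quad i x * quad j x) = (\<lambda>x. 0)"
    by (simp only:)
  then show ?thesis
    by (simp add: gram_def)
qed

end

section \<open>Factorization of the defect\<close>

lemma sum_adiff_cutoff:
  assumes "1 \<le> N"
  shows "(\<Sum>k = 1..N. adiff \<theta> s (cutoff (N - 1) x) k * y k) = (\<Sum>k = 1..N - 1. x k * bdiff \<theta> s y k)"
proof -
  obtain M where N: "N = Suc M"
    using assms by (cases N) auto
  have "(\<Sum>k = 1..M. cutoff M x k * bdiff \<theta> s y k) = (\<Sum>k = 1..M. x k * bdiff \<theta> s y k)"
    by (rule sum.cong) auto
  then show ?thesis
    using sum_adiff_mult[of "cutoff M x" \<theta> s y M] by (simp add: N)
qed

text \<open>Summation by parts moves every transposed operator to the other factor and leaves a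
  visibly symmetric bilinear form. This lets S pass from a row of the Gram matrix to the
  moments.\<close>

lemma sop_symmetric:
  assumes "3 \<le> n"
  shows "(\<Sum>k = 1..n. sop n \<theta> v k * w k) = (\<Sum>k = 1..n. v k * sop n \<theta> w k)"
proof -
  have "(\<Sum>k = 1..n. sop n \<theta> v k * w k) = (\<Sum>k = 1..n. u0 \<theta> k * v k * w k)
      + (\<Sum>k = 1..n - 1. u1 \<theta> k * bdiff \<theta> 3 v k * bdiff \<theta> 3 w k)
      + (\<Sum>k = 1..n - 2. u2 \<theta> k * bdiff \<theta> 4 (bdiff \<theta> 3 v) k * bdiff \<theta> 4 (bdiff \<theta> 3 w) k)" for v w
  proof -
    have "n - 1 - 1 = n - 2" by simp
    then have "(\<Sum>k = 1..n - 1. adiff \<theta> 4 (cutoff (n - 2) x) k * y k) = (\<Sum>k = 1..n - 2. x k * bdiff \<theta> 4 y k)" for x y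
      using sum_adiff_cutoff[of "n - 1" \<theta> 4 x y] assms by simp
    then show ?thesis
      unfolding sop_def distrib_right sum.distrib
      using sum_adiff_cutoff[of n \<theta> 3 _ w] assms by (simp add: distrib_right sum.distrib)
  qed
  from this[of v w] this[of w v] show ?thesis
    by (simp add: mult_ac)
qed

definition psum :: "(nat \<Rightarrow> real) \<Rightarrow> nat \<Rightarrow> (nat \<Rightarrow> real) \<Rightarrow> nat \<Rightarrow> real" where
  "psum \<theta> s v k = (\<Sum>j = 1..k. v j * knot_h \<theta> s j)"

text \<open>The partial sums solve the first N - 1 equations in any case. Cutting off sets the N-th
  unknown to zero, and the last equation is then the condition that the total vanishes.\<close>

lemma adiff_psum:
  assumes "\<And>k. 1 \<le> k \<Longrightarrow> k \<le> N \<Longrightarrow> knot_h \<theta> s k \<noteq> 0" "psum \<theta> s v N = 0" "1 \<le> k" "k \<le> N"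
  shows "adiff \<theta> s (cutoff (N - 1) (psum \<theta> s v)) k = v k"
proof -
  have "cutoff (N - 1) (psum \<theta> s v) k = psum \<theta> s v k" if "k \<le> N" for k
    using that assms(2) by (cases "k = 0 \<or> k = N") (auto simp: psum_def cutoff_def)
  from this[of k] this[of "k - 1"] have "adiff \<theta> s (cutoff (N - 1) (psum \<theta> s v)) k = adiff \<theta> s (psum \<theta> s v) k"
    using assms(4) by (simp add: adiff_def)
  also have "\<dots> = v k"
    unfolding psum_def[abs_def] using assms by (intro adiff_partial_sum) auto
  finally show ?thesis .
qed

lemma sum_psum_bdiff:
  assumes "1 \<le> N" "\<And>k. 1 \<le> k \<Longrightarrow> k \<le> N \<Longrightarrow> knot_h \<theta> s k \<noteq> 0" "psum \<theta> s v N = 0"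
  shows "(\<Sum>k = 1..N - 1. psum \<theta> s v k * bdiff \<theta> s y k) = (\<Sum>k = 1..N. v k * y k)"
  unfolding sum_adiff_cutoff[OF assms(1), symmetric]
proof (rule sum.cong)
  fix k
  assume "k \<in> {1..N}"
  then have "adiff \<theta> s (cutoff (N - 1) (psum \<theta> s v)) k = v k"
    by (intro adiff_psum assms) auto
  then show "adiff \<theta> s (cutoff (N - 1) (psum \<theta> s v)) k * y k = v k * y k"
    by simp
qed simp

lemma psum_zero_right:
  assumes "psum \<theta> s v N = 0" "\<And>j. k < j \<Longrightarrow> j \<le> N \<Longrightarrow> v j = 0" "k \<le> N"
  shows "psum \<theta> s v k = 0"
proof -
  have "psum \<theta> s v N = psum \<theta> s v k"
    unfolding psum_def using assms by (intro sum.mono_neutral_right) auto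
  then show ?thesis
    using assms by simp
qed

lemma psum_scale: "(\<Sum>k = 1..N. v k * (a * knot_h \<theta> s k)) = a * psum \<theta> s v N"
  by (simp add: psum_def sum_distrib_left mult.left_commute)

context spline_knots
begin

text \<open>Three nested solves need three vanishing totals. Each total pairs a sequence with
  \<open>knot_h\<close> of order 3, 4 or 5, and these weights are combinations of the moments and of
  their first two differences, so orthogonality for a few values of s suffices.\<close>

lemma orthogonal_factor:
  assumes orth: "\<And>s. (\<Sum>k = 1..n. v k * moment s k) = 0"
  defines "z \<equiv> psum \<theta> 5 (psum \<theta> 4 (psum \<theta> 3 v))"
  shows "1 \<le> k \<Longrightarrow> k \<le> n \<Longrightarrow>
      adiff \<theta> 3 (cutoff (n - 1) (adiff \<theta> 4 (cutoff (n - 2) (adiff \<theta> 5 (cutoff (n - 3) z))))) k = v k"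
    and "(\<And>k. q + 3 \<le> k \<Longrightarrow> k \<le> n \<Longrightarrow> v k = 0) \<Longrightarrow> q \<le> k \<Longrightarrow> k \<le> n - 3 \<Longrightarrow> z k = 0"
proof -
  define x1 x2 where "x1 = psum \<theta> 3 v" and "x2 = psum \<theta> 4 x1"
  have idx: "n - 1 - 1 = n - 2" "n - 2 - 1 = n - 3" by simp_all
  have h: "knot_h \<theta> s k \<noteq> 0" if "1 \<le> k" "3 \<le> s" "k + s \<le> n + 3" for s k
    using knot_h_pos[OF that] by simp
  have h3: "\<And>k. 1 \<le> k \<Longrightarrow> k \<le> n \<Longrightarrow> knot_h \<theta> 3 k \<noteq> 0"
    and h4: "\<And>k. 1 \<le> k \<Longrightarrow> k \<le> n - 1 \<Longrightarrow> knot_h \<theta> 4 k \<noteq> 0"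
    and h5: "\<And>k. 1 \<le> k \<Longrightarrow> k \<le> n - 2 \<Longrightarrow> knot_h \<theta> 5 k \<noteq> 0"
    using h n_ge_3 by auto
  \<comment> \<open>As \<open>(1 - x)\<^sup>2 + (- 1 - x)\<^sup>2 - 2 * x\<^sup>2\<close> = 2, this
    is twice the integral of the B-spline.\<close>
  have "moment 1 k + moment (- 1) k - 2 * moment 0 k = 2 * knot_h \<theta> 3 k" for k
    by (simp add: moment_def hom2_def power2_eq_square field_simps)
  then have "2 * x1 n = (\<Sum>k = 1..n. v k * (moment 1 k + moment (- 1) k - 2 * moment 0 k))"
    unfolding x1_def psum_scale[symmetric] by simp
  also have "\<dots> = (\<Sum>k = 1..n. v k * moment 1 k) + (\<Sum>k = 1..n. v k * moment (- 1) k)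
      - 2 * (\<Sum>k = 1..n. v k * moment 0 k)"
    by (simp add: algebra_simps sum.distrib sum_subtractf sum_distrib_left)
  finally have x1: "x1 n = 0"
    unfolding orth by simp
  note sum1 = sum_psum_bdiff[OF _ h3 x1[unfolded x1_def], folded x1_def]
  \<comment> \<open>Changing s cancels the sum of the knots and leaves a pure length.\<close>
  have "bdiff \<theta> 3 (moment 0) k - bdiff \<theta> 3 (moment 1) k = - 2 * knot_h \<theta> 4 k" if "1 \<le> k" "k + 1 \<le> n" for k
    unfolding bdiff3_moment[OF that] by (simp add: knot_h_def field_simps)
  then have "- 2 * x2 (n - 1) = (\<Sum>k = 1..n - 1. x1 k * (bdiff \<theta> 3 (moment 0) k - bdiff \<theta> 3 (moment 1) k))"
    unfolding x2_def psum_scale[symmetric] using n_ge_3 by (intro sum.cong) auto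
  also have "\<dots> = (\<Sum>k = 1..n - 1. x1 k * bdiff \<theta> 3 (moment 0) k) - (\<Sum>k = 1..n - 1. x1 k * bdiff \<theta> 3 (moment 1) k)"
    by (simp add: algebra_simps sum_subtractf)
  also have "\<dots> = 0"
    using sum1 orth n_ge_3 by simp
  finally have x2: "x2 (n - 1) = 0"
    by simp
  note sum2 = sum_psum_bdiff[OF _ h4 x2[unfolded x2_def], folded x2_def, unfolded idx]
  have "bdiff \<theta> 4 (bdiff \<theta> 3 (moment 0)) k = 2 * knot_h \<theta> 5 k" if "1 \<le> k" "k + 2 \<le> n" for k
    unfolding bdiff4_moment[OF that] by (simp add: knot_h_def)
  then have "2 * psum \<theta> 5 x2 (n - 2) = (\<Sum>k = 1..n - 2. x2 k * bdiff \<theta> 4 (bdiff \<theta> 3 (moment 0)) k)"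
    unfolding psum_scale[symmetric] using n_ge_3 by (intro sum.cong) auto
  also have "\<dots> = 0"
    using sum2 sum1 orth n_ge_3 by simp
  finally have x3: "psum \<theta> 5 x2 (n - 2) = 0"
    by simp
  have z: "z = psum \<theta> 5 x2"
    by (simp add: z_def x1_def x2_def)
  have "cutoff (n - 2) (adiff \<theta> 5 (cutoff (n - 3) z)) = cutoff (n - 2) x2"
    unfolding z idx(2)[symmetric] using h5 x3 by (intro cutoff_cong adiff_psum)
  moreover have "cutoff (n - 1) (adiff \<theta> 4 (cutoff (n - 2) x2)) = cutoff (n - 1) x1"
    unfolding x2_def idx(1)[symmetric] using h4 x2[unfolded x2_def] by (intro cutoff_cong adiff_psum)
  ultimately show "adiff \<theta> 3 (cutoff (n - 1) (adiff \<theta> 4 (cutoff (n - 2) (adiff \<theta> 5 (cutoff (n - 3) z))))) k = v k"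
    if "1 \<le> k" "k \<le> n"
    using adiff_psum[OF h3 x1[unfolded x1_def] that] by (simp add: x1_def)
  show "z k = 0" if v0: "\<And>k. q + 3 \<le> k \<Longrightarrow> k \<le> n \<Longrightarrow> v k = 0" and k: "q \<le> k" "k \<le> n - 3"
  proof -
    \<comment> \<open>Since the totals vanish, the sums may be read from the right end; each solve
      carries the zeros one index further to the left.\<close>
    have 1: "x1 k = 0" if "q + 2 \<le> k" "k \<le> n" for k
      unfolding x1_def by (rule psum_zero_right[OF x1[unfolded x1_def]]) (use v0 that in auto)
    have 2: "x2 k = 0" if "q + 1 \<le> k" "k \<le> n - 1" for k
      unfolding x2_def by (rule psum_zero_right[OF x2[unfolded x2_def]]) (use 1 that in auto)
    show ?thesis
      unfolding z by (rule psum_zero_right[OF x3]) (use 2 k in auto)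
  qed
qed

text \<open>A row of the Gram matrix paired with \<open>coef s\<close> returns the moment, so the
  defect is orthogonal to all moments. The Gram matrix and S both have bandwidth 2, hence the row
  vanishes from index i + 5 on; the three solves extend the zeros down to i + 2.\<close>

lemma defect_row:
  assumes i: "1 \<le> i" "i \<le> n"
  obtains z where "\<And>k. 1 \<le> k \<Longrightarrow> k \<le> n \<Longrightarrow>
      adiff \<theta> 3 (cutoff (n - 1) (adiff \<theta> 4 (cutoff (n - 2) (adiff \<theta> 5 (cutoff (n - 3) z))))) k =
      (if k = i then 1 else 0) - sop n \<theta> (gram i) k"
    and "\<And>j. i + 1 < j \<Longrightarrow> j \<le> n - 3 \<Longrightarrow> z j = 0"
proof -
  define v where "v = (\<lambda>k. (if k = i then 1 else 0) - sop n \<theta> (gram i) k)"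
  have "(\<Sum>k = 1..n. v k * moment s k) = 0" for s
  proof -
    have "(\<Sum>k = 1..n. sop n \<theta> (gram i) k * moment s k) = (\<Sum>k = 1..n. gram i k * coef s k)"
      unfolding sop_symmetric[OF n_ge_3] by (intro sum.cong) (auto simp: sop_moment)
    also have "\<dots> = moment s i"
      using gram_coef[OF i] .
    finally have "(\<Sum>k = 1..n. v k * moment s k) = (\<Sum>k = 1..n. (if k = i then 1 else 0) * moment s k) - moment s i"
      by (simp add: v_def left_diff_distrib sum_subtractf)
    also have "(\<Sum>k = 1..n. (if k = i then 1 else 0) * moment s k) = (\<Sum>k = 1..n. if k = i then moment s k else 0)"
      by (rule sum.cong) auto
    finally show ?thesis
      using i by simp
  qed
  note z = orthogonal_factor[OF this]
  have v0: "v k = 0" if k: "i + 5 \<le> k" "k \<le> n" for k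
  proof -
    define B where "B = cutoff (n - 2) (\<lambda>k. u2 \<theta> k * bdiff \<theta> 4 (bdiff \<theta> 3 (gram i)) k)"
    have g: "gram i k = 0" if "i + 3 \<le> k" "k \<le> n" for k
      using gram_band i that by simp
    then have b3: "bdiff \<theta> 3 (gram i) k = 0" if "i + 3 \<le> k" "k + 1 \<le> n" for k
      using that by (simp add: bdiff_def)
    then have "bdiff \<theta> 4 (bdiff \<theta> 3 (gram i)) k = 0" if "i + 3 \<le> k" "k + 2 \<le> n" for k
      using that by (simp add: bdiff_def[of _ 4])
    then have B: "B k = 0" if "i + 3 \<le> k" for k
      using that by (auto simp: B_def cutoff_def)
    have a4: "adiff \<theta> 4 B k = 0" if "i + 4 \<le> k" for k
      using that B[of k] B[of "k - 1"] by (simp add: adiff_def)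
    have "cutoff (n - 1) (\<lambda>k. u1 \<theta> k * bdiff \<theta> 3 (gram i) k + adiff \<theta> 4 B k) k = 0" if "i + 4 \<le> k" for k
      using that a4[of k] b3[of k] by (auto simp: cutoff_def)
    from this[of k] this[of "k - 1"] show ?thesis
      using k g[of k] unfolding v_def sop_def B_def[symmetric] adiff_def[of \<theta> 3] by simp
  qed
  show thesis
  proof (rule that)
    show "psum \<theta> 5 (psum \<theta> 4 (psum \<theta> 3 v)) j = 0" if "i + 1 < j" "j \<le> n - 3" for j
      by (rule z(2)[of "i + 2"]) (use that v0 in auto)
  qed (use z(1) in \<open>simp add: v_def\<close>)
qed

section \<open>The defect of truncated powers\<close>

lemma right_jet_zero:
  assumes "1 \<le> k" "k + m \<le> n + 3" "\<theta> (k + m) \<le> c"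
  shows "jet_dd \<theta> k m (right_jet c) = 0"
proof -
  have "jet_dd \<theta> k m (right_jet c) = jet_dd \<theta> k m (\<lambda>i t. 0)"
  proof (rule jet_dd_cong)
    fix j i
    assume ji: "k \<le> j" "j + i \<le> k + m" "\<theta> (j + i) = \<theta> j"
    then have "\<theta> j \<le> c"
      using knot_mono[of j "k + m"] assms by auto
    then show "right_jet c i (\<theta> j) = 0"
      using coalescent_cases[of j i "i < 5"] ji assms by (auto simp: right_jet_def trunc_pow_def)
  qed
  then show ?thesis by simp
qed

lemma left_jet_zero:
  assumes "1 \<le> k" "k + m \<le> n + 3" "c \<le> \<theta> k"
  shows "jet_dd \<theta> k m (left_jet c) = 0"
proof -
  have "jet_dd \<theta> k m (left_jet c) = jet_dd \<theta> k m (\<lambda>i t. 0)"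
  proof (rule jet_dd_cong)
    fix j i
    assume ji: "k \<le> j" "j + i \<le> k + m" "\<theta> (j + i) = \<theta> j"
    then have "c \<le> \<theta> j"
      using knot_mono[of k j] assms by auto
    then show "left_jet c i (\<theta> j) = 0"
      using coalescent_cases[of j i "i < 5"] ji assms by (auto simp: left_jet_def trunc_pow_def)
  qed
  then show ?thesis by simp
qed

lemma dd_step':
  assumes "1 \<le> k" "j = k + m'" "j \<le> n + 3" "k' = k + 1" "m' = Suc m"
  shows "jet_dd \<theta> k m' F * (\<theta> j - \<theta> k) = jet_dd \<theta> k' m F - jet_dd \<theta> k m F"
  using dd_step[of k m F] assms by simp

text \<open>To the left of the break point the divided difference table is zero, and to the right it
  is that of the full power, so few steps remain. The outer lengths b and e may be 0 next to an end
  point; only c and d are positive.\<close>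

lemma right_jet_values:
  assumes q: "1 \<le> q" "q + 3 \<le> n"
  defines "b \<equiv> \<theta> (q + 2) - \<theta> (q + 1)" and "c \<equiv> \<theta> (q + 3) - \<theta> (q + 2)"
    and "d \<equiv> \<theta> (q + 4) - \<theta> (q + 3)" and "e \<equiv> \<theta> (q + 5) - \<theta> (q + 4)"
  shows "jet_dd \<theta> (q + 1) 3 (right_jet (\<theta> (q + 3))) = d ^ 4 / ((c + d) * (b + c + d))"
    and "jet_dd \<theta> (q + 2) 3 (right_jet (\<theta> (q + 3))) =
      (d ^ 3 + (d + e) ^ 3 + d\<^sup>2 * (d + e) + (d + e)\<^sup>2 * d - d ^ 4 / (c + d)) / (c + d + e)"
proof -
  define J where "J = (\<lambda>m k. jet_dd \<theta> k m (right_jet (\<theta> (q + 3))))"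
  have pos: "0 < c" "0 < d" "0 \<le> b" "0 \<le> e"
    using q knot_less[of "q + 2" "q + 3"] knot_less[of "q + 3" "q + 4"]
      knot_mono[of "q + 1" "q + 2"] knot_mono[of "q + 4" "q + 5"]
    by (auto simp: b_def c_def d_def e_def)
  then have nz: "d \<noteq> 0" "c + d \<noteq> 0" "b + c + d \<noteq> 0" "c + d + e \<noteq> 0"
    by linarith+
  have diffs: "\<theta> (q + 4) - \<theta> (q + 3) = d" "\<theta> (q + 4) - \<theta> (q + 2) = c + d"
    "\<theta> (q + 4) - \<theta> (q + 1) = b + c + d" "\<theta> (q + 5) - \<theta> (q + 2) = c + d + e"
    "\<theta> (q + 5) - \<theta> (q + 3) = d + e"
    by (simp_all add: b_def c_def d_def e_def)
  have steps: "J 1 (q + 3) * (\<theta> (q + 4) - \<theta> (q + 3)) = J 0 (q + 4) - J 0 (q + 3)"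
    "J 2 (q + 2) * (\<theta> (q + 4) - \<theta> (q + 2)) = J 1 (q + 3) - J 1 (q + 2)"
    "J 3 (q + 1) * (\<theta> (q + 4) - \<theta> (q + 1)) = J 2 (q + 2) - J 2 (q + 1)"
    "J 3 (q + 2) * (\<theta> (q + 5) - \<theta> (q + 2)) = J 2 (q + 3) - J 2 (q + 2)"
    unfolding J_def by (rule dd_step'; use q in simp)+
  have zero: "J 0 (q + 3) = 0" "J 1 (q + 2) = 0" "J 2 (q + 1) = 0"
    unfolding J_def by (rule right_jet_zero; use q in \<open>simp add: eval_nat_numeral\<close>)+
  have "J 0 (q + 4) = d ^ 5"
    using pos(2) unfolding J_def by (simp add: right_jet_def trunc_pow_def diffs)
  then have "J 1 (q + 3) * d = d ^ 4 * d"
    using steps(1) unfolding zero diffs by (simp add: eval_nat_numeral)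
  then have 1: "J 1 (q + 3) = d ^ 4"
    using nz by simp
  have 2: "J 2 (q + 2) = d ^ 4 / (c + d)"
    using steps(2) nz unfolding zero diffs 1 by (simp add: eq_divide_eq)
  have "J 3 (q + 1) = d ^ 4 / (c + d) / (b + c + d)"
    using steps(3) unfolding zero diffs 2 nonzero_eq_divide_eq[OF nz(3)] by simp
  then show "jet_dd \<theta> (q + 1) 3 (right_jet (\<theta> (q + 3))) = d ^ 4 / ((c + d) * (b + c + d))"
    by (simp add: J_def)
  have "J 2 (q + 3) = jet_dd \<theta> (q + 3) 2 (pow_jet 5 (\<theta> (q + 3)))"
    using jet_dd_left_right[of "q + 3" 2 "\<theta> (q + 3)"] left_jet_zero[of "q + 3" 2 "\<theta> (q + 3)"] q
    by (simp add: J_def)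
  also have "\<dots> = d ^ 3 + (d + e) ^ 3 + d\<^sup>2 * (d + e) + (d + e)\<^sup>2 * d"
  proof -
    have idx: "q + 3 + 1 = q + 4" "q + 3 + 2 = q + 5" by simp_all
    have "\<theta> (q + 3) \<le> \<theta> (q + 4)" "\<theta> (q + 4) \<le> \<theta> (q + 5)"
      using knot_mono q by auto
    from jet_dd_pow5_2[of \<theta> "q + 3" "\<theta> (q + 3)", unfolded idx diffs, OF this] show ?thesis
      by simp
  qed
  finally show "jet_dd \<theta> (q + 2) 3 (right_jet (\<theta> (q + 3))) =
      (d ^ 3 + (d + e) ^ 3 + d\<^sup>2 * (d + e) + (d + e)\<^sup>2 * d - d ^ 4 / (c + d)) / (c + d + e)"
    using steps(4) nz unfolding diffs 2 J_def[symmetric] by (simp add: J_def eq_divide_eq)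
qed

lemma left_jet_value:
  assumes q: "1 \<le> q" "q + 3 \<le> n"
  defines "c \<equiv> \<theta> (q + 3) - \<theta> (q + 2)" and "d \<equiv> \<theta> (q + 4) - \<theta> (q + 3)"
    and "e \<equiv> \<theta> (q + 5) - \<theta> (q + 4)"
  shows "jet_dd \<theta> (q + 2) 3 (left_jet (\<theta> (q + 3))) = - (c ^ 4) / ((c + d) * (c + d + e))"
proof -
  define J where "J = (\<lambda>m k. jet_dd \<theta> k m (left_jet (\<theta> (q + 3))))"
  have pos: "0 < c" "0 < d" "0 \<le> e"
    using q knot_less[of "q + 2" "q + 3"] knot_less[of "q + 3" "q + 4"] knot_mono[of "q + 4" "q + 5"]
    by (auto simp: c_def d_def e_def)
  then have nz: "c \<noteq> 0" "c + d \<noteq> 0" "c + d + e \<noteq> 0"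
    by linarith+
  have diffs: "\<theta> (q + 3) - \<theta> (q + 2) = c" "\<theta> (q + 4) - \<theta> (q + 2) = c + d"
    "\<theta> (q + 5) - \<theta> (q + 2) = c + d + e"
    by (simp_all add: c_def d_def e_def)
  have steps: "J 1 (q + 2) * (\<theta> (q + 3) - \<theta> (q + 2)) = J 0 (q + 3) - J 0 (q + 2)"
    "J 2 (q + 2) * (\<theta> (q + 4) - \<theta> (q + 2)) = J 1 (q + 3) - J 1 (q + 2)"
    "J 3 (q + 2) * (\<theta> (q + 5) - \<theta> (q + 2)) = J 2 (q + 3) - J 2 (q + 2)"
    unfolding J_def by (rule dd_step'; use q in simp)+
  have zero: "J 0 (q + 3) = 0" "J 1 (q + 3) = 0" "J 2 (q + 3) = 0"
    unfolding J_def by (rule left_jet_zero; use q in simp)+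
  have "J 0 (q + 2) = c ^ 5"
    using pos(1) unfolding J_def by (simp add: left_jet_def trunc_pow_def c_def del: add_2_eq_Suc')
  then have "J 1 (q + 2) * c = - (c ^ 4) * c"
    using steps(1) unfolding zero diffs by (simp add: eval_nat_numeral)
  then have 1: "J 1 (q + 2) = - (c ^ 4)"
    using nz by (simp only: mult_cancel_right) simp
  have 2: "J 2 (q + 2) = c ^ 4 / (c + d)"
    using steps(2) nz unfolding zero diffs 1 by (simp add: eq_divide_eq)
  have "J 3 (q + 2) = - (c ^ 4 / (c + d)) / (c + d + e)"
    using steps(3) unfolding zero diffs 2 nonzero_eq_divide_eq[OF nz(3)] by simp
  then show ?thesis
    by (simp add: J_def)
qed

end

text \<open>The numerator of \<open>mu\<close> is half the \<open>F2\<close> in \<open>u2\<close>,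
  with the four knots measured from the break point; this accounts for 1200 against 600. The formula
  for \<open>nu\<close> arises in the same way on the other side.\<close>

lemma mu_eq_F2:
  "F2 (- a - b - c) (- b - c) (- c) 0 * d ^ 4 / (1200 * (a + b + c + d) * (b + c + d) * (c + d)) = mu a b c d"
proof -
  have "F2 (- a - b - c) (- b - c) (- c) 0 = 2 * (b\<^sup>2 * (a + b + c)\<^sup>2 + a * (a + b) * (b + c) * c)"
    by (simp add: F2_def power2_eq_square algebra_simps)
  moreover have "2 * x * y / (1200 * u * v * w) = x * y / (600 * u * v * w)" for x y u v w :: real
    by simp
  ultimately show ?thesis
    unfolding mu_def by (simp only:)
qed

lemma nu_eq_F2:
  "F2 0 d (d + e) (d + e + f) * c ^ 4 / (1200 * (c + d + e + f) * (c + d + e) * (c + d)) = nu c d e f"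
proof -
  have "F2 0 d (d + e) (d + e + f) = 2 * (e\<^sup>2 * (d + e + f)\<^sup>2 + f * (e + f) * (d + e) * d)"
    by (simp add: F2_def power2_eq_square algebra_simps)
  moreover have "2 * x * y / (1200 * u * v * w) = x * y / (600 * u * v * w)" for x y u v w :: real
    by simp
  ultimately show ?thesis
    unfolding nu_def by (simp only:)
qed

text \<open>The left-hand side is what the triangular solve produces once the length a has dropped
  out, with r and r' the values from \<open>right_jet_values\<close>. Clearing denominators leaves a
  polynomial identity of degree 9.\<close>

lemma kappa_eq:
  assumes "c + d \<noteq> 0" "b + c + d \<noteq> 0" "c + d + e \<noteq> 0" "b + c + d + e \<noteq> 0"
  defines "r \<equiv> d ^ 4 / ((c + d) * (b + c + d))"
    and "r' \<equiv> (d ^ 3 + (d + e) ^ 3 + d\<^sup>2 * (d + e) + (d + e)\<^sup>2 * d - d ^ 4 / (c + d)) / (c + d + e)"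
  shows "- r * (F1 (- b - c) (- c) 0 * (2 * d + e) + 2 * (b + c) * c\<^sup>2 + 2 * c * (b + c)\<^sup>2)
    + F2 (- b - c) (- c) 0 d * (r' - r) / (b + c + d + e) = 1200 * kappa b c d e"
proof -
  define x y z w where "x = c + d" and "y = b + c + d" and "z = c + d + e" and "w = b + c + d + e"
  define H where "H = d ^ 3 + (d + e) ^ 3 + d\<^sup>2 * (d + e) + (d + e)\<^sup>2 * d"
  define A where "A = F1 (- b - c) (- c) 0 * (2 * d + e) + 2 * (b + c) * c\<^sup>2 + 2 * c * (b + c)\<^sup>2"
  define B where "B = F2 (- b - c) (- c) 0 d"
  have nz: "x \<noteq> 0" "y \<noteq> 0" "z \<noteq> 0" "w \<noteq> 0"
    using assms by (simp_all add: x_def y_def z_def w_def)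
  have "- (d ^ 4 / (x * y)) * A + B * ((H - d ^ 4 / x) / z - d ^ 4 / (x * y)) / w =
      (- (d ^ 4) * A * z * w + B * (H * x * y - d ^ 4 * y - d ^ 4 * z)) / (x * y * z * w)"
    using nz by (simp add: field_simps)
  also have "- (d ^ 4) * A * z * w + B * (H * x * y - d ^ 4 * y - d ^ 4 * z) = 2 * kappa_num b c d e"
    unfolding A_def B_def H_def x_def y_def z_def w_def F1_def F2_def kappa_num_def
    by Groebner_Basis.algebra
  also have "2 * kappa_num b c d e / (x * y * z * w) = 1200 * kappa b c d e"
  proof -
    have "kappa b c d e = kappa_num b c d e / (600 * y * w * x * z)"
      by (simp only: kappa_def x_def y_def z_def w_def)
    then show ?thesis
      by (simp add: mult_ac)
  qed
  finally show ?thesis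
    by (simp only: r_def r'_def A_def B_def H_def x_def y_def z_def w_def)
qed

text \<open>Regroups the equation by levels, D_3^T (D_4^T (D_5^T z + ...) + ...), so that one
  transposed matrix after the other can be removed using data near a single index.\<close>

lemma sop_peel:
  assumes "adiff \<theta> 3 (cutoff (n - 1) (adiff \<theta> 4 (cutoff (n - 2) x))) k = c k - sop n \<theta> v k"
  shows "adiff \<theta> 3 (cutoff (n - 1) (\<lambda>k. adiff \<theta> 4 (cutoff (n - 2)
      (\<lambda>k. x k + u2 \<theta> k * bdiff \<theta> 4 (bdiff \<theta> 3 v) k)) k + u1 \<theta> k * bdiff \<theta> 3 v k)) k = c k - u0 \<theta> k * v k"
proof -
  have *: "adiff \<theta> s (\<lambda>k. v k + w k) = (\<lambda>k. adiff \<theta> s v k + adiff \<theta> s w k)" for s v w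
    by (simp add: adiff_add fun_eq_iff)
  show ?thesis
    using assms unfolding sop_def by (simp add: cutoff_add * add.assoc add.left_commute add.commute)
qed

lemma F_translate:
  "F1 (t + x) (t + y) (t + z) = F1 x y z"
  "F2 (t + w) (t + x) (t + y) (t + z) = F2 w x y z"
  by (simp_all add: F1_def F2_def)

context spline_knots
begin

context
  fixes q :: nat and z :: "nat \<Rightarrow> real"
  assumes q: "1 \<le> q" "q + 3 \<le> n"
    and z: "\<And>k. 1 \<le> k \<Longrightarrow> k \<le> n \<Longrightarrow>
      adiff \<theta> 3 (cutoff (n - 1) (adiff \<theta> 4 (cutoff (n - 2) (adiff \<theta> 5 (cutoff (n - 3) z))))) k =
      trunc_coef (q + 3) k - sop n \<theta> (trunc_moment (\<theta> (q + 3))) k"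
begin

text \<open>Replacing the truncated square by its difference from the full square leaves z
  unchanged, by \<open>sop_moment\<close>. The new data \<open>M\<close> vanish up to index q, and
  each difference shortens this range by one, so the first entry that can be nonzero has index q -
  1.\<close>

lemma defect_left:
  defines "M \<equiv> \<lambda>k. trunc_moment (\<theta> (q + 3)) k - moment (\<theta> (q + 3)) k"
  shows "k + 1 < q \<Longrightarrow> cutoff (n - 3) z k = 0"
    and "1 \<le> k \<Longrightarrow> k + 1 = q \<Longrightarrow>
      z k = - knot_h \<theta> 5 k * u2 \<theta> k * bdiff \<theta> 4 (bdiff \<theta> 3 M) k"
    and "z q = cutoff (n - 3) z (q - 1) - knot_h \<theta> 5 q * (knot_h \<theta> 4 q * (u1 \<theta> q * bdiff \<theta> 3 M q)
      + u2 \<theta> q * bdiff \<theta> 4 (bdiff \<theta> 3 M) q)"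
proof -
  define c where "c = (\<lambda>k. trunc_coef (q + 3) k - coef (\<theta> (q + 3)) k)"
  define Y where "Y = (\<lambda>k. adiff \<theta> 5 (cutoff (n - 3) z) k + u2 \<theta> k * bdiff \<theta> 4 (bdiff \<theta> 3 M) k)"
  define X where "X = (\<lambda>k. adiff \<theta> 4 (cutoff (n - 2) Y) k + u1 \<theta> k * bdiff \<theta> 3 M k)"
  have h: "knot_h \<theta> s k \<noteq> 0" if "1 \<le> k" "3 \<le> s" "k + s \<le> n + 3" for s k
    using knot_h_pos[OF that] by simp
  have M0: "M k = 0" if "1 \<le> k" "k \<le> q" for k
    using that q trunc_moment_minus_moment[of k] right_jet_zero[of k 3 "\<theta> (q + 3)"] knot_mono[of "k + 3" "q + 3"]
    by (simp add: M_def)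
  have bM: "bdiff \<theta> 3 M k = 0" if "1 \<le> k" "k < q" for k
    using that M0[of k] M0[of "k + 1"] by (simp add: bdiff_def)
  have bbM: "bdiff \<theta> 4 (bdiff \<theta> 3 M) k = 0" if "1 \<le> k" "k + 1 < q" for k
    using that bM[of k] bM[of "k + 1"] by (simp add: bdiff_def[of _ 4])
  have eq: "adiff \<theta> 3 (cutoff (n - 1) X) k = c k - u0 \<theta> k * M k" if "1 \<le> k" "k \<le> n" for k
    unfolding X_def Y_def
  proof (rule sop_peel)
    show "adiff \<theta> 3 (cutoff (n - 1) (adiff \<theta> 4 (cutoff (n - 2) (adiff \<theta> 5 (cutoff (n - 3) z))))) k = c k - sop n \<theta> M k"
      unfolding z[OF that] M_def sop_diff sop_moment[OF that] c_def by simp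
  qed
  have c0: "c k = 0" if "1 \<le> k" "k \<le> q" for k
    using that by (simp add: c_def trunc_coef_def)
  have cX: "cutoff (n - 1) X k = 0" if "k \<le> q" for k
    by (rule adiff_zero_left[of _ q \<theta> 3]) (use eq M0 c0 h q that in auto)
  have "X k = 0" if "1 \<le> k" "k \<le> q" for k
    using cX[of k] that q by simp
  then have X0: "adiff \<theta> 4 (cutoff (n - 2) Y) k = - u1 \<theta> k * bdiff \<theta> 3 M k" if "1 \<le> k" "k \<le> q" for k
    using that unfolding X_def by (simp add: add_eq_0_iff2)
  have "cutoff (n - 2) Y k = 0" if "k \<le> q - 1" for k
    by (rule adiff_zero_left[of _ "q - 1" \<theta> 4]) (use X0 bM h q that in auto)
  then have cY: "cutoff (n - 2) Y k = 0" if "k < q" for k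
    using that by simp
  have "Y k = 0" if "1 \<le> k" "k < q" for k
    using cY[of k] that q by simp
  then have a5: "adiff \<theta> 5 (cutoff (n - 3) z) k = - u2 \<theta> k * bdiff \<theta> 4 (bdiff \<theta> 3 M) k" if "1 \<le> k" "k < q" for k
    using that unfolding Y_def by (simp add: add_eq_0_iff2)
  have "cutoff (n - 3) z k = 0" if "k \<le> q - 2" for k
    by (rule adiff_zero_left[of _ "q - 2" \<theta> 5]) (use a5 bbM h q that in auto)
  then have z0: "cutoff (n - 3) z k = 0" if "k + 1 < q" for k
    using that by simp
  then show "k + 1 < q \<Longrightarrow> cutoff (n - 3) z k = 0" .
  show "z k = - knot_h \<theta> 5 k * u2 \<theta> k * bdiff \<theta> 4 (bdiff \<theta> 3 M) k" if "1 \<le> k" "k + 1 = q" for k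
    using a5[of k] z0[of "k - 1"] that q h[of k 5]
    by (simp add: adiff_def divide_eq_eq mult.commute mult.left_commute)
  \<comment> \<open>The outermost level is still zero at q, but the next one no longer is: here
    \<open>u1\<close> enters, and with it the more involved form of \<open>kappa\<close>.\<close>
  have "Y q = - knot_h \<theta> 4 q * (u1 \<theta> q * bdiff \<theta> 3 M q)"
    using X0[of q] cY[of "q - 1"] q h[of q 4] by (simp add: adiff_def divide_eq_eq mult_ac)
  moreover define S where "S = knot_h \<theta> 4 q * (u1 \<theta> q * bdiff \<theta> 3 M q) + u2 \<theta> q * bdiff \<theta> 4 (bdiff \<theta> 3 M) q"
  ultimately have "adiff \<theta> 5 (cutoff (n - 3) z) q = - S"
    unfolding Y_def by linarith
  then have "z q = cutoff (n - 3) z (q - 1) - knot_h \<theta> 5 q * S"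
    using q h[of q 5] by (simp add: adiff_def divide_eq_eq mult.commute)
  then show "z q = cutoff (n - 3) z (q - 1) - knot_h \<theta> 5 q * (knot_h \<theta> 4 q * (u1 \<theta> q * bdiff \<theta> 3 M q)
      + u2 \<theta> q * bdiff \<theta> 4 (bdiff \<theta> 3 M) q)"
    unfolding S_def .
qed

text \<open>To the right of the break point the truncated moments vanish themselves, and so do the
  coefficients. The systems are solved from the right end, and the first entry that can be nonzero
  has index q + 1.\<close>

lemma defect_right:
  defines "M \<equiv> trunc_moment (\<theta> (q + 3))"
  shows "q + 2 \<le> k \<Longrightarrow> k \<le> n - 3 \<Longrightarrow> z k = 0"
    and "q + 4 \<le> n \<Longrightarrow> z (q + 1) = knot_h \<theta> 5 (q + 2) * u2 \<theta> (q + 2) * bdiff \<theta> 4 (bdiff \<theta> 3 M) (q + 2)"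
proof -
  define Y where "Y = (\<lambda>k. adiff \<theta> 5 (cutoff (n - 3) z) k + u2 \<theta> k * bdiff \<theta> 4 (bdiff \<theta> 3 M) k)"
  define X where "X = (\<lambda>k. adiff \<theta> 4 (cutoff (n - 2) Y) k + u1 \<theta> k * bdiff \<theta> 3 M k)"
  have h: "knot_h \<theta> s k \<noteq> 0" if "1 \<le> k" "3 \<le> s" "k + s \<le> n + 3" for s k
    using knot_h_pos[OF that] by simp
  have M0: "M k = 0" if "q + 3 \<le> k" "k \<le> n" for k
    using that q left_jet_zero[of k 3 "\<theta> (q + 3)"] knot_mono[of "q + 3" k]
    by (simp add: M_def trunc_moment_def)
  have bM: "bdiff \<theta> 3 M k = 0" if "q + 3 \<le> k" "k + 1 \<le> n" for k
    using that M0[of k] M0[of "k + 1"] by (simp add: bdiff_def)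
  have bbM: "bdiff \<theta> 4 (bdiff \<theta> 3 M) k = 0" if "q + 3 \<le> k" "k + 2 \<le> n" for k
    using that bM[of k] bM[of "k + 1"] by (simp add: bdiff_def[of _ 4])
  have eq: "adiff \<theta> 3 (cutoff (n - 1) X) k = trunc_coef (q + 3) k - u0 \<theta> k * M k" if "1 \<le> k" "k \<le> n" for k
    unfolding X_def Y_def M_def by (rule sop_peel) (rule z[OF that])
  have cX: "cutoff (n - 1) X k = 0" if "q + 2 \<le> k" "k \<le> n" for k
    by (rule adiff_zero_right[of _ n "q + 2" \<theta> 3]) (use eq M0 h q that in \<open>auto simp: trunc_coef_def\<close>)
  have "X k = 0" if "q + 2 \<le> k" "k \<le> n - 1" for k
    using cX[of k] that q by simp
  then have X0: "adiff \<theta> 4 (cutoff (n - 2) Y) k = - u1 \<theta> k * bdiff \<theta> 3 M k" if "q + 2 \<le> k" "k \<le> n - 1" for k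
    using that unfolding X_def by (simp add: add_eq_0_iff2)
  have cY: "cutoff (n - 2) Y k = 0" if "q + 2 \<le> k" "k \<le> n - 1" for k
    by (rule adiff_zero_right[of _ "n - 1" "q + 2" \<theta> 4]) (use X0 bM h q that in auto)
  have "Y k = 0" if "q + 2 \<le> k" "k \<le> n - 2" for k
    using cY[of k] that q by simp
  then have a5: "adiff \<theta> 5 (cutoff (n - 3) z) k = - u2 \<theta> k * bdiff \<theta> 4 (bdiff \<theta> 3 M) k"
    if "q + 2 \<le> k" "k \<le> n - 2" for k
    using that unfolding Y_def by (simp add: add_eq_0_iff2)
  have z0: "cutoff (n - 3) z k = 0" if "q + 2 \<le> k" "k \<le> n - 2" for k
    by (rule adiff_zero_right[of _ "n - 2" "q + 2" \<theta> 5]) (use a5 bbM h q that in auto)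
  show "z k = 0" if "q + 2 \<le> k" "k \<le> n - 3"
    using z0[of k] cutoff_eq[of k "n - 3" z] that by simp
  show "z (q + 1) = knot_h \<theta> 5 (q + 2) * u2 \<theta> (q + 2) * bdiff \<theta> 4 (bdiff \<theta> 3 M) (q + 2)" if "q + 4 \<le> n"
    using a5[of "q + 2"] z0[of "q + 2"] that q h[of "q + 2" 5] cutoff_eq[of "q + 1" "n - 3" z]
    by (simp add: adiff_def divide_eq_eq mult_ac)
qed

lemma trunc_defect:
  defines "a \<equiv> \<theta> (q + 1) - \<theta> q" and "b \<equiv> \<theta> (q + 2) - \<theta> (q + 1)" and "c \<equiv> \<theta> (q + 3) - \<theta> (q + 2)"
    and "d \<equiv> \<theta> (q + 4) - \<theta> (q + 3)" and "e \<equiv> \<theta> (q + 5) - \<theta> (q + 4)" and "f \<equiv> \<theta> (q + 6) - \<theta> (q + 5)"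
  assumes k: "1 \<le> k" "k \<le> n - 3"
  shows "z k = (if k + 1 = q then mu a b c d else 0) + (if k = q then kappa b c d e else 0)
    + (if k = q + 1 then nu c d e f else 0)"
proof -
  define M where "M = (\<lambda>k. trunc_moment (\<theta> (q + 3)) k - moment (\<theta> (q + 3)) k)"
  define r where "r = d ^ 4 / ((c + d) * (b + c + d))"
  define r' where "r' = (d ^ 3 + (d + e) ^ 3 + d\<^sup>2 * (d + e) + (d + e)\<^sup>2 * d - d ^ 4 / (c + d)) / (c + d + e)"
  have pos: "0 < c" "0 < d" "0 \<le> a" "0 \<le> b" "0 \<le> e" "0 \<le> f"
    using q knot_less[of "q + 2" "q + 3"] knot_less[of "q + 3" "q + 4"] knot_mono[of q "q + 1"]
      knot_mono[of "q + 1" "q + 2"] knot_mono[of "q + 4" "q + 5"] knot_mono[of "q + 5" "q + 6"]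
    by (auto simp: a_def b_def c_def d_def e_def f_def)
  have h: "knot_h \<theta> s k \<noteq> 0" if "1 \<le> k" "3 \<le> s" "k + s \<le> n + 3" for s k
    using knot_h_pos[OF that] by simp
  \<comment> \<open>The length in \<open>knot_h\<close> cancels the one in the weight, so the
    products below depend on the inner knots only.\<close>
  have "e / 5 * (G / (96 * e)) = G / 480" if "e \<noteq> 0" for e G :: real
    using that by (simp add: field_simps)
  from this[of "\<theta> (k + 5) - \<theta> k" for k]
  have u2h: "knot_h \<theta> 5 k * u2 \<theta> k = F2 (\<theta> (k + 1)) (\<theta> (k + 2)) (\<theta> (k + 3)) (\<theta> (k + 4)) / 480"
    if "1 \<le> k" "k + 2 \<le> n" for k
    using knot_less[of k "k + 5"] that unfolding u2_def knot_h_def of_nat_numeral by auto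
  have "e / 4 * (G / (6 * e)) = G / 24" if "e \<noteq> 0" for e G :: real
    using that by (simp add: field_simps)
  from this[of "\<theta> (k + 4) - \<theta> k" for k]
  have u1h: "knot_h \<theta> 4 k * u1 \<theta> k = F1 (\<theta> (k + 1)) (\<theta> (k + 2)) (\<theta> (k + 3)) / 24"
    if "1 \<le> k" "k + 1 \<le> n" for k
    using knot_less[of k "k + 4"] that unfolding u1_def knot_h_def of_nat_numeral by auto
  \<comment> \<open>\<open>F1\<close> and \<open>F2\<close> are translation invariant, so knots may
    be measured from the break point and become combinations of a, ..., f.\<close>
  define t where "t = \<theta> (q + 3)"
  have kn: "t + (- a - b - c) = \<theta> q" "t + (- b - c) = \<theta> (q + 1)" "t + - c = \<theta> (q + 2)"
    "t + 0 = \<theta> (q + 3)" "t + d = \<theta> (q + 4)" "t + (d + e) = \<theta> (q + 5)" "t + (d + e + f) = \<theta> (q + 6)"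
    by (simp_all add: t_def a_def b_def c_def d_def e_def f_def)
  have idx: "q + 1 + 1 = q + 2" "q + 2 + 1 = q + 3" "q + 3 + 1 = q + 4" "q + 1 + 4 = q + 5"
    "q + 2 + 2 = q + 4" "q + 2 + 3 = q + 5" "q + 2 + 4 = q + 6"
    by simp_all
  have M: "M k = knot_h \<theta> 3 k * (- jet_dd \<theta> k 3 (right_jet (\<theta> (q + 3))) / 10)" if "1 \<le> k" "k \<le> n" for k
    unfolding M_def trunc_moment_minus_moment[OF that] by simp
  have Mh: "M q / knot_h \<theta> 3 q = 0" "M (q + 1) / knot_h \<theta> 3 (q + 1) = - r / 10"
    "M (q + 2) / knot_h \<theta> 3 (q + 2) = - r' / 10"
    using M[of q] M[of "q + 1"] M[of "q + 2"] right_jet_zero[of q 3 "\<theta> (q + 3)"] right_jet_values[OF q]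
      h[of "q + 1" 3] h[of "q + 2" 3] q
    by (simp_all add: r_def r'_def b_def c_def d_def e_def)
  have b3: "bdiff \<theta> 3 M q = r / 10" "bdiff \<theta> 3 M (q + 1) = (r' - r) / 10"
    unfolding bdiff_def idx Mh by (simp_all add: diff_divide_distrib)
  have h4: "knot_h \<theta> 4 q = (a + b + c + d) / 4" "knot_h \<theta> 4 (q + 1) = (b + c + d + e) / 4"
    "knot_h \<theta> 4 (q + 2) = (c + d + e + f) / 4"
    unfolding knot_h_def idx by (simp_all add: a_def b_def c_def d_def e_def f_def)
  have quot: "x / 10 / (y / 4) = 2 / 5 * (x / y)" for x y :: real
    by simp
  have b4: "bdiff \<theta> 4 (bdiff \<theta> 3 M) q = 2 / 5 * (r / (a + b + c + d) - (r' - r) / (b + c + d + e))"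
    unfolding bdiff_def[of _ 4] h4 b3 quot by (rule right_diff_distrib[symmetric])
  have scale: "G / 480 * (2 / 5 * (D / (x * y) / w)) = G * D / (1200 * w * y * x)" for G D w x y :: real
    by (simp add: mult_ac)
  have mu: "cutoff (n - 3) z (q - 1) = mu a b c d"
  \<comment> \<open>For q = 1 the entry has index 0 and is zero by convention. The formula agrees,
    because the triple knot forces a = b = 0.\<close>
  proof (cases "q = 1")
    case True
    then have "a = 0" "b = 0"
      using knot_left[of 1] knot_left[of 2] knot_left[of 3] by (simp_all add: a_def b_def numeral_2_eq_2 numeral_3_eq_3)
    then show ?thesis
      using True by (simp add: mu_def)
  next
    case False
    define p where "p = q - 1"
    then have p: "p + 1 = q" "1 \<le> p" and pidx: "p + 2 = q + 1" "p + 3 = q + 2" "p + 4 = q + 3"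
      using False q by auto
    have "M p = 0"
      using M[of p] right_jet_zero[of p 3 "\<theta> (q + 3)"] knot_mono[of "p + 3" "q + 3"] p q by simp
    then have b3p: "bdiff \<theta> 3 M p = 0"
      unfolding bdiff_def p(1) Mh(1) by simp
    have b4p: "bdiff \<theta> 4 (bdiff \<theta> 3 M) p = - (2 / 5 * (r / (a + b + c + d)))"
      unfolding bdiff_def[of _ 4] p(1) h4 b3 b3p quot by simp
    have "1 \<le> p" "p + 2 \<le> n"
      using p q by auto
    from u2h[OF this] have u2p: "knot_h \<theta> 5 p * u2 \<theta> p = F2 (- a - b - c) (- b - c) (- c) 0 / 480"
      unfolding p(1) pidx F_translate(2)[of t "- a - b - c" "- b - c" "- c" 0, unfolded kn] .
    have "z p = - (knot_h \<theta> 5 p * u2 \<theta> p) * bdiff \<theta> 4 (bdiff \<theta> 3 M) p"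
      using defect_left(2)[of p] p unfolding M_def by simp
    also have "\<dots> = mu a b c d"
      unfolding b4p u2p r_def minus_mult_minus scale mu_eq_F2 ..
    moreover have "cutoff (n - 3) z (q - 1) = z p"
      using p q unfolding p_def[symmetric] by simp
    ultimately show ?thesis
      by simp
  qed
  have "z q = kappa b c d e"
  proof -
    define u where "u = F2 (- b - c) (- c) 0 d"
    define v where "v = F1 (- b - c) (- c) 0"
    \<comment> \<open>By \<open>F2_diff\<close> the quartic in \<open>mu\<close> is u - s g. The
      terms with denominator s therefore cancel, and in g + (s + e) v the length a drops out as
      well.\<close>
    define g where "g = (d - a - b - c) * v + 2 * (b + c) * c\<^sup>2 + 2 * c * (b + c)\<^sup>2"
    define s where "s = a + b + c + d"
    have s: "s \<noteq> 0"
      using pos by (simp add: s_def)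
    have F2u: "knot_h \<theta> 5 q * u2 \<theta> q = u / 480"
      using u2h[of q] q unfolding F_translate(2)[of t "- b - c" "- c" 0 d, unfolded kn] u_def by simp
    have F1v: "knot_h \<theta> 4 q * u1 \<theta> q = v / 24"
      using u1h[of q] q unfolding F_translate(1)[of t "- b - c" "- c" 0, unfolded kn] v_def by simp
    have h5: "knot_h \<theta> 5 q = (s + e) / 5"
      by (simp add: knot_h_def a_def b_def c_def d_def e_def s_def)
    have "F2 (- a - b - c) (- b - c) (- c) 0 = u - s * g"
      using F2_diff[of "- b - c" "- c" 0 d "- a - b - c"] unfolding u_def v_def g_def s_def
      by (simp add: algebra_simps power2_eq_square)
    then have mu_r: "mu a b c d = (u - s * g) / 480 * (2 / 5 * (r / s))"
      unfolding mu_eq_F2[symmetric] scale[symmetric] r_def s_def by simp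
    have "z q = mu a b c d - (knot_h \<theta> 5 q * ((knot_h \<theta> 4 q * u1 \<theta> q) * bdiff \<theta> 3 M q)
        + (knot_h \<theta> 5 q * u2 \<theta> q) * bdiff \<theta> 4 (bdiff \<theta> 3 M) q)"
      using defect_left(3) mu unfolding M_def by (simp add: algebra_simps)
    also have "\<dots> = (u - s * g) / 480 * (2 / 5 * (r / s)) - ((s + e) / 5 * (v / 24 * (r / 10))
        + u / 480 * (2 / 5 * (r / s - (r' - r) / (b + c + d + e))))"
      unfolding F2u F1v unfolding h5 b3 b4 mu_r s_def[symmetric] by (rule refl)
    finally have "1200 * z q = - r * (g + (s + e) * v) + u * ((r' - r) / (b + c + d + e))"
    proof -
      assume *: "z q = (u - s * g) / 480 * (2 / 5 * (r / s)) - ((s + e) / 5 * (v / 24 * (r / 10))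
        + u / 480 * (2 / 5 * (r / s - (r' - r) / (b + c + d + e))))"
      have "1200 * ((u - s * g) / 480 * (2 / 5 * (r / s)) - ((s + e) / 5 * (v / 24 * (r / 10))
        + u / 480 * (2 / 5 * (r / s - w)))) = - r * (g + (s + e) * v) + u * w" for w
        using s by (simp add: field_simps)
      then show ?thesis
        unfolding * .
    qed
    also have "g + (s + e) * v = v * (2 * d + e) + 2 * (b + c) * c\<^sup>2 + 2 * c * (b + c)\<^sup>2"
      unfolding g_def s_def by (simp add: algebra_simps)
    also have "- r * \<dots> + u * ((r' - r) / (b + c + d + e)) = 1200 * kappa b c d e"
      unfolding u_def v_def r_def r'_def times_divide_eq_right using pos by (intro kappa_eq) auto
    finally show ?thesis
      by simp
  qed
  moreover have "z (q + 1) = nu c d e f" if "q + 4 \<le> n"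
  proof -
    define T where "T = trunc_moment (\<theta> (q + 3))"
    define s where "s = c ^ 4 / ((c + d) * (c + d + e))"
    have T: "T (q + 3) = 0" "T (q + 4) = 0" "T (q + 2) / knot_h \<theta> 3 (q + 2) = s / 10"
      using left_jet_zero[of "q + 3" 3 "\<theta> (q + 3)"] left_jet_zero[of "q + 4" 3 "\<theta> (q + 3)"]
        knot_mono[of "q + 3" "q + 4"] left_jet_value[OF q] h[of "q + 2" 3] that
      by (simp_all add: T_def trunc_moment_def s_def c_def d_def e_def)
    have b3T: "bdiff \<theta> 3 T (q + 2) = s / 10" "bdiff \<theta> 3 T (q + 3) = 0"
      unfolding bdiff_def idx T by simp_all
    have b4T: "bdiff \<theta> 4 (bdiff \<theta> 3 T) (q + 2) = 2 / 5 * (s / (c + d + e + f))"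
      unfolding bdiff_def[of _ 4] idx b3T h4 quot by simp
    have u2q: "knot_h \<theta> 5 (q + 2) * u2 \<theta> (q + 2) = F2 0 d (d + e) (d + e + f) / 480"
      using u2h[of "q + 2"] that
      unfolding idx F_translate(2)[of t 0 d "d + e" "d + e + f", unfolded kn] by simp
    have "z (q + 1) = (knot_h \<theta> 5 (q + 2) * u2 \<theta> (q + 2)) * bdiff \<theta> 4 (bdiff \<theta> 3 T) (q + 2)"
      using defect_right(2)[OF that] unfolding T_def .
    then show ?thesis
      unfolding b4T u2q s_def nu_eq_F2[symmetric] scale .
  qed
  moreover have "z k = mu a b c d" if "k + 1 = q"
    using mu that k by auto
  moreover have "z k = 0" if "k + 1 < q"
    using defect_left(1)[OF that] k by simp
  moreover have "z k = 0" if "q + 2 \<le> k"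
    using defect_right(1)[OF that k(2)] .
  ultimately show ?thesis
    using k by (cases "k + 1 < q \<or> q + 2 \<le> k") auto
qed

end

end

section \<open>Homogeneity and symmetry\<close>

text \<open>Multiplication by one variable at a time makes the extraction of coefficients a mere
  shift of exponents. Products and powers are derived from it, so \<open>kappa_num\<close> can be
  treated as written, without expansion.\<close>

inductive homogeneous :: "nat \<Rightarrow> (real \<Rightarrow> real \<Rightarrow> real \<Rightarrow> real \<Rightarrow> real) \<Rightarrow> bool" where
  const: "homogeneous 0 (\<lambda>b c d e. x)"
| add: "homogeneous m p \<Longrightarrow> homogeneous m q \<Longrightarrow> homogeneous m (\<lambda>b c d e. p b c d e + q b c d e)"
| mult_1: "homogeneous m p \<Longrightarrow> homogeneous (Suc m) (\<lambda>b c d e. p b c d e * b)"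
| mult_2: "homogeneous m p \<Longrightarrow> homogeneous (Suc m) (\<lambda>b c d e. p b c d e * c)"
| mult_3: "homogeneous m p \<Longrightarrow> homogeneous (Suc m) (\<lambda>b c d e. p b c d e * d)"
| mult_4: "homogeneous m p \<Longrightarrow> homogeneous (Suc m) (\<lambda>b c d e. p b c d e * e)"

lemma homogeneous_scale: "homogeneous k q \<Longrightarrow> homogeneous k (\<lambda>b c d e. x * q b c d e)"
proof (induction rule: homogeneous.induct)
  case (const y)
  show ?case by (rule homogeneous.const)
next
  case (add m p q)
  then show ?case by (simp add: distrib_left homogeneous.add)
qed (simp_all only: mult.assoc[symmetric] homogeneous.intros)

lemma homogeneous_mult:
  assumes p: "homogeneous m p" and q: "homogeneous k q"
  shows "homogeneous (m + k) (\<lambda>b c d e. p b c d e * q b c d e)"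
  using q
proof (induction rule: homogeneous.induct)
  case (const x)
  show ?case
    using homogeneous_scale[OF p, of x] by (simp add: mult.commute)
next
  case (add k q r)
  then show ?case by (simp add: distrib_left homogeneous.add)
qed (simp_all only: mult.assoc[symmetric] add_Suc_right homogeneous.intros)

lemma homogeneous_power:
  assumes "homogeneous m p"
  shows "homogeneous (k * m) (\<lambda>b c d e. p b c d e ^ k)"
proof (induction k)
  case 0
  show ?case using homogeneous.const[of 1] by simp
next
  case (Suc k)
  then show ?case using homogeneous_mult[OF assms Suc] by simp
qed

lemma homogeneous_var:
  "homogeneous 1 (\<lambda>b c d e. b)" "homogeneous 1 (\<lambda>b c d e. c)"
  "homogeneous 1 (\<lambda>b c d e. d)" "homogeneous 1 (\<lambda>b c d e. e)"
  using homogeneous.intros(3-6)[OF homogeneous.const[of 1]] by simp_all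

definition exponents :: "nat \<Rightarrow> (nat \<times> nat \<times> nat \<times> nat) set" where
  "exponents m = {(i, j, k, l). i + j + k + l = m}"

definition monomial :: "real \<Rightarrow> real \<Rightarrow> real \<Rightarrow> real \<Rightarrow> nat \<times> nat \<times> nat \<times> nat \<Rightarrow> real" where
  "monomial b c d e = (\<lambda>(i, j, k, l). b ^ i * c ^ j * d ^ k * e ^ l)"

lemma finite_exponents: "finite (exponents m)"
proof (rule finite_subset)
  show "exponents m \<subseteq> {..m} \<times> {..m} \<times> {..m} \<times> {..m}"
    by (auto simp: exponents_def)
qed simp

lemma shift_monomials:
  assumes "inj s" "\<And>t. s t \<in> exponents (Suc m) \<longleftrightarrow> t \<in> exponents m"
    "\<And>b c d e t. monomial b c d e (s t) = monomial b c d e t * v b c d e"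
  shows "\<exists>g. \<forall>b c d e. (\<Sum>t\<in>exponents m. f t * monomial b c d e t) * v b c d e =
    (\<Sum>t\<in>exponents (Suc m). g t * monomial b c d e t)"
proof (intro exI allI)
  fix b c d e
  \<comment> \<open>Exponents outside the image of the shift receive coefficient zero.\<close>
  let ?g = "\<lambda>t. if t \<in> range s then f (inv_into UNIV s t) else 0"
  have "(\<Sum>t\<in>exponents (Suc m). ?g t * monomial b c d e t) = (\<Sum>t\<in>s ` exponents m. ?g t * monomial b c d e t)"
    using assms(2) by (intro sum.mono_neutral_right) (auto simp: finite_exponents)
  also have "\<dots> = (\<Sum>t\<in>exponents m. f t * monomial b c d e (s t))"
    using assms(1) by (subst sum.reindex) (auto intro: inj_on_subset)
  finally show "(\<Sum>t\<in>exponents m. f t * monomial b c d e t) * v b c d e =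
      (\<Sum>t\<in>exponents (Suc m). ?g t * monomial b c d e t)"
    by (simp add: assms(3) sum_distrib_right mult.assoc)
qed

lemma homogeneous_monomials:
  assumes "homogeneous m p"
  shows "\<exists>f. \<forall>b c d e. p b c d e = (\<Sum>t\<in>exponents m. f t * monomial b c d e t)"
  using assms
proof (induction rule: homogeneous.induct)
  case (const x)
  have "exponents 0 = {(0, 0, 0, 0)}"
    by (auto simp: exponents_def)
  then show ?case
    by (intro exI[of _ "\<lambda>_. x"]) (simp add: monomial_def)
next
  case (add m p q)
  then obtain f g where "\<forall>b c d e. p b c d e = (\<Sum>t\<in>exponents m. f t * monomial b c d e t)"
    and "\<forall>b c d e. q b c d e = (\<Sum>t\<in>exponents m. g t * monomial b c d e t)"
    by blast
  then show ?case
    by (intro exI[of _ "\<lambda>t. f t + g t"]) (simp add: sum.distrib distrib_right)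
next
  case (mult_1 m p)
  then obtain f where "\<forall>b c d e. p b c d e = (\<Sum>t\<in>exponents m. f t * monomial b c d e t)"
    by blast
  with shift_monomials[of "\<lambda>(i, j, k, l). (Suc i, j, k, l)" m "\<lambda>b c d e. b" f] show ?case
    by (simp add: inj_def exponents_def monomial_def split_beta)
next
  case (mult_2 m p)
  then obtain f where "\<forall>b c d e. p b c d e = (\<Sum>t\<in>exponents m. f t * monomial b c d e t)"
    by blast
  with shift_monomials[of "\<lambda>(i, j, k, l). (i, Suc j, k, l)" m "\<lambda>b c d e. c" f] show ?case
    by (simp add: inj_def exponents_def monomial_def split_beta)
next
  case (mult_3 m p)
  then obtain f where "\<forall>b c d e. p b c d e = (\<Sum>t\<in>exponents m. f t * monomial b c d e t)"
    by blast
  with shift_monomials[of "\<lambda>(i, j, k, l). (i, j, Suc k, l)" m "\<lambda>b c d e. d" f] show ?case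
    by (simp add: inj_def exponents_def monomial_def split_beta)
next
  case (mult_4 m p)
  then obtain f where "\<forall>b c d e. p b c d e = (\<Sum>t\<in>exponents m. f t * monomial b c d e t)"
    by blast
  with shift_monomials[of "\<lambda>(i, j, k, l). (i, j, k, Suc l)" m "\<lambda>b c d e. e" f] show ?case
    by (simp add: inj_def exponents_def monomial_def split_beta)
qed

lemma homogeneous_poly4I:
  assumes "homogeneous m p" "p b\<^sub>0 c\<^sub>0 d\<^sub>0 e\<^sub>0 \<noteq> 0"
  shows "homogeneous_poly4 m p"
proof -
  obtain f where f: "\<And>b c d e. p b c d e = (\<Sum>t\<in>exponents m. f t * monomial b c d e t)"
    using homogeneous_monomials[OF assms(1)] by blast
  have "\<exists>t\<in>exponents m. f t \<noteq> 0"
    using assms(2) unfolding f by (auto dest: sum.not_neutral_contains_not_neutral)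
  then have "\<exists>i j k l. i + j + k + l = m \<and> f (i, j, k, l) \<noteq> 0"
    by (auto simp: exponents_def)
  moreover have "p b c d e = (\<Sum>(i, j, k, l) \<in> {(i, j, k, l). i + j + k + l = m}.
      f (i, j, k, l) * b ^ i * c ^ j * d ^ k * e ^ l)" for b c d e
    unfolding f exponents_def by (rule sum.cong) (auto simp: monomial_def)
  ultimately show ?thesis
    unfolding homogeneous_poly4_def by blast
qed

lemma homogeneous_kappa_num: "homogeneous 9 kappa_num"
proof -
  have mult: "homogeneous m p \<Longrightarrow> homogeneous k q \<Longrightarrow> m + k = l \<Longrightarrow> homogeneous l (\<lambda>b c d e. p b c d e * q b c d e)"
    and power: "homogeneous 1 p \<Longrightarrow> homogeneous k (\<lambda>b c d e. p b c d e ^ k)" for m k l p q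
    using homogeneous_mult homogeneous_power[of 1 p k] by auto
  show ?thesis
    unfolding kappa_num_def[abs_def]
    by (intro homogeneous.add; ((rule mult power homogeneous_var homogeneous.add) | simp)+)
qed

text \<open>Reflecting the line about the knot reverses the four lengths. Numerator and denominator
  are each invariant.\<close>

lemma kappa_reverse: "kappa b c d e = kappa e d c b"
proof -
  have "kappa_num b c d e = kappa_num e d c b"
    unfolding kappa_num_def by Groebner_Basis.algebra
  moreover have "600 * (b + c + d) * (b + c + d + e) * (c + d) * (c + d + e) =
      600 * (e + d + c) * (e + d + c + b) * (d + c) * (d + c + b)"
    by Groebner_Basis.algebra
  ultimately show ?thesis
    by (simp only: kappa_def)
qed

section \<open>Translation to matrices\<close>

definition svec :: "nat \<Rightarrow> (nat \<Rightarrow> real) \<Rightarrow> real vec" where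
  "svec m f = vec m (\<lambda>i. f (Suc i))"

lemma dim_svec [simp]: "dim_vec (svec m f) = m"
  by (simp add: svec_def)

lemma index_svec [simp]: "i < m \<Longrightarrow> svec m f $ i = f (Suc i)"
  by (simp add: svec_def)

lemma svec_carrier [simp]: "svec m f \<in> carrier_vec m"
  by (simp add: svec_def)

lemma svec_cong: "(\<And>k. 1 \<le> k \<Longrightarrow> k \<le> m \<Longrightarrow> f k = g k) \<Longrightarrow> svec m f = svec m g"
  by (auto simp: svec_def)

lemma svec_eq_iff: "svec m f = svec m g \<longleftrightarrow> (\<forall>k. 1 \<le> k \<and> k \<le> m \<longrightarrow> f k = g k)"
proof
  assume eq: "svec m f = svec m g"
  show "\<forall>k. 1 \<le> k \<and> k \<le> m \<longrightarrow> f k = g k"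
  proof (intro allI impI)
    fix k
    assume "1 \<le> k \<and> k \<le> m"
    then obtain i where "k = Suc i" "i < m"
      by (cases k) auto
    then show "f k = g k"
      using arg_cong[OF eq, of "\<lambda>v. v $ i"] by simp
  qed
qed (auto intro: svec_cong)

lemma svec_scalar_prod: "svec m f \<bullet> svec m g = (\<Sum>k = 1..m. f k * g k)"
  by (simp add: scalar_prod_def sum.atLeast1_atMost_eq atLeast0LessThan)

lemma vec_eq_svec: "v \<in> carrier_vec m \<Longrightarrow> v = svec m (\<lambda>k. v $ (k - 1))"
  by (intro eq_vecI) auto

lemma mult_mat_vec_assoc:
  "dim_col A = dim_row B \<Longrightarrow> dim_col B = dim_vec v \<Longrightarrow> (A * B) *\<^sub>v v = A *\<^sub>v (B *\<^sub>v (v :: real vec))"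
  by (rule assoc_mult_mat_vec[of _ "dim_row A" "dim_col A" _ "dim_col B"]) auto

lemma transpose_mult_dim: "dim_col A = dim_row B \<Longrightarrow> (A * B)\<^sup>T = B\<^sup>T * (A :: real mat)\<^sup>T"
  by (rule transpose_mult[of _ "dim_row A" "dim_col A" _ "dim_col B"]) auto

lemma transpose_mat_diag [simp]: "(mat_diag m f)\<^sup>T = mat_diag m f"
  by (rule eq_matI) (auto simp: mat_diag_def)

lemma dim_mat_diag [simp]: "dim_row (mat_diag m f) = m" "dim_col (mat_diag m f) = m"
  by (simp_all add: mat_diag_def)

lemma mat_diag_mult_svec: "mat_diag m (\<lambda>i. u (i + 1)) *\<^sub>v svec m f = svec m (\<lambda>k. u k * f k)"
proof (rule eq_vecI)
  fix i
  assume "i < dim_vec (svec m (\<lambda>k. u k * f k))"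
  then show "(mat_diag m (\<lambda>i. u (i + 1)) *\<^sub>v svec m f) $ i = svec m (\<lambda>k. u k * f k) $ i"
    by (simp add: scalar_prod_def mat_diag_def if_distrib[of "\<lambda>x. x * _"] cong: if_cong)
qed simp

lemma row_mult_mat:
  assumes "i < dim_row A" "dim_col A = dim_row B"
  shows "row (A * B) i = B\<^sup>T *\<^sub>v row (A :: real mat) i"
proof (rule eq_vecI)
  fix k
  assume "k < dim_vec (B\<^sup>T *\<^sub>v row A i)"
  then show "row (A * B) i $ k = (B\<^sup>T *\<^sub>v row A i) $ k"
    using assms comm_scalar_prod[of "row A i" "dim_row B" "col B k"] by (simp add: carrier_vecI)
qed (use assms in simp)

lemma Dmat_mult_svec:
  assumes "s \<le> n + 2"
  shows "Dmat n \<theta> s *\<^sub>v svec (n + 3 - s) f = svec (n + 2 - s) (bdiff \<theta> s f)"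
proof (rule eq_vecI)
  fix i
  assume i: "i < dim_vec (svec (n + 2 - s) (bdiff \<theta> s f))"
  have "(Dmat n \<theta> s *\<^sub>v svec (n + 3 - s) f) $ i = (\<Sum>j\<in>{0..<n + 3 - s}. Dmat n \<theta> s $$ (i, j) * f (Suc j))"
    using i by (simp add: Dmat_def scalar_prod_def)
  also have "\<dots> = (\<Sum>j\<in>{0..<n + 3 - s}. (if j = i then f (i + 1) / knot_h \<theta> s (i + 1) else 0)
      - (if j = i + 1 then f (i + 2) / knot_h \<theta> s (i + 2) else 0))"
    using i by (intro sum.cong) (auto simp: Dmat_def divide_inverse)
  also have "\<dots> = bdiff \<theta> s f (i + 1)"
  proof -
    have "i < n + 3 - s" "i + 1 < n + 3 - s"
      using i assms by auto
    then show ?thesis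
      by (simp add: sum_subtractf bdiff_def)
  qed
  finally show "(Dmat n \<theta> s *\<^sub>v svec (n + 3 - s) f) $ i = svec (n + 2 - s) (bdiff \<theta> s f) $ i"
    using i by simp
qed (simp add: Dmat_def)

lemma Dmat_transpose_mult_svec:
  assumes "s \<le> n + 2"
  shows "(Dmat n \<theta> s)\<^sup>T *\<^sub>v svec (n + 2 - s) f = svec (n + 3 - s) (adiff \<theta> s (cutoff (n + 2 - s) f))"
proof (rule eq_vecI)
  fix i
  assume i: "i < dim_vec (svec (n + 3 - s) (adiff \<theta> s (cutoff (n + 2 - s) f)))"
  have "((Dmat n \<theta> s)\<^sup>T *\<^sub>v svec (n + 2 - s) f) $ i = (\<Sum>j\<in>{0..<n + 2 - s}. Dmat n \<theta> s $$ (j, i) * f (Suc j))"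
    using i by (simp add: Dmat_def scalar_prod_def)
  also have "\<dots> = (\<Sum>j\<in>{0..<n + 2 - s}. (if j = i then f (i + 1) / knot_h \<theta> s (i + 1) else 0)
      - (if i = j + 1 then f i / knot_h \<theta> s (i + 1) else 0))"
    using i by (intro sum.cong) (auto simp: Dmat_def divide_inverse)
  also have "\<dots> = adiff \<theta> s (cutoff (n + 2 - s) f) (i + 1)"
    using i assms by (cases i) (auto simp: sum_subtractf adiff_def cutoff_def diff_divide_distrib)
  finally show "((Dmat n \<theta> s)\<^sup>T *\<^sub>v svec (n + 2 - s) f) $ i =
      svec (n + 3 - s) (adiff \<theta> s (cutoff (n + 2 - s) f)) $ i"
    using i by simp
qed (simp add: Dmat_def)

lemma dim_Dmat [simp]:
  "dim_row (Dmat n \<theta> 3) = n - 1" "dim_col (Dmat n \<theta> 3) = n"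
  "dim_row (Dmat n \<theta> 4) = n - 2" "dim_col (Dmat n \<theta> 4) = n - 1"
  "dim_row (Dmat n \<theta> 5) = n - 3" "dim_col (Dmat n \<theta> 5) = n - 2"
  by (simp_all add: Dmat_def)

lemma dim_Smat [simp]: "dim_row (Smat n \<theta>) = n" "dim_col (Smat n \<theta>) = n"
  by (simp_all add: Smat_def Let_def)

lemma Smat_carrier [simp]: "Smat n \<theta> \<in> carrier_mat n n"
  by (simp add: carrier_matI)

lemma Smat_transpose: "(Smat n \<theta>)\<^sup>T = Smat n \<theta>"
proof -
  have "(A + B)\<^sup>T = A\<^sup>T + B\<^sup>T" if "dim_row A = dim_row B" "dim_col A = dim_col B" for A B :: "real mat"
    using that by (intro eq_matI) auto
  moreover have "A * B * C = A * (B * C)" if "dim_col A = dim_row B" "dim_col B = dim_row C" for A B C :: "real mat"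
    using that by (intro assoc_mult_mat[of _ "dim_row A" "dim_col A" _ "dim_col B" _ "dim_col C"]) auto
  ultimately show ?thesis
    unfolding Smat_def Let_def by (simp add: transpose_mult_dim)
qed

definition dmul :: "nat \<Rightarrow> (nat \<Rightarrow> real) \<Rightarrow> real vec \<Rightarrow> real vec" where
  "dmul n \<theta> v = Dmat n \<theta> 5 *\<^sub>v (Dmat n \<theta> 4 *\<^sub>v (Dmat n \<theta> 3 *\<^sub>v v))"

definition dtmul :: "nat \<Rightarrow> (nat \<Rightarrow> real) \<Rightarrow> real vec \<Rightarrow> real vec" where
  "dtmul n \<theta> v = (Dmat n \<theta> 3)\<^sup>T *\<^sub>v ((Dmat n \<theta> 4)\<^sup>T *\<^sub>v ((Dmat n \<theta> 5)\<^sup>T *\<^sub>v v))"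

context spline_knots
begin

lemma Dmat_svec:
  "Dmat n \<theta> 3 *\<^sub>v svec n f = svec (n - 1) (bdiff \<theta> 3 f)"
  "Dmat n \<theta> 4 *\<^sub>v svec (n - 1) f = svec (n - 2) (bdiff \<theta> 4 f)"
  "Dmat n \<theta> 5 *\<^sub>v svec (n - 2) f = svec (n - 3) (bdiff \<theta> 5 f)"
  using Dmat_mult_svec[of 3 n \<theta> f] Dmat_mult_svec[of 4 n \<theta> f] Dmat_mult_svec[of 5 n \<theta> f] n_ge_3
  by simp_all

lemma Dmat_transpose_svec:
  "(Dmat n \<theta> 3)\<^sup>T *\<^sub>v svec (n - 1) f = svec n (adiff \<theta> 3 (cutoff (n - 1) f))"
  "(Dmat n \<theta> 4)\<^sup>T *\<^sub>v svec (n - 2) f = svec (n - 1) (adiff \<theta> 4 (cutoff (n - 2) f))"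
  "(Dmat n \<theta> 5)\<^sup>T *\<^sub>v svec (n - 3) f = svec (n - 2) (adiff \<theta> 5 (cutoff (n - 3) f))"
  using Dmat_transpose_mult_svec[of 3 n \<theta> f] Dmat_transpose_mult_svec[of 4 n \<theta> f]
    Dmat_transpose_mult_svec[of 5 n \<theta> f] n_ge_3
  by simp_all

lemma dmul_svec: "dmul n \<theta> (svec n f) = svec (n - 3) (bdiff \<theta> 5 (bdiff \<theta> 4 (bdiff \<theta> 3 f)))"
  by (simp only: dmul_def Dmat_svec)

lemma dtmul_svec:
  "dtmul n \<theta> (svec (n - 3) f) = svec n (adiff \<theta> 3 (cutoff (n - 1) (adiff \<theta> 4 (cutoff (n - 2) (adiff \<theta> 5 (cutoff (n - 3) f))))))"
  by (simp only: dtmul_def Dmat_transpose_svec)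

lemma Smat_svec: "Smat n \<theta> *\<^sub>v svec n f = svec n (sop n \<theta> f)"
proof -
  have add: "(A + B) *\<^sub>v v = A *\<^sub>v v + B *\<^sub>v v"
    if "dim_row A = dim_row B" "dim_col A = dim_col B" "dim_col B = dim_vec v" for A B :: "real mat" and v
    using that by (intro add_mult_distrib_mat_vec[of _ "dim_row B" "dim_col B"]) auto
  have svec_add: "svec m f + svec m g = svec m (\<lambda>k. f k + g k)" for m f g
    by (rule eq_vecI) auto
  have "Smat n \<theta> *\<^sub>v svec n f = mat_diag n (\<lambda>i. u0 \<theta> (i + 1)) *\<^sub>v svec n f
      + (Dmat n \<theta> 3)\<^sup>T *\<^sub>v (mat_diag (n - 1) (\<lambda>i. u1 \<theta> (i + 1)) *\<^sub>v (Dmat n \<theta> 3 *\<^sub>v svec n f))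
      + (Dmat n \<theta> 3)\<^sup>T *\<^sub>v ((Dmat n \<theta> 4)\<^sup>T *\<^sub>v (mat_diag (n - 2) (\<lambda>i. u2 \<theta> (i + 1)) *\<^sub>v
          (Dmat n \<theta> 4 *\<^sub>v (Dmat n \<theta> 3 *\<^sub>v svec n f))))"
    unfolding Smat_def Let_def by (simp add: add mult_mat_vec_assoc)
  also have "\<dots> = svec n (sop n \<theta> f)"
    unfolding Dmat_svec mat_diag_mult_svec Dmat_transpose_svec svec_add sop_def
    by (simp add: cutoff_add adiff_add add.assoc)
  finally show ?thesis .
qed

section \<open>The Gram matrix and reproducing kernels in coefficients\<close>

lemma Gram_eq: "Gram n \<theta> = mat n n (\<lambda>(i, j). gram (Suc i) (Suc j))"
proof (rule eq_matI)
  fix i j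
  assume "i < dim_row (mat n n (\<lambda>(i, j). gram (Suc i) (Suc j)))" "j < dim_col (mat n n (\<lambda>(i, j). gram (Suc i) (Suc j)))"
  then show "Gram n \<theta> $$ (i, j) = mat n n (\<lambda>(i, j). gram (Suc i) (Suc j)) $$ (i, j)"
    using knot_left[of 1] knot_right[of "n + 3"]
    by (auto simp: Gram_def gram_def bspline_eq_quad intro!: Henstock_Kurzweil_Integration.integral_cong)
qed (simp_all add: Gram_def)

lemma Gram_carrier [simp]: "Gram n \<theta> \<in> carrier_mat n n"
  by (simp add: Gram_eq)

lemma dim_Gram [simp]: "dim_row (Gram n \<theta>) = n" "dim_col (Gram n \<theta>) = n"
  by (simp_all add: Gram_eq)

lemma Gram_transpose: "(Gram n \<theta>)\<^sup>T = Gram n \<theta>"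
  by (rule eq_matI) (auto simp: Gram_eq gram_sym)

lemma row_Gram: "i < n \<Longrightarrow> row (Gram n \<theta>) i = svec n (gram (Suc i))"
  by (rule eq_vecI) (auto simp: Gram_eq)

lemma Gram_svec: "Gram n \<theta> *\<^sub>v svec n f = svec n (\<lambda>i. \<Sum>j = 1..n. gram i j * f j)"
  by (rule eq_vecI) (simp_all add: row_Gram svec_scalar_prod)

lemma cvec_eq_svec: "cvec n \<theta> l = svec n (trunc_coef l)"
  by (rule eq_vecI) (auto simp: cvec_def trunc_coef_def coef_def)

lemma Phi3_eq_svec: "x \<in> {\<alpha>..\<beta>} \<Longrightarrow> Phi3 n \<theta> x = svec n (\<lambda>k. quad k x)"
  by (rule eq_vecI) (auto simp: Phi3_def bspline_eq_quad)

text \<open>Integrating p against the kernel gives (Gamma v)^T M Phi(x) = (M^T Gamma v) . Phi(x), so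
  reproduction reduces to a fixed-point equation for coefficient vectors.\<close>

lemma reproduces_coef:
  assumes M: "M \<in> carrier_mat n n"
    and p: "\<And>x. x \<in> {\<alpha>..\<beta>} \<Longrightarrow> (\<Sum>j = 1..n. v j * quad j x) = p x"
    and fixed: "M\<^sup>T *\<^sub>v (Gram n \<theta> *\<^sub>v svec n v) = svec n v"
  shows "reproduces \<alpha> \<beta> (spline_kernel n \<theta> M) p"
  unfolding reproduces_def
proof
  fix x
  assume x: "x \<in> {\<alpha>..\<beta>}"
  define w where "w = M *\<^sub>v Phi3 n \<theta> x"
  have Phi: "Phi3 n \<theta> y \<in> carrier_vec n" for y
    by (simp add: Phi3_def)
  have w: "w \<in> carrier_vec n"
    unfolding w_def by (rule mult_mat_vec_carrier[OF M Phi])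
  define u where "u = (\<lambda>k. w $ (k - 1))"
  have wu: "w = svec n u"
    unfolding u_def by (rule vec_eq_svec[OF w])
  have L: "spline_kernel n \<theta> M x y = Phi3 n \<theta> y \<bullet> w" for y
    unfolding spline_kernel_def w_def by (rule transpose_vec_mult_scalar[OF M Phi Phi])
  have "((\<lambda>y. \<Sum>i = 1..n. p y * quad i y * u i) has_integral
      (\<Sum>i = 1..n. (\<Sum>j = 1..n. gram i j * v j) * u i)) {\<alpha>..\<beta>}"
    by (intro has_integral_sum has_integral_mult_left gram_apply_has_integral) (use p in auto)
  moreover have "(\<Sum>i = 1..n. p y * quad i y * u i) = p y * spline_kernel n \<theta> M x y" if "y \<in> {\<alpha>..\<beta>}" for y
    unfolding L wu Phi3_eq_svec[OF that] svec_scalar_prod sum_distrib_left mult.assoc ..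
  moreover have "(\<Sum>i = 1..n. (\<Sum>j = 1..n. gram i j * v j) * u i) = p x"
  proof -
    have "(\<Sum>i = 1..n. (\<Sum>j = 1..n. gram i j * v j) * u i) = (Gram n \<theta> *\<^sub>v svec n v) \<bullet> w"
      unfolding Gram_svec wu svec_scalar_prod ..
    also have "\<dots> = (M\<^sup>T *\<^sub>v (Gram n \<theta> *\<^sub>v svec n v)) \<bullet> Phi3 n \<theta> x"
      unfolding w_def using M Phi
      by (intro transpose_vec_mult_scalar[symmetric]) (auto simp: Gram_svec)
    also have "\<dots> = p x"
      unfolding fixed Phi3_eq_svec[OF x] svec_scalar_prod by (rule p[OF x])
    finally show ?thesis .
  qed
  ultimately show "((\<lambda>y. p y * spline_kernel n \<theta> M x y) has_integral p x) {\<alpha>..\<beta>}"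
    using has_integral_eq[of "{\<alpha>..\<beta>}" "\<lambda>y. \<Sum>i = 1..n. p y * quad i y * u i"
      "\<lambda>y. p y * spline_kernel n \<theta> M x y"] by simp
qed

lemma reproduces_add:
  assumes "reproduces \<alpha> \<beta> L p" "reproduces \<alpha> \<beta> L q"
  shows "reproduces \<alpha> \<beta> L (\<lambda>x. p x + q x)"
  unfolding reproduces_def distrib_right
  using assms by (auto simp: reproduces_def intro!: has_integral_add)

lemma reproduces_cmult:
  assumes "reproduces \<alpha> \<beta> L p"
  shows "reproduces \<alpha> \<beta> L (\<lambda>x. a * p x)"
  unfolding reproduces_def mult.assoc
  using assms by (auto simp: reproduces_def intro!: has_integral_mult_right)

lemma reproduces_quadratic:
  assumes sq: "\<And>s. reproduces \<alpha> \<beta> L (\<lambda>x. (s - x)\<^sup>2)" and "degree p \<le> 2"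
  shows "reproduces \<alpha> \<beta> L (poly p)"
proof -
  \<comment> \<open>The squares of -x, 1 - x and -1 - x span the quadratics; a and b solve a + b =
    \<open>coeff p 0\<close> and 2 (b - a) = \<open>coeff p 1\<close>.\<close>
  define a b where "a = (coeff p 0 - coeff p 1 / 2) / 2" and "b = (coeff p 0 + coeff p 1 / 2) / 2"
  have "poly p x = (coeff p 2 - coeff p 0) * (0 - x)\<^sup>2 + (a * (1 - x)\<^sup>2 + b * (- 1 - x)\<^sup>2)" for x
  proof -
    have "poly p x = (\<Sum>i\<le>2. coeff p i * x ^ i)"
      unfolding poly_altdef using assms(2)
      by (intro sum.mono_neutral_left) (auto simp: coeff_eq_0)
    also have "\<dots> = coeff p 0 + coeff p 1 * x + coeff p 2 * x\<^sup>2"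
      by (simp add: numeral_2_eq_2)
    finally show ?thesis
      by (simp add: a_def b_def power2_eq_square field_simps)
  qed
  then have "poly p = (\<lambda>x. (coeff p 2 - coeff p 0) * (0 - x)\<^sup>2 + (a * (1 - x)\<^sup>2 + b * (- 1 - x)\<^sup>2))"
    by blast
  then show ?thesis
    by (simp only:) (intro reproduces_add reproduces_cmult sq)
qed


section \<open>The factor Z and its products with coefficient vectors\<close>

lemma defect_matrix:
  obtains Z where "Z \<in> carrier_mat n (n - 3)"
    "1\<^sub>m n - Gram n \<theta> * Smat n \<theta> = Z * (Dmat n \<theta> 5 * Dmat n \<theta> 4 * Dmat n \<theta> 3)"
    "\<And>i j. i < n \<Longrightarrow> j < n - 3 \<Longrightarrow> i + 1 < j \<Longrightarrow> Z $$ (i, j) = 0"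
proof -
  define P where "P = (\<lambda>i z. (\<forall>k. 1 \<le> k \<and> k \<le> n \<longrightarrow>
      adiff \<theta> 3 (cutoff (n - 1) (adiff \<theta> 4 (cutoff (n - 2) (adiff \<theta> 5 (cutoff (n - 3) z))))) k =
      (if k = i then 1 else 0) - sop n \<theta> (gram i) k) \<and> (\<forall>j. i + 1 < j \<and> j \<le> n - 3 \<longrightarrow> z j = 0))"
  have "\<exists>z. P i z" if i: "i \<in> {1..n}" for i
  proof (rule defect_row[of i])
    fix z
    assume "\<And>k. 1 \<le> k \<Longrightarrow> k \<le> n \<Longrightarrow>
        adiff \<theta> 3 (cutoff (n - 1) (adiff \<theta> 4 (cutoff (n - 2) (adiff \<theta> 5 (cutoff (n - 3) z))))) k =
        (if k = i then 1 else 0) - sop n \<theta> (gram i) k"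
      and "\<And>j. i + 1 < j \<Longrightarrow> j \<le> n - 3 \<Longrightarrow> z j = 0"
    then show ?thesis
      unfolding P_def by blast
  qed (use i in auto)
  then obtain z where Pz: "\<And>i. i \<in> {1..n} \<Longrightarrow> P i (z i)"
    using bchoice[of "{1..n}" P] by blast
  then have z: "adiff \<theta> 3 (cutoff (n - 1) (adiff \<theta> 4 (cutoff (n - 2) (adiff \<theta> 5 (cutoff (n - 3) (z i)))))) k =
      (if k = i then 1 else 0) - sop n \<theta> (gram i) k" if "1 \<le> i" "i \<le> n" "1 \<le> k" "k \<le> n" for i k
    using that unfolding P_def by simp
  have band: "z i j = 0" if "1 \<le> i" "i \<le> n" "i + 1 < j" "j \<le> n - 3" for i j
    using Pz[of i] that unfolding P_def by simp
  define Z where "Z = mat n (n - 3) (\<lambda>(i, j). z (Suc i) (Suc j))"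
  show thesis
  proof (rule that[of Z])
    show "1\<^sub>m n - Gram n \<theta> * Smat n \<theta> = Z * (Dmat n \<theta> 5 * Dmat n \<theta> 4 * Dmat n \<theta> 3)"
    proof (rule eq_rowI)
      fix i
      assume "i < dim_row (Z * (Dmat n \<theta> 5 * Dmat n \<theta> 4 * Dmat n \<theta> 3))"
      then have i: "i < n"
        by (simp add: Z_def)
      have "row Z i = svec (n - 3) (z (Suc i))"
        using i by (intro eq_vecI) (auto simp: Z_def)
      \<comment> \<open>A row of Z times D_5 D_4 D_3 is the transposed product applied to that row,
        which is the form delivered by \<open>defect_row\<close>.\<close>
      moreover have "row (Z * (Dmat n \<theta> 5 * Dmat n \<theta> 4 * Dmat n \<theta> 3)) i = dtmul n \<theta> (row Z i)"
        using i by (subst row_mult_mat) (simp_all add: Z_def dtmul_def transpose_mult_dim mult_mat_vec_assoc)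
      ultimately have "row (Z * (Dmat n \<theta> 5 * Dmat n \<theta> 4 * Dmat n \<theta> 3)) i =
          svec n (\<lambda>k. (if k = Suc i then 1 else 0) - sop n \<theta> (gram (Suc i)) k)"
        using i by (simp only: dtmul_svec) (intro svec_cong z, auto)
      moreover have "row (Gram n \<theta> * Smat n \<theta>) i = svec n (sop n \<theta> (gram (Suc i)))"
        using i by (subst row_mult_mat) (simp_all add: Smat_transpose row_Gram Smat_svec)
      moreover have "row (A - B) i = row A i - row B i" if "i < dim_row B" "dim_col A = dim_col B" "dim_row A = dim_row B"
        for A B :: "real mat"
        using that by (intro eq_vecI) auto
      from this[of "Gram n \<theta> * Smat n \<theta>" "1\<^sub>m n"]
      have "row (1\<^sub>m n - Gram n \<theta> * Smat n \<theta>) i = row (1\<^sub>m n) i - row (Gram n \<theta> * Smat n \<theta>) i"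
        using i by simp
      moreover have "row (1\<^sub>m n) i - svec n f = svec n (\<lambda>k. (if k = Suc i then 1 else 0) - f k)" for f
        using i by (intro eq_vecI) auto
      ultimately show "row (1\<^sub>m n - Gram n \<theta> * Smat n \<theta>) i = row (Z * (Dmat n \<theta> 5 * Dmat n \<theta> 4 * Dmat n \<theta> 3)) i"
        by simp
    qed (simp_all add: Z_def)
  qed (simp_all add: Z_def band)
qed

text \<open>The factorization of part (a), transposed; symmetry of both matrices reverses their
  order. It turns the unknown product with Z into the solution of triangular systems.\<close>

lemma defect_apply:
  assumes Z: "Z \<in> carrier_mat n (n - 3)"
    "1\<^sub>m n - Gram n \<theta> * Smat n \<theta> = Z * (Dmat n \<theta> 5 * Dmat n \<theta> 4 * Dmat n \<theta> 3)"
  shows "dtmul n \<theta> (Z\<^sup>T *\<^sub>v svec n v) = svec n v - Smat n \<theta> *\<^sub>v (Gram n \<theta> *\<^sub>v svec n v)"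
proof -
  have "dtmul n \<theta> (Z\<^sup>T *\<^sub>v svec n v) = (Z * (Dmat n \<theta> 5 * Dmat n \<theta> 4 * Dmat n \<theta> 3))\<^sup>T *\<^sub>v svec n v"
    using Z(1) by (simp add: dtmul_def transpose_mult_dim mult_mat_vec_assoc)
  also have "\<dots> = (1\<^sub>m n - Gram n \<theta> * Smat n \<theta>)\<^sup>T *\<^sub>v svec n v"
    unfolding Z(2) ..
  also have "(1\<^sub>m n - Gram n \<theta> * Smat n \<theta>)\<^sup>T = 1\<^sub>m n - Smat n \<theta> * Gram n \<theta>"
    by (subst transpose_minus[of _ n n]) (auto simp: transpose_mult_dim Smat_transpose Gram_transpose intro!: mult_carrier_mat[of _ n n])
  also have "\<dots> *\<^sub>v svec n v = svec n v - Smat n \<theta> *\<^sub>v (Gram n \<theta> *\<^sub>v svec n v)"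
    by (subst minus_mult_distrib_mat_vec[of _ n n]) (auto simp: mult_mat_vec_assoc intro!: mult_carrier_mat[of _ n n])
  finally show ?thesis .
qed

lemma Gram_trunc: "3 \<le> l \<Longrightarrow> l \<le> n + 3 \<Longrightarrow> Gram n \<theta> *\<^sub>v cvec n \<theta> l = svec n (trunc_moment (\<theta> l))"
  unfolding cvec_eq_svec Gram_svec by (rule svec_cong) (rule gram_trunc_coef)

lemma Gram_coef: "Gram n \<theta> *\<^sub>v svec n (coef s) = svec n (moment s)"
  unfolding Gram_svec by (rule svec_cong) (rule gram_coef)

lemma dmul_trunc:
  assumes "4 \<le> l" "l \<le> n"
  shows "dmul n \<theta> (Gram n \<theta> *\<^sub>v cvec n \<theta> l) = svec (n - 3) (\<lambda>k. 2 * bspline n \<theta> 6 k (\<theta> l))"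
proof -
  \<comment> \<open>An interior knot lies strictly to the left of \<open>\<beta>\<close>, so no left
    limit is involved in the values of the B-splines.\<close>
  have "\<theta> l < \<beta>"
    using knot_less[of l "n + 1"] knot_right[of "n + 1"] assms by simp
  then show ?thesis
    using assms by (subst Gram_trunc) (auto simp only: dmul_svec intro!: svec_cong bdiff_trunc_moment)
qed

lemma defect_trunc:
  assumes Z: "Z \<in> carrier_mat n (n - 3)"
    "1\<^sub>m n - Gram n \<theta> * Smat n \<theta> = Z * (Dmat n \<theta> 5 * Dmat n \<theta> 4 * Dmat n \<theta> 3)"
    and l: "4 \<le> l" "l \<le> n"
  shows "cvec n \<theta> l \<^sub>v* Z =
      mu (\<theta> (l - 2) - \<theta> (l - 3)) (\<theta> (l - 1) - \<theta> (l - 2)) (\<theta> l - \<theta> (l - 1)) (\<theta> (l + 1) - \<theta> l)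
        \<cdot>\<^sub>v canon_vec (n - 3) (l - 4)
      + kappa (\<theta> (l - 1) - \<theta> (l - 2)) (\<theta> l - \<theta> (l - 1)) (\<theta> (l + 1) - \<theta> l) (\<theta> (l + 2) - \<theta> (l + 1))
        \<cdot>\<^sub>v canon_vec (n - 3) (l - 3)
      + nu (\<theta> l - \<theta> (l - 1)) (\<theta> (l + 1) - \<theta> l) (\<theta> (l + 2) - \<theta> (l + 1)) (\<theta> (l + 3) - \<theta> (l + 2))
        \<cdot>\<^sub>v canon_vec (n - 3) (l - 2)"
    (is "_ = ?r")
proof -
  define q where "q = l - 3"
  have q: "l = q + 3" "1 \<le> q" "q + 3 \<le> n"
    using l by (auto simp: q_def)
  define z where "z = (\<lambda>k. (cvec n \<theta> l \<^sub>v* Z) $ (k - 1))"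
  have z: "cvec n \<theta> l \<^sub>v* Z = svec (n - 3) z"
    unfolding z_def using Z(1) by (intro vec_eq_svec) (auto simp: cvec_def)
  have "svec n (adiff \<theta> 3 (cutoff (n - 1) (adiff \<theta> 4 (cutoff (n - 2) (adiff \<theta> 5 (cutoff (n - 3) z)))))) =
      svec n (trunc_coef l) - Smat n \<theta> *\<^sub>v (Gram n \<theta> *\<^sub>v svec n (trunc_coef l))"
    unfolding dtmul_svec[symmetric] z[symmetric] unfolding cvec_eq_svec by (rule defect_apply[OF Z])
  also have "\<dots> = svec n (trunc_coef l) - svec n (sop n \<theta> (trunc_moment (\<theta> l)))"
    using l by (simp add: Gram_trunc[unfolded cvec_eq_svec] Smat_svec)
  also have "\<dots> = svec n (\<lambda>k. trunc_coef l k - sop n \<theta> (trunc_moment (\<theta> l)) k)"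
    by (rule eq_vecI) auto
  finally have "adiff \<theta> 3 (cutoff (n - 1) (adiff \<theta> 4 (cutoff (n - 2) (adiff \<theta> 5 (cutoff (n - 3) z))))) k =
      trunc_coef (q + 3) k - sop n \<theta> (trunc_moment (\<theta> (q + 3))) k" if "1 \<le> k" "k \<le> n" for k
    using that unfolding svec_eq_iff q(1) by blast
  note defect = trunc_defect[OF q(2,3) this]
  have idx: "q + 3 - 2 = q + 1" "q + 3 - 3 = q" "q + 3 - 1 = q + 2" "q + 3 + 1 = q + 4"
    "q + 3 + 2 = q + 5" "q + 3 + 3 = q + 6" "q + 3 - 4 = q - 1"
    by simp_all
  show ?thesis
    unfolding z unfolding q(1) idx
  proof (rule eq_vecI)
    fix i
    assume "i < dim_vec (mu (\<theta> (q + 1) - \<theta> q) (\<theta> (q + 2) - \<theta> (q + 1)) (\<theta> (q + 3) - \<theta> (q + 2)) (\<theta> (q + 4) - \<theta> (q + 3))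
        \<cdot>\<^sub>v canon_vec (n - 3) (q - 1)
      + kappa (\<theta> (q + 2) - \<theta> (q + 1)) (\<theta> (q + 3) - \<theta> (q + 2)) (\<theta> (q + 4) - \<theta> (q + 3)) (\<theta> (q + 5) - \<theta> (q + 4))
        \<cdot>\<^sub>v canon_vec (n - 3) q
      + nu (\<theta> (q + 3) - \<theta> (q + 2)) (\<theta> (q + 4) - \<theta> (q + 3)) (\<theta> (q + 5) - \<theta> (q + 4)) (\<theta> (q + 6) - \<theta> (q + 5))
        \<cdot>\<^sub>v canon_vec (n - 3) (q + 1))"
    then have i: "i < n - 3"
      by (simp add: canon_vec_def)
    \<comment> \<open>For q = 1 the subtraction gives 0 and both sides are false, which matches the
      vanishing unit vector of index 0.\<close>
    have "i + 1 = q - 1 \<longleftrightarrow> i + 1 + 1 = q"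
      by auto
    then show "svec (n - 3) z $ i = (mu (\<theta> (q + 1) - \<theta> q) (\<theta> (q + 2) - \<theta> (q + 1)) (\<theta> (q + 3) - \<theta> (q + 2)) (\<theta> (q + 4) - \<theta> (q + 3))
        \<cdot>\<^sub>v canon_vec (n - 3) (q - 1)
      + kappa (\<theta> (q + 2) - \<theta> (q + 1)) (\<theta> (q + 3) - \<theta> (q + 2)) (\<theta> (q + 4) - \<theta> (q + 3)) (\<theta> (q + 5) - \<theta> (q + 4))
        \<cdot>\<^sub>v canon_vec (n - 3) q
      + nu (\<theta> (q + 3) - \<theta> (q + 2)) (\<theta> (q + 4) - \<theta> (q + 3)) (\<theta> (q + 5) - \<theta> (q + 4)) (\<theta> (q + 6) - \<theta> (q + 5))
        \<cdot>\<^sub>v canon_vec (n - 3) (q + 1)) $ i"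
      using i by (simp add: canon_vec_def defect)
  qed (simp add: canon_vec_def)
qed

section \<open>Kernels with the correction term\<close>

lemma kernel_matrix_transpose_apply:
  assumes U: "U \<in> carrier_mat (n - 3) (n - 3)"
  defines "M \<equiv> Smat n \<theta> + (Dmat n \<theta> 3)\<^sup>T * (Dmat n \<theta> 4)\<^sup>T * (Dmat n \<theta> 5)\<^sup>T * U *
      Dmat n \<theta> 5 * Dmat n \<theta> 4 * Dmat n \<theta> 3"
  shows "M \<in> carrier_mat n n"
    and "M\<^sup>T *\<^sub>v svec n g = Smat n \<theta> *\<^sub>v svec n g + dtmul n \<theta> (U\<^sup>T *\<^sub>v dmul n \<theta> (svec n g))"
proof -
  define N where "N = (Dmat n \<theta> 3)\<^sup>T * (Dmat n \<theta> 4)\<^sup>T * (Dmat n \<theta> 5)\<^sup>T * U *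
      Dmat n \<theta> 5 * Dmat n \<theta> 4 * Dmat n \<theta> 3"
  have N: "N \<in> carrier_mat n n"
    unfolding N_def by (rule carrier_matI) (simp_all only: index_mult_mat index_transpose_mat dim_Dmat)
  have M: "M = Smat n \<theta> + N"
    by (simp add: M_def N_def)
  show "M \<in> carrier_mat n n"
    using N by (simp add: M)
  have "N\<^sup>T *\<^sub>v svec n g = dtmul n \<theta> (U\<^sup>T *\<^sub>v dmul n \<theta> (svec n g))"
    using U by (simp add: N_def dtmul_def dmul_def transpose_mult_dim mult_mat_vec_assoc)
  moreover have "M\<^sup>T = Smat n \<theta> + N\<^sup>T"
    unfolding M transpose_add[OF Smat_carrier N] Smat_transpose ..
  then have "M\<^sup>T *\<^sub>v svec n g = Smat n \<theta> *\<^sub>v svec n g + N\<^sup>T *\<^sub>v svec n g"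
    using add_mult_distrib_mat_vec[of "Smat n \<theta>" n n "N\<^sup>T" "svec n g"] N by simp
  ultimately show "M\<^sup>T *\<^sub>v svec n g = Smat n \<theta> *\<^sub>v svec n g + dtmul n \<theta> (U\<^sup>T *\<^sub>v dmul n \<theta> (svec n g))"
    by (simp only:)
qed

text \<open>The difference matrices annihilate the moments of a square, so the correction
  contributes nothing, whatever U is, and S alone restores the coefficients.\<close>

lemma kernel_reproduces_square:
  assumes U: "U \<in> carrier_mat (n - 3) (n - 3)"
  shows "reproduces \<alpha> \<beta> (spline_kernel n \<theta> (Smat n \<theta> + (Dmat n \<theta> 3)\<^sup>T * (Dmat n \<theta> 4)\<^sup>T * (Dmat n \<theta> 5)\<^sup>T * U *
      Dmat n \<theta> 5 * Dmat n \<theta> 4 * Dmat n \<theta> 3)) (\<lambda>x. (s - x)\<^sup>2)"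
proof (rule reproduces_coef[where v = "coef s", OF kernel_matrix_transpose_apply(1)[OF U] marsden])
  have d: "dmul n \<theta> (svec n (moment s)) = 0\<^sub>v (n - 3)"
    unfolding dmul_svec using bdiff5_moment by (intro eq_vecI) auto
  have u: "U\<^sup>T *\<^sub>v 0\<^sub>v (n - 3) = svec (n - 3) (\<lambda>_. 0)"
    using U by (intro eq_vecI) auto
  have t: "dtmul n \<theta> (svec (n - 3) (\<lambda>_. 0)) = 0\<^sub>v n"
  proof -
    have "cutoff m (\<lambda>_. 0) = (\<lambda>_. 0)" "adiff \<theta> s (\<lambda>_. 0) = (\<lambda>_. 0)" for m s
      by (simp_all add: cutoff_def adiff_def fun_eq_iff)
    then show ?thesis
      unfolding dtmul_svec by (simp only:) (rule eq_vecI, simp_all)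
  qed
  have m: "Smat n \<theta> *\<^sub>v svec n (moment s) = svec n (coef s)"
    unfolding Smat_svec by (rule svec_cong) (rule sop_moment)
  show "(Smat n \<theta> + (Dmat n \<theta> 3)\<^sup>T * (Dmat n \<theta> 4)\<^sup>T * (Dmat n \<theta> 5)\<^sup>T * U *
      Dmat n \<theta> 5 * Dmat n \<theta> 4 * Dmat n \<theta> 3)\<^sup>T *\<^sub>v (Gram n \<theta> *\<^sub>v svec n (coef s)) = svec n (coef s)"
    unfolding Gram_coef kernel_matrix_transpose_apply(2)[OF U] d u t m
    by (rule right_zero_vec[OF svec_carrier])
qed


text \<open>The differences of the moments are the B-spline values in \<open>eq\<close>. So the
  correction becomes the transposed product applied to w_l, which by \<open>defect_apply\<close> is
  precisely the defect of S.\<close>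

lemma kernel_reproduces_trunc:
  assumes U: "U \<in> carrier_mat (n - 3) (n - 3)"
    and Z: "Z \<in> carrier_mat n (n - 3)"
    "1\<^sub>m n - Gram n \<theta> * Smat n \<theta> = Z * (Dmat n \<theta> 5 * Dmat n \<theta> 4 * Dmat n \<theta> 3)"
    and l: "4 \<le> l" "l \<le> n"
    and eq: "U\<^sup>T *\<^sub>v svec (n - 3) (\<lambda>k. 2 * bspline n \<theta> 6 k (\<theta> l)) = cvec n \<theta> l \<^sub>v* Z"
  shows "reproduces \<alpha> \<beta> (spline_kernel n \<theta> (Smat n \<theta> + (Dmat n \<theta> 3)\<^sup>T * (Dmat n \<theta> 4)\<^sup>T * (Dmat n \<theta> 5)\<^sup>T * U *
      Dmat n \<theta> 5 * Dmat n \<theta> 4 * Dmat n \<theta> 3)) (trunc_pow 2 (\<theta> l))"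
proof (rule reproduces_coef[where v = "trunc_coef l", OF kernel_matrix_transpose_apply(1)[OF U]])
  show "(\<Sum>j = 1..n. trunc_coef l j * quad j x) = trunc_pow 2 (\<theta> l) x" if "x \<in> {\<alpha>..\<beta>}" for x
    using that l by (intro trunc_marsden) auto
  define g where "g = trunc_moment (\<theta> l)"
  have G: "Gram n \<theta> *\<^sub>v svec n (trunc_coef l) = svec n g"
    unfolding g_def cvec_eq_svec[symmetric] by (rule Gram_trunc) (use l in auto)
  have dg: "dmul n \<theta> (svec n g) = svec (n - 3) (\<lambda>k. 2 * bspline n \<theta> 6 k (\<theta> l))"
    using dmul_trunc[OF l] unfolding cvec_eq_svec G .
  have "U\<^sup>T *\<^sub>v dmul n \<theta> (svec n g) = Z\<^sup>T *\<^sub>v svec n (trunc_coef l)"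
    unfolding dg using eq unfolding cvec_eq_svec .
  then have d: "dtmul n \<theta> (U\<^sup>T *\<^sub>v dmul n \<theta> (svec n g)) = svec n (trunc_coef l) - Smat n \<theta> *\<^sub>v svec n g"
    using defect_apply[OF Z, of "trunc_coef l"] unfolding G by (simp only:)
  have cancel: "svec n u + (svec n v - svec n u) = svec n v" for u v
    by (rule eq_vecI) auto
  show "(Smat n \<theta> + (Dmat n \<theta> 3)\<^sup>T * (Dmat n \<theta> 4)\<^sup>T * (Dmat n \<theta> 5)\<^sup>T * U *
      Dmat n \<theta> 5 * Dmat n \<theta> 4 * Dmat n \<theta> 3)\<^sup>T *\<^sub>v (Gram n \<theta> *\<^sub>v svec n (trunc_coef l)) = svec n (trunc_coef l)"
    unfolding G kernel_matrix_transpose_apply(2)[OF U] d Smat_svec by (rule cancel)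
qed

end

theorem proposition5p4:
  fixes n :: nat and \<alpha> \<beta> :: real and \<theta> :: "nat \<Rightarrow> real"
  assumes "simple_knot_vector n \<alpha> \<beta> \<theta>"
  shows "\<exists>Z \<in> carrier_mat n (n - 3).
    \<comment> \<open>(a)\<close>
    1\<^sub>m n - Gram n \<theta> * Smat n \<theta> = Z * (Dmat n \<theta> 5 * Dmat n \<theta> 4 * Dmat n \<theta> 3) \<and>
    (\<forall>i<n. \<forall>j<n - 3. j > i + 1 \<longrightarrow> Z $$ (i, j) = 0) \<and>
    \<comment> \<open>(b)\<close>
    (\<forall>l\<in>{4..n}.
      (\<forall>x\<in>{\<alpha>..\<beta>}. trunc_pow 2 (\<theta> l) x = Phi3 n \<theta> x \<bullet> cvec n \<theta> l) \<and>
      (let a = \<theta> (l - 2) - \<theta> (l - 3); b = \<theta> (l - 1) - \<theta> (l - 2); c = \<theta> l - \<theta> (l - 1);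
           d = \<theta> (l + 1) - \<theta> l; e = \<theta> (l + 2) - \<theta> (l + 1); f = \<theta> (l + 3) - \<theta> (l + 2)
       in cvec n \<theta> l \<^sub>v* Z =
            mu a b c d \<cdot>\<^sub>v canon_vec (n - 3) (l - 4)
            + kappa b c d e \<cdot>\<^sub>v canon_vec (n - 3) (l - 3)
            + nu c d e f \<cdot>\<^sub>v canon_vec (n - 3) (l - 2)) \<and>
      cvec n \<theta> l \<^sub>v* (Gram n \<theta> * (Dmat n \<theta> 3)\<^sup>T * (Dmat n \<theta> 4)\<^sup>T * (Dmat n \<theta> 5)\<^sup>T) =
        2 \<cdot>\<^sub>v vec (n - 3) (\<lambda>j. bspline n \<theta> 6 (j + 1) (\<theta> l))) \<and>
    (\<forall>b c d e. kappa b c d e = kappa e d c b \<and> kappa e c d b = kappa b d c e) \<and>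
    homogeneous_poly4 9 kappa_num \<and>
    \<comment> \<open>(c)\<close>
    (\<forall>(r :: nat) (l :: nat \<Rightarrow> nat) U3.
      strict_mono_on {1..r} l \<and> l ` {1..r} \<subseteq> {4..n} \<and>
      U3 \<in> carrier_mat (n - 3) (n - 3) \<and>
      (2 \<cdot>\<^sub>m mat r (n - 3) (\<lambda>(j, k). bspline n \<theta> 6 (k + 1) (\<theta> (l (j + 1))))) * U3 =
        mat r (n - 3) (\<lambda>(j, k). (cvec n \<theta> (l (j + 1)) \<^sub>v* Z) $ k) \<longrightarrow>
      (let L = spline_kernel n \<theta> (Smat n \<theta> +
                 (Dmat n \<theta> 3)\<^sup>T * (Dmat n \<theta> 4)\<^sup>T * (Dmat n \<theta> 5)\<^sup>T * U3 *
                 Dmat n \<theta> 5 * Dmat n \<theta> 4 * Dmat n \<theta> 3)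
       in (\<forall>p :: real poly. degree p \<le> 2 \<longrightarrow> reproduces \<alpha> \<beta> L (poly p)) \<and>
          (\<forall>j\<in>{1..r}. reproduces \<alpha> \<beta> L (trunc_pow 2 (\<theta> (l j))))))"
proof -
  interpret spline_knots n \<alpha> \<beta> \<theta>
    by unfold_locales (rule assms)
  obtain Z where Z: "Z \<in> carrier_mat n (n - 3)"
    "1\<^sub>m n - Gram n \<theta> * Smat n \<theta> = Z * (Dmat n \<theta> 5 * Dmat n \<theta> 4 * Dmat n \<theta> 3)"
    "\<And>i j. i < n \<Longrightarrow> j < n - 3 \<Longrightarrow> i + 1 < j \<Longrightarrow> Z $$ (i, j) = 0"
    by (rule defect_matrix) blast
  have trunc: "trunc_pow 2 (\<theta> l) x = Phi3 n \<theta> x \<bullet> cvec n \<theta> l"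
    if "x \<in> {\<alpha>..\<beta>}" "4 \<le> l" "l \<le> n" for x l
    using that trunc_marsden[of x l]
    by (simp add: Phi3_eq_svec cvec_eq_svec svec_scalar_prod mult.commute)
  have moments: "cvec n \<theta> l \<^sub>v* (Gram n \<theta> * (Dmat n \<theta> 3)\<^sup>T * (Dmat n \<theta> 4)\<^sup>T * (Dmat n \<theta> 5)\<^sup>T) =
      2 \<cdot>\<^sub>v vec (n - 3) (\<lambda>j. bspline n \<theta> 6 (j + 1) (\<theta> l))" if "4 \<le> l" "l \<le> n" for l
  proof -
    have "cvec n \<theta> l \<^sub>v* (Gram n \<theta> * (Dmat n \<theta> 3)\<^sup>T * (Dmat n \<theta> 4)\<^sup>T * (Dmat n \<theta> 5)\<^sup>T) =
        dmul n \<theta> (Gram n \<theta> *\<^sub>v cvec n \<theta> l)"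
      by (simp add: cvec_eq_svec dmul_def transpose_mult_dim mult_mat_vec_assoc Gram_transpose)
    also have "\<dots> = 2 \<cdot>\<^sub>v vec (n - 3) (\<lambda>j. bspline n \<theta> 6 (j + 1) (\<theta> l))"
      unfolding dmul_trunc[OF that] by (rule eq_vecI) auto
    finally show ?thesis .
  qed
  have reproduction: "let L = spline_kernel n \<theta> (Smat n \<theta> +
        (Dmat n \<theta> 3)\<^sup>T * (Dmat n \<theta> 4)\<^sup>T * (Dmat n \<theta> 5)\<^sup>T * U3 *
        Dmat n \<theta> 5 * Dmat n \<theta> 4 * Dmat n \<theta> 3)
      in (\<forall>p :: real poly. degree p \<le> 2 \<longrightarrow> reproduces \<alpha> \<beta> L (poly p)) \<and>
        (\<forall>j\<in>{1..r}. reproduces \<alpha> \<beta> L (trunc_pow 2 (\<theta> (l j))))"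
    if l: "l ` {1..r} \<subseteq> {4..n}" and U: "U3 \<in> carrier_mat (n - 3) (n - 3)"
      and eq: "(2 \<cdot>\<^sub>m mat r (n - 3) (\<lambda>(j, k). bspline n \<theta> 6 (k + 1) (\<theta> (l (j + 1))))) * U3 =
        mat r (n - 3) (\<lambda>(j, k). (cvec n \<theta> (l (j + 1)) \<^sub>v* Z) $ k)" (is "?A * U3 = ?B")
    for r l U3
    unfolding Let_def
  proof (intro conjI allI impI ballI)
    fix p :: "real poly"
    assume "degree p \<le> 2"
    with kernel_reproduces_square[OF U] show "reproduces \<alpha> \<beta> (spline_kernel n \<theta> (Smat n \<theta> +
        (Dmat n \<theta> 3)\<^sup>T * (Dmat n \<theta> 4)\<^sup>T * (Dmat n \<theta> 5)\<^sup>T * U3 *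
        Dmat n \<theta> 5 * Dmat n \<theta> 4 * Dmat n \<theta> 3)) (poly p)"
      by (rule reproduces_quadratic)
  next
    fix j
    assume j: "j \<in> {1..r}"
    then obtain i where i: "j = Suc i" "i < r"
      by (cases j) auto
    have "l j \<in> {4..n}"
      using l j by blast
    then have "4 \<le> l j" "l j \<le> n"
      by auto
    \<comment> \<open>This is one row of the matrix equation for U3, transposed.\<close>
    moreover have "U3\<^sup>T *\<^sub>v svec (n - 3) (\<lambda>k. 2 * bspline n \<theta> 6 k (\<theta> (l j))) = cvec n \<theta> (l j) \<^sub>v* Z"
    proof -
      have "svec (n - 3) (\<lambda>k. 2 * bspline n \<theta> 6 k (\<theta> (l j))) = row ?A i"
        using i by (intro eq_vecI) auto
      then have "U3\<^sup>T *\<^sub>v svec (n - 3) (\<lambda>k. 2 * bspline n \<theta> 6 k (\<theta> (l j))) = row (?A * U3) i"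
        using i U by (subst row_mult_mat) auto
      also have "\<dots> = cvec n \<theta> (l j) \<^sub>v* Z"
        unfolding eq using i Z(1) by (intro eq_vecI) auto
      finally show ?thesis .
    qed
    ultimately show "reproduces \<alpha> \<beta> (spline_kernel n \<theta> (Smat n \<theta> +
        (Dmat n \<theta> 3)\<^sup>T * (Dmat n \<theta> 4)\<^sup>T * (Dmat n \<theta> 5)\<^sup>T * U3 *
        Dmat n \<theta> 5 * Dmat n \<theta> 4 * Dmat n \<theta> 3)) (trunc_pow 2 (\<theta> (l j)))"
      by (rule kernel_reproduces_trunc[OF U Z(1,2)])
  qed
  show ?thesis
  proof (rule bexI[OF _ Z(1)], intro conjI)
    show "1\<^sub>m n - Gram n \<theta> * Smat n \<theta> = Z * (Dmat n \<theta> 5 * Dmat n \<theta> 4 * Dmat n \<theta> 3)"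
      by (rule Z(2))
    show "\<forall>i<n. \<forall>j<n - 3. j > i + 1 \<longrightarrow> Z $$ (i, j) = 0"
      using Z(3) by blast
    \<comment> \<open>Both equations are reversal, the second with its arguments renamed.\<close>
    show "\<forall>b c d e. kappa b c d e = kappa e d c b \<and> kappa e c d b = kappa b d c e"
      using kappa_reverse by blast
    show "homogeneous_poly4 9 kappa_num"
      by (rule homogeneous_poly4I[OF homogeneous_kappa_num, of 1 1 1 1]) (simp add: kappa_num_def)
  qed (use trunc moments defect_trunc[OF Z(1,2)] reproduction in \<open>auto simp only: Let_def Ball_def atLeastAtMost_iff\<close>)
qed

end
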